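(* For $w\in\mathfrak{h}$, we have \[ Z_{Y,X}^{\mathbin{\sqcup\!\sqcup}}\circ\sigma\circ\tau(w)=\rho\circ Z_{X,Y}^{\mathbin{\sqcup\!\sqcup}}\circ\sigma(w). \]
   Context: Multiple zeta values are $\zeta(k_1,\dots,k_d)=\sum_{0<m_1<\cdots<m_d}m_1^{-k_1}\cdots m_d^{-k_d}$ for positive integers $k_i$ with $k_d>1$. Let $\mathfrak{h}=\mathbb{Q}\langle x,y\rangle$ and $\mathfrak{h}^0=\mathbb{Q}\oplus y\mathfrak{h}x$. Let $Z:\mathfrak{h}^0\to\mathbb{R}$ be the linear map with $Z(yx^{k_1-1}\cdots yx^{k_d-1})=\zeta(k_1,\dots,k_d)$ (and $Z(1)=1$). Let $\sigma:\mathfrak{h}\to\mathfrak{h}[[T]]$ be the ring homomorphism with $\sigma(x)=x$, $\sigma(y)=y(1-xT)^{-1}$, and $\tau:\mathfrak{h}\to\mathfrak{h}$ the anti-automorphism with $\tau(x)=y$, $\tau(y)=x$. Any linear map is extended coefficientwise to formal power series in the parameters $T,A,B$. The shuffle product $\mathbin{\sqcup\!\sqcup}$ on $\mathfrak{h}$ is the bilinear map with $w\mathbin{\sqcup\!\sqcup}1=1\mathbin{\sqcup\!\sqcup}w=w$ and $u_1w_1\mathbin{\sqcup\!\sqcup}u_2w_2=u_1(w_1\mathbin{\sqcup\!\sqcup}u_2w_2)+u_2(u_1w_1\mathbin{\sqcup\!\sqcup}w_2)$ for $u_i\in\{x,y\}$, $w_i\in\mathfrak{h}$. Let $Z_{X,Y}^{\mathbin{\sqcup\!\sqcup}}:\mathfrak{h}\to\mathbb{R}[X,Y]$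 be the unique map with $Z_{X,Y}^{\mathbin{\sqcup\!\sqcup}}|_{\mathfrak{h}^0}=Z$, $Z_{X,Y}^{\mathbin{\sqcup\!\sqcup}}(w_1\mathbin{\sqcup\!\sqcup}w_2)=Z_{X,Y}^{\mathbin{\sqcup\!\sqcup}}(w_1)Z_{X,Y}^{\mathbin{\sqcup\!\sqcup}}(w_2)$, $Z_{X,Y}^{\mathbin{\sqcup\!\sqcup}}(x)=X$, $Z_{X,Y}^{\mathbin{\sqcup\!\sqcup}}(y)=Y$. Let $\rho:\mathbb{R}[X,Y]\to\mathbb{R}[[T]][X,Y]$ be the $\mathbb{R}$-linear map determined by $\rho(e^{AX+BY})=\frac{\Gamma(1+A)\Gamma(1-T+B)}{\Gamma(1+B)\Gamma(1-T+A)}e^{AX+BY}$ in $\mathbb{R}[[T]][X,Y][[A,B]]$ (Gamma quotients expanded as power series at the origin). *)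

theory Defs
  imports
    "HOL-Analysis.Analysis"
    "HOL-Computational_Algebra.Computational_Algebra"
    "HOL-Library.Poly_Mapping"
begin

section \<open>The free algebra on two letters\<close>

text \<open>With concatenation as addition, lists form the free monoid, and finitely supported
  functions on words, with the convolution product of \<^theory>\<open>HOL-Library.Poly_Mapping\<close>, form
  the noncommutative polynomial ring.\<close>

instantiation list :: (type) monoid_add
begin
definition zero_list :: "'a list" where "zero_list = []"
definition plus_list :: "'a list \<Rightarrow> 'a list \<Rightarrow> 'a list" where "plus_list = (@)"
instance by standard (simp_all add: zero_list_def plus_list_def)
end

datatype letter = LX | LY

type_synonym ncpoly = "letter list \<Rightarrow>\<^sub>0 rat"

definition word :: "letter list \<Rightarrow> ncpoly" where
  "word w = Poly_Mapping.single w 1"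

definition scal :: "rat \<Rightarrow> ncpoly" where
  "scal c = Poly_Mapping.single [] c"

abbreviation hx :: ncpoly where "hx \<equiv> word [LX]"
abbreviation hy :: ncpoly where "hy \<equiv> word [LY]"

definition h0 :: "ncpoly set" where
  "h0 = {scal c + hy * v * hx | c v. True}"

section \<open>Multiple zeta values\<close>

definition mzv :: "nat list \<Rightarrow> real" where
  "mzv ks = (\<Sum>\<^sub>\<infinity>ms\<in>{ms. length ms = length ks \<and> sorted_wrt (<) ms \<and> 0 \<notin> set ms}.
               \<Prod>i<length ks. 1 / real (ms ! i) ^ (ks ! i))"

definition index_word :: "nat list \<Rightarrow> letter list" where
  "index_word ks = concat (map (\<lambda>k. LY # replicate (k - 1) LX) ks)"

text \<open>On lists of positive integers \<^const>\<open>index_word\<close> is injective; \<open>Zconv\<close> is the linear map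
  sending \<open>word (index_word ks)\<close> to \<open>mzv ks\<close>. Only its values on \<^const>\<open>h0\<close> are
  meaningful.\<close>

definition word_index :: "letter list \<Rightarrow> nat list" where
  "word_index = inv_into {ks. 0 \<notin> set ks} index_word"

definition Zconv :: "ncpoly \<Rightarrow> real" where
  "Zconv w = (\<Sum>u\<in>Poly_Mapping.keys w. of_rat (Poly_Mapping.lookup w u) * mzv (word_index u))"

lemma index_word_Cons: "index_word (k # ks) = LY # replicate (k - 1) LX @ index_word ks"
  by (simp add: index_word_def)

lemma index_word_inj: "inj_on index_word {ks. 0 \<notin> set ks}"
proof -
  have tw: "takeWhile ((=) LX) (index_word ks) = []" for ks
    by (cases ks) (simp_all add: index_word_def)
  have "index_word ks = index_word ls \<Longrightarrow> 0 \<notin> set ks \<Longrightarrow> 0 \<notin> set ls \<Longrightarrow> ks = ls" for ks ls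
  proof (induction ks arbitrary: ls)
    case Nil
    then show ?case by (cases ls) (simp_all add: index_word_def)
  next
    case (Cons k ks)
    then obtain l ls' where ls: "ls = l # ls'"
      by (cases ls) (simp_all add: index_word_def)
    have eq: "replicate (k - 1) LX @ index_word ks = replicate (l - 1) LX @ index_word ls'"
      using Cons.prems(1) by (simp add: ls index_word_Cons)
    have tw': "takeWhile ((=) LX) (replicate n LX @ index_word js) = replicate n LX" for n js
      by (induction n) (simp_all add: tw)
    have "replicate (k - 1) LX = replicate (l - 1) LX"
      using arg_cong[OF eq, of "takeWhile ((=) LX)"] by (simp only: tw')
    hence "k - 1 = l - 1" by (metis length_replicate)
    with Cons.prems eq ls show ?case by (auto intro: Cons.IH)
  qed
  thus ?thesis by (auto simp: inj_on_def)
qed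

lemma word_index_index_word: "0 \<notin> set ks \<Longrightarrow> word_index (index_word ks) = ks"
  unfolding word_index_def by (rule inv_into_f_f[OF index_word_inj]) simp

lemma Zconv_index_word: "0 \<notin> set ks \<Longrightarrow> Zconv (word (index_word ks)) = mzv ks"
  by (simp add: Zconv_def word_def word_index_index_word)

section \<open>The maps sigma and tau\<close>

definition geom_x :: "ncpoly fps" where
  "geom_x = Abs_fps (\<lambda>n. hx ^ n)"

lemma geom_x_inverse:
  "(1 - fps_const hx * fps_X) * geom_x = 1" "geom_x * (1 - fps_const hx * fps_X) = 1"
proof -
  have "(fps_const hx * fps_X * geom_x) $ n = (if n = 0 then 0 else hx ^ n)" for n
    by (cases n) (simp_all add: geom_x_def mult.assoc fps_mult_fps_X_commute)
  moreover have "(geom_x * (fps_const hx * fps_X)) $ n = (if n = 0 then 0 else hx ^ n)" for n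
    by (cases n) (simp_all add: geom_x_def mult.assoc[symmetric] power_commutes)
  ultimately show "(1 - fps_const hx * fps_X) * geom_x = 1"
      "geom_x * (1 - fps_const hx * fps_X) = 1"
    by (auto simp: fps_eq_iff algebra_simps geom_x_def)
qed

fun sigma_letter :: "letter \<Rightarrow> ncpoly fps" where
  "sigma_letter LX = fps_const hx"
| "sigma_letter LY = fps_const hy * geom_x"

definition sigma_map :: "ncpoly \<Rightarrow> ncpoly fps" where
  "sigma_map w = (\<Sum>u\<in>Poly_Mapping.keys w.
     fps_const (scal (Poly_Mapping.lookup w u)) * prod_list (map sigma_letter u))"

lemma sum_keys_add:
  fixes f :: "'a \<Rightarrow> rat \<Rightarrow> 'b::comm_monoid_add"
  assumes "\<And>u. f u 0 = 0" "\<And>u c d. f u (c + d) = f u c + f u d"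
  shows "(\<Sum>u\<in>Poly_Mapping.keys (p + q). f u (Poly_Mapping.lookup (p + q) u)) =
    (\<Sum>u\<in>Poly_Mapping.keys p. f u (Poly_Mapping.lookup p u)) +
    (\<Sum>u\<in>Poly_Mapping.keys q. f u (Poly_Mapping.lookup q u))"
proof -
  have bound: "(\<Sum>u\<in>Poly_Mapping.keys r. f u (Poly_Mapping.lookup r u)) =
      (\<Sum>u\<in>K. f u (Poly_Mapping.lookup r u))"
    if "Poly_Mapping.keys r \<subseteq> K" "finite K" for r K
    using that by (intro sum.mono_neutral_left) (auto simp: in_keys_iff assms)
  define K where "K = Poly_Mapping.keys p \<union> Poly_Mapping.keys q"
  have "Poly_Mapping.keys p \<subseteq> K" "Poly_Mapping.keys q \<subseteq> K" "Poly_Mapping.keys (p + q) \<subseteq> K"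
    "finite K"
    using Poly_Mapping.keys_add[of p q] by (auto simp: K_def)
  thus ?thesis
    unfolding bound[OF \<open>Poly_Mapping.keys p \<subseteq> K\<close> \<open>finite K\<close>]
      bound[OF \<open>Poly_Mapping.keys q \<subseteq> K\<close> \<open>finite K\<close>]
      bound[OF \<open>Poly_Mapping.keys (p + q) \<subseteq> K\<close> \<open>finite K\<close>]
    by (simp add: lookup_add assms sum.distrib)
qed

lemma poly_mapping_additive_induct [case_names single add]:
  fixes p :: "'a \<Rightarrow>\<^sub>0 'b::comm_monoid_add"
  assumes "\<And>u c. P (Poly_Mapping.single u c)" "\<And>p q. P p \<Longrightarrow> P q \<Longrightarrow> P (p + q)"
  shows "P p"
proof (induction p rule: update_induct)
  case const
  show ?case using assms(1)[of undefined 0] by simp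
next
  case (update f a b)
  have "Poly_Mapping.update a b f = Poly_Mapping.single a b + f"
    using update by (intro poly_mapping_eqI)
      (auto simp: lookup_update lookup_add lookup_single when_def in_keys_iff)
  thus ?case using update assms by simp
qed

lemma scal_add: "scal (c + d) = scal c + scal d" and scal_0: "scal 0 = 0"
  and scal_mult: "scal (c * d) = scal c * scal d"
  by (simp_all add: scal_def single_add mult_single plus_list_def)

lemma scal_commute: "scal c * p = p * scal c"
proof (induction p rule: poly_mapping_additive_induct)
  case (single k v)
  show ?case by (simp add: scal_def mult_single plus_list_def mult.commute)
qed (simp add: algebra_simps)

lemma fps_scal_commute: "fps_const (scal c) * F = F * fps_const (scal c)"
  by (simp add: fps_eq_iff scal_commute)

lemma sigma_map_add: "sigma_map (p + q) = sigma_map p + sigma_map q"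
  unfolding sigma_map_def
  by (rule sum_keys_add)
     (simp_all add: scal_0 scal_add fps_const_add[symmetric] algebra_simps del: fps_const_add)

lemma sigma_map_single:
  "sigma_map (Poly_Mapping.single u c) = fps_const (scal c) * prod_list (map sigma_letter u)"
  by (simp add: sigma_map_def scal_0)

lemma sigma_map_mult: "sigma_map (p * q) = sigma_map p * sigma_map q"
proof (induction p rule: poly_mapping_additive_induct)
  case (single u c)
  show ?case
  proof (induction q rule: poly_mapping_additive_induct)
    case (single v d)
    have "fps_const (scal c) * fps_const (scal d) * (A * B) =
        fps_const (scal c) * A * (fps_const (scal d) * B)" for A B
      by (metis (no_types, lifting) fps_scal_commute mult.assoc)
    thus ?case
      by (simp add: mult_single sigma_map_single plus_list_def scal_mult fps_const_mult[symmetric]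
          del: fps_const_mult)
  qed (simp add: sigma_map_add algebra_simps)
qed (simp add: sigma_map_add algebra_simps)

lemma sigma_map_letters: "sigma_map hx = fps_const hx" "sigma_map hy = fps_const hy * geom_x"
  and sigma_map_1: "sigma_map 1 = 1"
proof -
  have 1: "scal 1 = 1" by (simp add: scal_def single_one[symmetric] zero_list_def del: single_one)
  show "sigma_map hx = fps_const hx" "sigma_map hy = fps_const hy * geom_x"
    unfolding word_def by (simp_all add: sigma_map_single word_def 1)
  show "sigma_map 1 = 1"
    using sigma_map_single[of "[]" 1] by (simp add: 1 scal_def[symmetric])
qed

fun swap_letter :: "letter \<Rightarrow> letter" where
  "swap_letter LX = LY"
| "swap_letter LY = LX"

definition tau_map :: "ncpoly \<Rightarrow> ncpoly" where
  "tau_map w = (\<Sum>u\<in>Poly_Mapping.keys w.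
     scal (Poly_Mapping.lookup w u) * word (rev (map swap_letter u)))"

lemma tau_map_add: "tau_map (p + q) = tau_map p + tau_map q"
  unfolding tau_map_def by (rule sum_keys_add) (simp_all add: scal_0 scal_add algebra_simps)

lemma tau_map_single:
  "tau_map (Poly_Mapping.single u c) = scal c * word (rev (map swap_letter u))"
  by (simp add: tau_map_def scal_0)

lemma tau_map_mult: "tau_map (p * q) = tau_map q * tau_map p"
proof (induction p rule: poly_mapping_additive_induct)
  case (single u c)
  show ?case
    by (induction q rule: poly_mapping_additive_induct)
       (simp_all add: mult_single tau_map_single plus_list_def scal_def word_def tau_map_add
          algebra_simps)
qed (simp add: tau_map_add algebra_simps)

lemma tau_map_letters: "tau_map hx = hy" "tau_map hy = hx"
  unfolding word_def by (simp_all add: tau_map_single scal_def word_def mult_single plus_list_def)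

section \<open>The shuffle product and shuffle regularization\<close>

fun shuffle_word :: "letter list \<Rightarrow> letter list \<Rightarrow> ncpoly" where
  "shuffle_word [] w = word w"
| "shuffle_word w [] = word w"
| "shuffle_word (u1 # w1) (u2 # w2) =
     word [u1] * shuffle_word w1 (u2 # w2) + word [u2] * shuffle_word (u1 # w1) w2"

definition shuffle :: "ncpoly \<Rightarrow> ncpoly \<Rightarrow> ncpoly" where
  "shuffle p q = (\<Sum>u\<in>Poly_Mapping.keys p. \<Sum>v\<in>Poly_Mapping.keys q.
     scal (Poly_Mapping.lookup p u * Poly_Mapping.lookup q v) * shuffle_word u v)"

text \<open>The ring of polynomials in \<open>X\<close>, \<open>Y\<close> is the iterated polynomial ring with \<open>X\<close> as the
  inner and \<open>Y\<close> as the outer variable.\<close>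

definition pX :: "'a::comm_ring_1 poly poly" where "pX = [:[:0, 1:]:]"
definition pY :: "'a::comm_ring_1 poly poly" where "pY = [:0, 1:]"

definition is_Zsh :: "real poly poly \<Rightarrow> real poly poly \<Rightarrow> (ncpoly \<Rightarrow> real poly poly) \<Rightarrow> bool" where
  "is_Zsh P Q f \<longleftrightarrow>
     (\<forall>v w. f (v + w) = f v + f w) \<and>
     (\<forall>c w. f (scal c * w) = smult [:of_rat c:] (f w)) \<and>
     (\<forall>w\<in>h0. f w = [:[:Zconv w:]:]) \<and>
     (\<forall>v w. f (shuffle v w) = f v * f w) \<and>
     f hx = P \<and> f hy = Q"

text \<open>The two arguments are the images of \<open>x\<close> and \<open>y\<close>; thus \<open>Zsh pX pY\<close> and \<open>Zsh pY pX\<close> are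
  the regularizations with subscripts \<open>X, Y\<close> and \<open>Y, X\<close>.\<close>

definition Zsh :: "real poly poly \<Rightarrow> real poly poly \<Rightarrow> ncpoly \<Rightarrow> real poly poly" where
  "Zsh P Q = (THE f. is_Zsh P Q f)"

section \<open>The map rho\<close>

definition coeffwise :: "('a \<Rightarrow> 'b) \<Rightarrow> 'a fps \<Rightarrow> 'b fps" where
  "coeffwise f F = Abs_fps (\<lambda>n. f (F $ n))"

text \<open>The Taylor series of \<open>\<Gamma>(1 + z)\<close> at \<open>z = 0\<close>.\<close>

definition gamma_fps :: "real fps" where
  "gamma_fps = Abs_fps (\<lambda>n. (deriv ^^ n) Gamma 1 / fact n)"

text \<open>\<open>subst_shift f\<close> is \<open>f(U - T)\<close> as a power series in \<open>U\<close> over power series in \<open>T\<close>: the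
  coefficient of \<open>U^i T^k\<close> comes from the binomial expansion of \<open>(U - T)^(i + k)\<close>.
  \<open>subst_plain f\<close> is \<open>f(U)\<close> in the same ring.\<close>

definition subst_shift :: "real fps \<Rightarrow> real fps fps" where
  "subst_shift f =
     Abs_fps (\<lambda>i. Abs_fps (\<lambda>k. (-1) ^ k * of_nat ((i + k) choose k) * f $ (i + k)))"

definition subst_plain :: "real fps \<Rightarrow> real fps fps" where
  "subst_plain f = coeffwise fps_const f"

text \<open>The target ring is \<open>\<real>[[T]][X, Y][[A]][[B]]\<close>, with \<open>B\<close> as the outermost variable.
  \<open>in_A\<close> and \<open>in_B\<close> embed \<open>\<real>[[T]][[U]]\<close> by substituting \<open>A\<close> and \<open>B\<close> for \<open>U\<close>.\<close>

definition in_A :: "real fps fps \<Rightarrow> real fps poly poly fps fps" where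
  "in_A F = fps_const (coeffwise (\<lambda>c. [:[:c:]:]) F)"

definition in_B :: "real fps fps \<Rightarrow> real fps poly poly fps fps" where
  "in_B F = coeffwise (\<lambda>c. fps_const [:[:c:]:]) F"

definition gamma_quot :: "real fps poly poly fps fps" where
  "gamma_quot =
     in_A (subst_plain gamma_fps) * in_B (subst_shift gamma_fps) *
     in_B (subst_plain (inverse gamma_fps)) * in_A (subst_shift (inverse gamma_fps))"

text \<open>The coefficient of \<open>A^a B^b\<close> in \<open>exp(A X + B Y)\<close> is \<open>X^a Y^b / (a! b!)\<close>.\<close>

definition exp_coeff :: "nat \<Rightarrow> nat \<Rightarrow> real poly poly" where
  "exp_coeff a b = monom (monom (1 / (fact a * fact b)) a) b"

definition exp_series :: "real poly poly fps fps" where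
  "exp_series = Abs_fps (\<lambda>b. Abs_fps (\<lambda>a. exp_coeff a b))"

definition is_rho :: "(real poly poly \<Rightarrow> real fps poly poly) \<Rightarrow> bool" where
  "is_rho r \<longleftrightarrow>
     (\<forall>p q. r (p + q) = r p + r q) \<and>
     (\<forall>c p. r (smult [:c:] p) = smult [:fps_const c:] (r p)) \<and>
     coeffwise (coeffwise r) exp_series =
       gamma_quot * coeffwise (coeffwise (map_poly (map_poly fps_const))) exp_series"

lemma ex1_is_rho: "\<exists>!r. is_rho r"
proof -
  define G where
    "G = gamma_quot * coeffwise (coeffwise (map_poly (map_poly fps_const))) exp_series"
  define W where "W a b = smult [:fps_const (fact a * fact b):] (G $ b $ a)" for a b
  define r where "r p = (\<Sum>b\<le>degree p. \<Sum>a\<le>degree (coeff p b).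
      smult [:fps_const (coeff (coeff p b) a):] (W a b))" for p
  define D :: "real poly poly \<Rightarrow> nat" where
    "D p = degree p + (\<Sum>b\<le>degree p. degree (coeff p b))" for p
  have D: "degree p \<le> D p" "degree (coeff p b) \<le> D p" for p b
  proof -
    show "degree p \<le> D p" by (simp add: D_def)
    show "degree (coeff p b) \<le> D p"
    proof (cases "b \<le> degree p")
      case True
      hence "degree (coeff p b) \<le> (\<Sum>b\<le>degree p. degree (coeff p b))"
        by (intro member_le_sum) auto
      thus ?thesis by (simp add: D_def)
    qed (simp add: coeff_eq_0)
  qed
  have r_bound: "r p = (\<Sum>b\<le>N. \<Sum>a\<le>N. smult [:fps_const (coeff (coeff p b) a):] (W a b))"
    if "D p \<le> N" for p N
  proof -
    have "r p = (\<Sum>b\<le>degree p. \<Sum>a\<le>N. smult [:fps_const (coeff (coeff p b) a):] (W a b))"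
      unfolding r_def
    proof (rule sum.cong[OF refl], rule sum.mono_neutral_left)
      fix b show "{..degree (coeff p b)} \<subseteq> {..N}" using D(2)[of p b] that by auto
    qed (auto simp: coeff_eq_0)
    also have "\<dots> = (\<Sum>b\<le>N. \<Sum>a\<le>N. smult [:fps_const (coeff (coeff p b) a):] (W a b))"
      using D(1)[of p] that by (intro sum.mono_neutral_left) (auto simp: coeff_eq_0)
    finally show ?thesis .
  qed
  have r_add: "r (p + q) = r p + r q" for p q
  proof -
    define N where "N = D p + D q + D (p + q)"
    have "D p \<le> N" "D q \<le> N" "D (p + q) \<le> N" by (auto simp: N_def)
    thus ?thesis
      by (simp add: r_bound sum.distrib[symmetric] smult_add_left[symmetric]
          fps_const_add[symmetric] del: fps_const_add)
  qed
  have r_scal: "r (smult [:c:] p) = smult [:fps_const c:] (r p)" for c p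
  proof -
    define N where "N = D p + D (smult [:c:] p)"
    have "D p \<le> N" "D (smult [:c:] p) \<le> N" by (auto simp: N_def)
    moreover have "smult a (sum g A) = (\<Sum>i\<in>A. smult a (g i))"
      for a and g :: "nat \<Rightarrow> real fps poly poly" and A
      by (induction A rule: infinite_finite_induct) (simp_all add: smult_add_right)
    ultimately show ?thesis
      by (simp add: r_bound fps_const_mult[symmetric] mult.commute del: fps_const_mult)
  qed
  have r_exp: "r (exp_coeff a b) = G $ b $ a" for a b
  proof -
    define N where "N = D (exp_coeff a b) + a + b"
    have "r (exp_coeff a b) = (\<Sum>b'\<le>N. \<Sum>a'\<le>N.
        smult [:fps_const (coeff (coeff (exp_coeff a b) b') a'):] (W a' b'))"
      by (rule r_bound) (simp add: N_def)
    also have "\<dots> = (\<Sum>b'\<le>N. if b' = b then \<Sum>a'\<le>N. if a' = a then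
        smult [:fps_const (1 / (fact a * fact b)):] (W a b) else 0 else 0)"
      by (intro sum.cong refl)
        (auto simp: exp_coeff_def if_distrib[of fps_const] if_distribR if_distrib[of "\<lambda>c. [:c:]"]
          if_distrib[of "\<lambda>c. smult c _"] cong: if_cong)
    also have "\<dots> = smult [:fps_const (1 / (fact a * fact b)):] (W a b)"
      by (simp add: N_def)
    also have "\<dots> = G $ b $ a" by (simp add: W_def one_pCons[symmetric])
    finally show ?thesis .
  qed
  have iff: "coeffwise (coeffwise s) exp_series = G \<longleftrightarrow> (\<forall>a b. s (exp_coeff a b) = G $ b $ a)"
    for s
    by (auto simp: coeffwise_def exp_series_def fps_eq_iff)
  show ?thesis
  proof (rule ex1I[of _ r])
    show "is_rho r"
      unfolding is_rho_def G_def[symmetric] iff using r_add r_scal r_exp by blast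
  next
    fix s assume "is_rho s"
    hence s_add: "\<And>p q. s (p + q) = s p + s q"
      and s_scal: "\<And>c p. s (smult [:c:] p) = smult [:fps_const c:] (s p)"
      and s_exp: "\<And>a b. s (exp_coeff a b) = G $ b $ a"
      unfolding is_rho_def G_def[symmetric] iff by blast+
    have s0: "s 0 = 0" and r0: "r 0 = 0"
      using s_add[of 0 0] r_add[of 0 0] by (metis add_0 add_cancel_right_right)+
    have s_sum: "s (sum g A) = (\<Sum>x\<in>A. s (g x))" and r_sum: "r (sum g A) = (\<Sum>x\<in>A. r (g x))"
      for g :: "nat \<Rightarrow> real poly poly" and A
      by (induction A rule: infinite_finite_induct; simp add: s0 r0 s_add r_add)+
    have mono: "s (monom (monom c a) b) = r (monom (monom c a) b)" for a b c
    proof -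
      have "monom (monom c a) b = smult [:c * (fact a * fact b):] (exp_coeff a b)"
        by (simp add: exp_coeff_def smult_monom)
      thus ?thesis by (simp only: s_scal r_scal s_exp r_exp)
    qed
    have "s (monom q b) = r (monom q b)" for q b
    proof -
      have "monom q b = monom (\<Sum>a\<le>degree q. monom (coeff q a) a) b"
        by (simp add: poly_as_sum_of_monoms)
      also have "\<dots> = (\<Sum>a\<le>degree q. monom (monom (coeff q a) a) b)"
        by (rule poly_eqI) (auto simp: coeff_sum)
      finally show ?thesis by (simp add: s_sum r_sum mono)
    qed
    hence "s (\<Sum>b\<le>degree p. monom (coeff p b) b) = r (\<Sum>b\<le>degree p. monom (coeff p b) b)" for p
      by (simp add: s_sum r_sum)
    thus "s = r" by (auto simp: poly_as_sum_of_monoms)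
  qed
qed

definition rho :: "real poly poly \<Rightarrow> real fps poly poly" where
  "rho = (THE r. is_rho r)"

text \<open>Both sides of the theorem are compared in \<open>\<real>[X, Y][[T]]\<close>, which contains
  \<open>\<real>[[T]][X, Y]\<close> through \<open>series_of_poly\<close>. The extension of \<^const>\<open>rho\<close> sends
  \<open>\<Sum>n. F $ n * T^n\<close> to \<open>\<Sum>n. rho (F $ n) * T^n\<close>; since \<open>rho (F $ n)\<close> involves \<open>T\<close> itself,
  this is a convolution.\<close>

definition series_of_poly :: "real fps poly poly \<Rightarrow> real poly poly fps" where
  "series_of_poly p = Abs_fps (\<lambda>n. map_poly (map_poly (\<lambda>c. c $ n)) p)"

definition rho_T :: "real poly poly fps \<Rightarrow> real poly poly fps" where
  "rho_T F = Abs_fps (\<lambda>n. \<Sum>k\<le>n. series_of_poly (rho (F $ k)) $ (n - k))"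

end

theory Submission
  imports
    Defs
    "HOL-Real_Asymp.Real_Asymp"
    "HOL-Complex_Analysis.Cauchy_Integral_Formula"
begin

unbundle no vec_syntax

text \<open>Grading all words by a formal variable \<open>t\<close>, the iterated integral of a word from \<open>0\<close> to \<open>t\<close>
  (regularized at \<open>0\<close>) is a power series satisfying a first-order differential equation, which
  makes it a character of the shuffle algebra. Convolving with the character of powers of
  \<open>log (1 - t)\<close> on \<open>y\<close> removes the divergence at \<open>t = 1\<close>, and the sum of the coefficients is the
  shuffle regularization at \<open>X = Y = 0\<close>; the general one is a convolution with the exponentials
  of \<open>X\<close> and \<open>Y\<close>.

  For a word \<open>x^a v y^b\<close> with \<open>v\<close> empty or in \<open>y h x\<close>, form the generating series in \<open>A\<close>, \<open>B\<close>, \<open>T\<close> of the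
  regularized values of the coefficients of its image under \<open>\<sigma>\<close>. The letter \<open>x\<close> then contributes a factor
  \<open>1/(m + A)\<close> and \<open>y\<close> a factor \<open>1/(m + A - T)\<close>, and Gauss' summation evaluates the trailing powers
  of \<open>y\<close>: the series is \<open>\<Gamma>(1 + B)\<close> times the sum of these products weighted by
  \<open>\<Gamma>(m + 1 + A - T) / \<Gamma>(m + 1 + A + B - T)\<close>, where \<open>m\<close> is the largest summation index. Up to a
  factor \<open>\<Gamma>(1 + B - T)\<close> this is the end point of a connected sum in the style of Seki and Yamamoto with connector
  \<open>\<Gamma>(m + 1 + A - T) \<Gamma>(n + 1 + B - T) / \<Gamma>(m + n + 1 + A + B - T)\<close>. Transporting the letters of \<open>v\<close> to the other side one by one
  produces the dual word with \<open>A\<close> and \<open>B\<close> exchanged, and the remaining Gamma factors are those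
  defining \<open>\<rho>\<close>. For convergence, \<open>A\<close> and \<open>B\<close> are specialized to negative multiples of \<open>T\<close>.\<close>
section \<open>Shuffles of words and characters\<close>

text \<open>Both factors come from the operator t d/dt, which multiplies the coefficient of t^m by
  m. Regularizing leading letters x at 0 adds A to it, and the relation \<sigma>(y) = y +
  \<sigma>(y) x T subtracts T for a word ending in y. The analytic difficulty is to interchange the
  sum over m with the expansion in A, B, T. After A = -\<alpha> T, B = -\<beta> T with \<alpha>,
  \<beta> > 0, the nested sums and the coefficients of (1 - t)^B have nonnegative coefficients in T,
  so Tonelli's theorem replaces uniform estimates, and putting a small number s for T leaves an
  identity between real functions. Nothing is lost: the coefficient of T^N of a specialized series
  is a polynomial in \<alpha>, \<beta> whose coefficients are those of total degree N in A, B, T, so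
  infinitely many specializations determine the formal series. The passage from this identity to
  \<rho> is algebraic: \<rho> multiplies exp(AX + BY) by the Gamma quotient, and this multiplication
  commutes with the one by the generating series of the regularized values.\<close>

fun shuffle_list :: "'a list \<Rightarrow> 'a list \<Rightarrow> 'a list list" where
  "shuffle_list [] v = [v]"
| "shuffle_list (a # u) [] = [a # u]"
| "shuffle_list (a # u) (b # v) = map ((#) a) (shuffle_list u (b # v)) @ map ((#) b) (shuffle_list (a # u) v)"

lemma shuffle_list_Nil2 [simp]: "shuffle_list u [] = [u]"
  by (cases u) auto

text \<open>The recursion of \<open>shuffle_list\<close> peels off first letters. The differential
  equation of \<open>polylog\<close> concerns last letters, so the mirrored recursion is
  needed.\<close>

lemma sum_shuffle_list_snoc:
  fixes f :: "'a list \<Rightarrow> 'b::comm_monoid_add"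
  shows "(\<Sum>w\<leftarrow>shuffle_list (u @ [p]) (v @ [q]). f w) =
    (\<Sum>w\<leftarrow>shuffle_list u (v @ [q]). f (w @ [p])) + (\<Sum>w\<leftarrow>shuffle_list (u @ [p]) v. f (w @ [q]))"
proof (induction "length u + length v" arbitrary: u v f rule: less_induct)
  case less
  show ?case
  proof (cases u)
    case u: Nil
    show ?thesis
    proof (cases v)
      case (Cons b v')
      have "(\<Sum>w\<leftarrow>shuffle_list ([] @ [p]) (v' @ [q]). f (b # w)) = (\<Sum>w\<leftarrow>shuffle_list [] (v' @ [q]). f (b # w @ [p])) +
         (\<Sum>w\<leftarrow>shuffle_list ([] @ [p]) v'. f (b # w @ [q]))"
        using less[of "[]" v' "\<lambda>w. f (b # w)"] by (simp add: u Cons)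
      then show ?thesis by (simp add: u Cons comp_def ac_simps)
    qed (simp add: u comp_def ac_simps)
  next
    case u: (Cons a u')
    have *: "(\<Sum>w\<leftarrow>shuffle_list (u' @ [p]) (v @ [q]). f (a # w)) = (\<Sum>w\<leftarrow>shuffle_list u' (v @ [q]). f (a # w @ [p])) +
         (\<Sum>w\<leftarrow>shuffle_list (u' @ [p]) v. f (a # w @ [q]))"
      using less[of u' v "\<lambda>w. f (a # w)"] by (simp add: u)
    show ?thesis
    proof (cases v)
      case Nil
      then show ?thesis using * by (simp add: u comp_def ac_simps)
    next
      case (Cons b v')
      have "(\<Sum>w\<leftarrow>shuffle_list (u @ [p]) (v' @ [q]). f (b # w)) = (\<Sum>w\<leftarrow>shuffle_list u (v' @ [q]). f (b # w @ [p])) +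
         (\<Sum>w\<leftarrow>shuffle_list (u @ [p]) v'. f (b # w @ [q]))"
        using less[of u v' "\<lambda>w. f (b # w)"] by (simp add: u Cons)
      then show ?thesis using * by (simp add: u Cons comp_def ac_simps)
    qed
  qed
qed

text \<open>The new letter q lands either behind p, in one of n + 1 slots that all give the same
  word, or before p. Solved for the word with n + 1 trailing letters q, this is a reduction step in
  the uniqueness of the regularization.\<close>

lemma sum_shuffle_list_insert:
  fixes f :: "'a list \<Rightarrow> 'b::semiring_1"
  shows "(\<Sum>w\<leftarrow>shuffle_list [q] (u @ [p] @ replicate n q). f w) =
    of_nat (Suc n) * f (u @ [p] @ replicate (Suc n) q) +
    (\<Sum>w\<leftarrow>shuffle_list [q] u. f (w @ [p] @ replicate n q))"
proof (induction n arbitrary: f)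
  case 0
  then show ?case using sum_shuffle_list_snoc[of f "[]" q u p] by simp
next
  case (Suc n)
  have rep: "q # replicate n q = replicate n q @ [q]" "q # replicate n q @ [q] = replicate n q @ [q, q]"
    by (simp_all flip: replicate_append_same)
  have "(\<Sum>w\<leftarrow>shuffle_list [q] (u @ [p] @ replicate (Suc n) q). f w) =
      f (u @ [p] @ replicate (Suc (Suc n)) q) + (\<Sum>w\<leftarrow>shuffle_list [q] (u @ [p] @ replicate n q). f (w @ [q]))"
    using sum_shuffle_list_snoc[of f "[]" q "u @ [p] @ replicate n q" q]
    by (simp add: rep)
  also have "(\<Sum>w\<leftarrow>shuffle_list [q] (u @ [p] @ replicate n q). f (w @ [q])) =
      of_nat (Suc n) * f (u @ [p] @ replicate (Suc (Suc n)) q) +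
      (\<Sum>w\<leftarrow>shuffle_list [q] u. f (w @ [p] @ replicate (Suc n) q))"
    using Suc.IH[of "\<lambda>w. f (w @ [q])"] by (simp add: replicate_append_same)
  finally show ?case by (simp add: algebra_simps)
qed

lemma sum_shuffle_list_replicate:
  fixes f :: "'a list \<Rightarrow> 'b::semiring_1"
  shows "(\<Sum>w\<leftarrow>shuffle_list [q] (replicate n q). f w) = of_nat (Suc n) * f (replicate (Suc n) q)"
proof (induction n arbitrary: f)
  case (Suc n)
  show ?case using Suc.IH[of "\<lambda>w. f (q # w)"] by (simp add: comp_def algebra_simps)
qed simp

lemma sum_shuffle_list_insert_front:
  fixes f :: "'a list \<Rightarrow> 'b::semiring_1"
  assumes "p \<noteq> q"
  shows "(\<Sum>w\<leftarrow>shuffle_list [q] (replicate n q @ p # u). f w) =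
    of_nat (Suc n) * f (replicate (Suc n) q @ p # u) +
    (\<Sum>w\<leftarrow>shuffle_list [q] u. f (replicate n q @ p # w))"
proof (induction n arbitrary: f)
  case 0
  then show ?case by (simp add: comp_def)
next
  case (Suc n)
  show ?case using Suc.IH[of "\<lambda>w. f (q # w)"] by (simp add: comp_def algebra_simps)
qed

lemma set_shuffle_list: "w \<in> set (shuffle_list u v) \<Longrightarrow> set w = set u \<union> set v"
proof (induction u v arbitrary: w rule: shuffle_list.induct)
  case (3 a u b v)
  then show ?case by fastforce
qed auto

lemma length_shuffle_list: "w \<in> set (shuffle_list u v) \<Longrightarrow> length w = length u + length v"
  by (induction u v arbitrary: w rule: shuffle_list.induct) auto

lemma length_shuffle_list_list: "length (shuffle_list u v) = (length u + length v) choose length u"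
proof (induction u v rule: shuffle_list.induct)
  case (3 a u b v)
  then show ?case by (simp add: add.commute)
qed auto

section \<open>Deconcatenation, and convolution of functionals on words\<close>

fun split_sum :: "('a list \<Rightarrow> 'a list \<Rightarrow> 'b::comm_monoid_add) \<Rightarrow> 'a list \<Rightarrow> 'b" where
  "split_sum F [] = F [] []"
| "split_sum F (a # w) = F [] (a # w) + split_sum (\<lambda>u. F (a # u)) w"

lemma split_sum_add: "split_sum (\<lambda>u v. F u v + G u v) w = split_sum F w + split_sum G w"
  by (induction w arbitrary: F G) (simp_all add: ac_simps)

lemma split_sum_snoc: "split_sum F (w @ [q]) = F (w @ [q]) [] + split_sum (\<lambda>u v. F u (v @ [q])) w"
  by (induction w arbitrary: F) (simp_all add: ac_simps)

lemma split_sum_0: "(\<And>u v. w = u @ v \<Longrightarrow> F u v = 0) \<Longrightarrow> split_sum F w = 0"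
  by (induction w arbitrary: F) auto

lemma split_sum_mult_left: "split_sum (\<lambda>u v. c * F u v) w = c * split_sum F w" for c :: "'b::semiring_0"
  by (induction w arbitrary: F) (simp_all add: algebra_simps)

lemma split_sum_mult_right: "split_sum (\<lambda>u v. F u v * c) w = split_sum F w * c" for c :: "'b::semiring_0"
  by (induction w arbitrary: F) (simp_all add: algebra_simps)

text \<open>\<open>split_sum\<close> runs over all factorizations of a word, that is, over its
  deconcatenation coproduct. Cutting a shuffle of u and v cuts both words and shuffles the left
  parts and the right parts separately, so the coproduct is multiplicative for the shuffle
  product.\<close>

lemma sum_shuffle_list_split_sum:
  "(\<Sum>w\<leftarrow>shuffle_list u v. split_sum F w) =
    split_sum (\<lambda>u1 u2. split_sum (\<lambda>v1 v2. \<Sum>w1\<leftarrow>shuffle_list u1 v1. \<Sum>w2\<leftarrow>shuffle_list u2 v2. F w1 w2) v) u"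
proof (induction u v arbitrary: F rule: shuffle_list.induct)
  case (3 a u b v)
  show ?case
    using 3(1)[of "\<lambda>u. F (a # u)"] 3(2)[of "\<lambda>u. F (b # u)"]
    by (simp add: comp_def split_sum_add sum_list_addf ac_simps)
qed simp_all

definition character :: "('a list \<Rightarrow> 'b::comm_ring_1) \<Rightarrow> bool" where
  "character f \<longleftrightarrow> f [] = 1 \<and> (\<forall>u v. (\<Sum>w\<leftarrow>shuffle_list u v. f w) = f u * f v)"

definition conv :: "('a list \<Rightarrow> 'b::comm_ring_1) \<Rightarrow> ('a list \<Rightarrow> 'b) \<Rightarrow> 'a list \<Rightarrow> 'b" where
  "conv f g = split_sum (\<lambda>u v. f u * g v)"

lemma character_conv:
  assumes "character f" "character g"
  shows "character (conv f g)"
proof -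
  have f: "(\<Sum>w\<leftarrow>shuffle_list u v. f w) = f u * f v" and g: "(\<Sum>w\<leftarrow>shuffle_list u v. g w) = g u * g v" for u v
    using assms by (auto simp: character_def)
  have prod: "(\<Sum>w1\<leftarrow>xs. \<Sum>w2\<leftarrow>ys. f w1 * g w2) = (\<Sum>w\<leftarrow>xs. f w) * (\<Sum>w\<leftarrow>ys. g w)" for xs ys
    by (simp add: sum_list_const_mult sum_list_mult_const)
  have "(\<Sum>w\<leftarrow>shuffle_list u v. conv f g w) =
      split_sum (\<lambda>u1 u2. split_sum (\<lambda>v1 v2. (f u1 * g u2) * (f v1 * g v2)) v) u" for u v
    unfolding conv_def sum_shuffle_list_split_sum prod f g by (simp add: mult_ac)
  also have "\<dots> u v = conv f g u * conv f g v" for u v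
    unfolding split_sum_mult_left split_sum_mult_right conv_def ..
  finally show ?thesis using assms by (simp add: character_def conv_def)
qed

text \<open>For e n = c^n / n! this is the exponential character sending p to c and every other
  letter to 0. It is used with c = log (1 - t) and with the prescribed images of x and y.\<close>

definition power_char :: "'a \<Rightarrow> (nat \<Rightarrow> 'b) \<Rightarrow> 'a list \<Rightarrow> 'b::comm_ring_1" where
  "power_char p e w = (if set w \<subseteq> {p} then e (length w) else 0)"

lemma character_power_char:
  assumes "e 0 = 1" "\<And>i j. e i * e j = of_nat ((i + j) choose i) * e (i + j)"
  shows "character (power_char p e)"
  unfolding character_def
proof (intro conjI allI)
  show "power_char p e [] = 1" using assms by (simp add: power_char_def)
  fix u v
  have "power_char p e w = (if set u \<union> set v \<subseteq> {p} then e (length u + length v) else 0)"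
    if "w \<in> set (shuffle_list u v)" for w
    using set_shuffle_list[OF that] length_shuffle_list[OF that] by (simp add: power_char_def)
  then have "map (power_char p e) (shuffle_list u v) =
      map (\<lambda>_. if set u \<union> set v \<subseteq> {p} then e (length u + length v) else 0) (shuffle_list u v)"
    by (intro map_cong refl) auto
  then have "(\<Sum>w\<leftarrow>shuffle_list u v. power_char p e w) = of_nat ((length u + length v) choose length u) *
      (if set u \<union> set v \<subseteq> {p} then e (length u + length v) else 0)"
    by (simp only: sum_list_triv length_shuffle_list_list)
  then show "(\<Sum>w\<leftarrow>shuffle_list u v. power_char p e w) = power_char p e u * power_char p e v"
    using assms by (simp add: power_char_def)
qed

lemma conv_power_char_left:
  assumes "z = [] \<or> hd z \<noteq> p"
  shows "conv (power_char p e) g (replicate a p @ z) = (\<Sum>i\<le>a. e i * g (replicate (a - i) p @ z))"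
proof -
  \<comment> \<open>The offset k carries the induction: moving one letter p into the prefix shifts
    the sequence e by one.\<close>
  have "split_sum (\<lambda>u v. power_char p (\<lambda>n. e (k + n)) u * g v) (replicate a p @ z) =
      (\<Sum>i\<le>a. e (k + i) * g (replicate (a - i) p @ z))" for k
  proof (induction a arbitrary: k)
    case 0
    show ?case using assms by (cases z) (auto simp: power_char_def split_sum_0)
  next
    case (Suc a)
    have "power_char p (\<lambda>n. e (k + n)) (p # u) = power_char p (\<lambda>n. e (Suc k + n)) u" for u
      by (simp add: power_char_def)
    then show ?case
      by (subst sum.atMost_Suc_shift) (use Suc[of "Suc k"] in \<open>simp add: power_char_def[of _ _ "[]"]\<close>)
  qed
  from this[of 0] show ?thesis by (simp add: conv_def)
qed

lemma conv_power_char_right: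
  assumes "z = [] \<or> last z \<noteq> q"
  shows "conv f (power_char q e) (z @ replicate b q) = (\<Sum>j\<le>b. f (z @ replicate (b - j) q) * e j)"
proof -
  have "split_sum (\<lambda>u v. f u * power_char q (\<lambda>n. e (k + n)) v) (z @ replicate b q) =
      (\<Sum>j\<le>b. f (z @ replicate (b - j) q) * e (k + j))" for k
  proof (induction b arbitrary: k)
    case 0
    show ?case using assms by (cases z rule: rev_cases) (auto simp: power_char_def split_sum_snoc split_sum_0)
  next
    case (Suc b)
    have *: "(\<lambda>u v. f u * power_char q (\<lambda>n. e (k + n)) (v @ [q])) = (\<lambda>u v. f u * power_char q (\<lambda>n. e (Suc k + n)) v)"
      by (simp add: power_char_def fun_eq_iff)
    have "z @ replicate (Suc b) q = (z @ replicate b q) @ [q]"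
      by (simp add: replicate_append_same)
    then show ?case
      by (subst sum.atMost_Suc_shift)
        (simp only: split_sum_snoc * Suc[of "Suc k"], simp add: power_char_def[of _ _ "[]"] replicate_append_same)
  qed
  from this[of 0] show ?thesis by (simp add: conv_def)
qed

section \<open>Linear functionals\<close>

definition lin_ext :: "(rat \<Rightarrow> 'a) \<Rightarrow> (letter list \<Rightarrow> 'a) \<Rightarrow> ncpoly \<Rightarrow> 'a::comm_ring_1" where
  "lin_ext h f p = (\<Sum>u\<in>Poly_Mapping.keys p. h (Poly_Mapping.lookup p u) * f u)"

locale rat_hom =
  fixes h :: "rat \<Rightarrow> 'a::comm_ring_1"
  assumes h0 [simp]: "h 0 = 0" and h1 [simp]: "h 1 = 1"
    and h_add: "h (c + d) = h c + h d" and h_mult: "h (c * d) = h c * h d"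
begin

lemma lin_ext_add: "lin_ext h f (p + q) = lin_ext h f p + lin_ext h f q"
  unfolding lin_ext_def by (rule sum_keys_add) (simp_all add: h_add algebra_simps)

lemma lin_ext_0 [simp]: "lin_ext h f 0 = 0"
  by (simp add: lin_ext_def)

lemma lin_ext_single: "lin_ext h f (Poly_Mapping.single u c) = h c * f u"
  by (simp add: lin_ext_def)

lemma lin_ext_word [simp]: "lin_ext h f (word u) = f u"
  by (simp add: word_def lin_ext_single)

lemma lin_ext_scal_mult: "lin_ext h f (scal c * p) = h c * lin_ext h f p"
proof (induction p rule: poly_mapping_additive_induct)
  case (single u d)
  then show ?case by (simp add: scal_def mult_single plus_list_def lin_ext_single h_mult mult.assoc)
qed (simp add: lin_ext_add algebra_simps)

lemma lin_ext_sum: "lin_ext h f (sum g A) = (\<Sum>i\<in>A. lin_ext h f (g i))"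
  by (induction A rule: infinite_finite_induct) (simp_all add: lin_ext_add)

lemma lin_ext_sum_list: "lin_ext h f (sum_list xs) = (\<Sum>x\<leftarrow>xs. lin_ext h f x)"
  by (induction xs) (simp_all add: lin_ext_add)

end

lemma word_mult: "word u * word v = word (u @ v)"
  by (simp add: word_def mult_single plus_list_def)

lemma shuffle_word_eq: "shuffle_word u v = (\<Sum>w\<leftarrow>shuffle_list u v. word w)"
  by (induction u v rule: shuffle_list.induct)
    (simp_all add: sum_list_const_mult[symmetric] word_mult comp_def)

context rat_hom begin

lemma lin_ext_shuffle:
  assumes "character f"
  shows "lin_ext h f (shuffle p q) = lin_ext h f p * lin_ext h f q"
proof -
  have "lin_ext h f (shuffle_word u v) = f u * f v" for u v
    using assms by (simp add: shuffle_word_eq lin_ext_sum_list comp_def character_def)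
  then have "lin_ext h f (shuffle p q) = (\<Sum>u\<in>Poly_Mapping.keys p. \<Sum>v\<in>Poly_Mapping.keys q.
      (h (Poly_Mapping.lookup p u) * f u) * (h (Poly_Mapping.lookup q v) * f v))"
    by (simp add: shuffle_def lin_ext_sum lin_ext_scal_mult h_mult mult_ac)
  also have "\<dots> = lin_ext h f p * lin_ext h f q"
    by (simp add: lin_ext_def sum_product)
  finally show ?thesis .
qed

end

section \<open>Polylogarithm series and regularized multiple zeta values\<close>

definition theta :: "real fps \<Rightarrow> real fps" where "theta F = fps_X * fps_deriv F"

lemma theta_nth [simp]: "theta F $ m = of_nat m * F $ m"
  by (cases m) (simp_all add: theta_def)

lemma theta_add: "theta (F + G) = theta F + theta G" and theta_diff: "theta (F - G) = theta F - theta G"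
  and theta_0 [simp]: "theta 0 = 0" and theta_1 [simp]: "theta 1 = 0" and theta_mult: "theta (F * G) = theta F * G + F * theta G"
  by (simp_all add: theta_def algebra_simps)

lemma theta_sum: "theta (sum f A) = (\<Sum>i\<in>A. theta (f i))"
  by (induction A rule: infinite_finite_induct) (simp_all add: theta_add)

lemma theta_sum_list: "theta (\<Sum>x\<leftarrow>xs. f x) = (\<Sum>x\<leftarrow>xs. theta (f x))"
  by (induction xs) (simp_all add: theta_add)

lemma theta_eqI: assumes "theta F = theta G" "F $ 0 = G $ 0" shows "F = G"
proof (rule fps_ext)
  fix m show "F $ m = G $ m"
    using assms(2) arg_cong[OF assms(1), of "\<lambda>F. F $ m"] by (cases m) simp_all
qed

text \<open>The forms dt/t and dt/(1 - t) divided by dt/t, to match \<open>theta\<close> = t d/dt: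
  the series of 1 and of t/(1 - t).\<close>

fun omega :: "letter \<Rightarrow> real fps" where
  "omega LX = 1"
| "omega LY = Abs_fps (\<lambda>m. if m = 0 then 0 else 1)"

lemma omega_LY_mult_nth: "(omega LY * F) $ m = (\<Sum>j<m. F $ j)"
proof -
  have "(omega LY * F) $ m = (F * omega LY) $ m" by (simp add: mult.commute)
  also have "\<dots> = (\<Sum>j=0..m. F $ j * (if m - j = 0 then 0 else 1))"
    by (simp add: fps_mult_nth)
  also have "\<dots> = (\<Sum>j<m. F $ j)"
    by (rule sum.mono_neutral_cong_right) auto
  finally show ?thesis .
qed

text \<open>The iterated integral of w is the sum over w = x^i u of (log t)^i / i! times
  \<open>polylog u\<close>. Differentiating the powers of log t removes a leading x; this is the
  correction term in the differential equation of \<open>polylog\<close>.\<close>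

definition strip_x :: "(letter list \<Rightarrow> 'b::zero) \<Rightarrow> letter list \<Rightarrow> 'b" where
  "strip_x f w = (case w of [] \<Rightarrow> 0 | a # u \<Rightarrow> if a = LX then f u else 0)"

lemma strip_x_simps [simp]: "strip_x f [] = 0" "strip_x f (LX # w) = f w" "strip_x f (LY # w) = 0"
  by (simp_all add: strip_x_def)

text \<open>Removing a leading x is a derivation of the shuffle product, because the first letter of
  a shuffle is the first letter of exactly one of the two words.\<close>

lemma sum_shuffle_list_strip_x:
  fixes f :: "letter list \<Rightarrow> 'b::comm_monoid_add"
  shows "(\<Sum>w\<leftarrow>shuffle_list u v. strip_x f w) =
    strip_x (\<lambda>u. \<Sum>w\<leftarrow>shuffle_list u v. f w) u + strip_x (\<lambda>v. \<Sum>w\<leftarrow>shuffle_list u v. f w) v"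
proof (cases "u = [] \<or> v = []")
  case True
  then show ?thesis by (auto simp: strip_x_def split: list.split)
next
  case False
  then obtain a u' b v' where "u = a # u'" "v = b # v'" by (meson neq_Nil_conv)
  then show ?thesis by (cases a; cases b) (simp_all add: comp_def)
qed

text \<open>The generating series in \<open>t\<close> of the iterated integral of a word from \<open>0\<close> to \<open>t\<close>,
  regularized at \<open>0\<close> by dropping all powers of \<open>log t\<close>. The quotient by \<open>m = 0\<close> is \<open>0\<close>.\<close>

function polylog :: "letter list \<Rightarrow> real fps" where
  "polylog w = (if w = [] then 1 else
     Abs_fps (\<lambda>m. (omega (last w) * polylog (butlast w) - (if hd w = LX then polylog (tl w) else 0)) $ m / of_nat m))"
  by auto
termination by (relation "Wellfounded.measure length") auto

declare polylog.simps [simp del]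

lemma polylog_Nil [simp]: "polylog [] = 1"
  by (simp add: polylog.simps)

lemma polylog_nth_0: "polylog w $ 0 = (if w = [] then 1 else 0)"
  by (subst polylog.simps) simp

lemma theta_polylog_aux:
  assumes "w \<noteq> []"
  shows "theta (polylog w) = omega (last w) * polylog (butlast w) - strip_x polylog w"
proof (rule fps_ext)
  fix m
  have strip_x: "strip_x polylog w = (if hd w = LX then polylog (tl w) else 0)"
    using assms by (cases w) (auto simp: strip_x_def)
  show "theta (polylog w) $ m = (omega (last w) * polylog (butlast w) - strip_x polylog w) $ m"
  proof (cases "m = 0")
    case False
    then show ?thesis
      by (subst polylog.simps) (simp add: assms strip_x)
  next
    case True
    \<comment> \<open>The definition sets coefficient 0 to 0 through the division by 0, so the
      right-hand side must have no constant term. Its two parts are both 1 for the word x and both 0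
      for every other nonempty word.\<close>
    have "(omega (last w) * polylog (butlast w)) $ 0 = strip_x polylog w $ 0"
    proof (cases w)
      case (Cons a u)
      show ?thesis
      proof (cases "u = []")
        case True
        then show ?thesis using Cons by (cases a) (simp_all add: polylog_nth_0)
      next
        case False
        then show ?thesis using Cons by (cases a) (simp_all add: polylog_nth_0)
      qed
    qed (use assms in simp)
    then show ?thesis using True by simp
  qed
qed

lemma theta_polylog: "theta (polylog (w @ [q])) = omega q * polylog w - strip_x polylog (w @ [q])"
  using theta_polylog_aux[of "w @ [q]"] by simp

text \<open>Both sides have the same image under \<open>theta\<close> and the same constant
  coefficient. The last-letter recursion of the shuffle together with the derivation property of
  \<open>strip_x\<close> reproduces the product rule.\<close>

lemma sum_shuffle_list_polylog: "(\<Sum>w\<leftarrow>shuffle_list u v. polylog w) = polylog u * polylog v"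
proof (induction "length u + length v" arbitrary: u v rule: less_induct)
  case less
  show ?case
  proof (cases "u = [] \<or> v = []")
    case False
    then obtain u' p v' q where uv: "u = u' @ [p]" "v = v' @ [q]"
      by (meson rev_exhaust)
    have Dx1: "strip_x (\<lambda>u. \<Sum>w\<leftarrow>shuffle_list u v. polylog w) u = strip_x polylog u * polylog v"
      using less by (auto simp: strip_x_def split: list.split)
    have Dx2: "strip_x (\<lambda>v. \<Sum>w\<leftarrow>shuffle_list u v. polylog w) v = polylog u * strip_x polylog v"
      using less by (auto simp: strip_x_def split: list.split)
    have ne: "w \<noteq> []" if "w \<in> set (shuffle_list u v)" for w
      using length_shuffle_list[OF that] False by auto
    have "theta (\<Sum>w\<leftarrow>shuffle_list u v. polylog w) = (\<Sum>w\<leftarrow>shuffle_list u v. omega (last w) * polylog (butlast w) - strip_x polylog w)"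
      unfolding theta_sum_list using ne by (intro arg_cong[of _ _ sum_list] map_cong refl theta_polylog_aux) auto
    also have "\<dots> = (\<Sum>w\<leftarrow>shuffle_list u v. omega (last w) * polylog (butlast w)) - (\<Sum>w\<leftarrow>shuffle_list u v. strip_x polylog w)"
      by (simp add: sum_list_subtractf)
    also have "(\<Sum>w\<leftarrow>shuffle_list u v. omega (last w) * polylog (butlast w)) =
        omega p * (\<Sum>w\<leftarrow>shuffle_list u' v. polylog w) + omega q * (\<Sum>w\<leftarrow>shuffle_list u v'. polylog w)"
      unfolding uv sum_shuffle_list_snoc by (simp add: sum_list_const_mult)
    also have "(\<Sum>w\<leftarrow>shuffle_list u' v. polylog w) = polylog u' * polylog v"
      by (rule less) (simp add: uv)
    also have "(\<Sum>w\<leftarrow>shuffle_list u v'. polylog w) = polylog u * polylog v'"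
      by (rule less) (simp add: uv)
    also have "omega p * (polylog u' * polylog v) + omega q * (polylog u * polylog v') - (\<Sum>w\<leftarrow>shuffle_list u v. strip_x polylog w) = theta (polylog u * polylog v)"
      unfolding theta_mult sum_shuffle_list_strip_x Dx1 Dx2 unfolding uv theta_polylog by (simp add: algebra_simps)
    finally have "theta (\<Sum>w\<leftarrow>shuffle_list u v. polylog w) = theta (polylog u * polylog v)" .
    moreover have "(\<Sum>w\<leftarrow>xs. polylog w) $ 0 = 0" if "\<And>w. w \<in> set xs \<Longrightarrow> w \<noteq> []" for xs
      using that by (induction xs) (auto simp: polylog_nth_0)
    then have "(\<Sum>w\<leftarrow>shuffle_list u v. polylog w) $ 0 = (polylog u * polylog v) $ 0"
      using ne False by (simp add: polylog_nth_0)
    ultimately show ?thesis by (rule theta_eqI)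
  qed auto
qed

lemma character_polylog: "character polylog"
  by (simp add: character_def sum_shuffle_list_polylog)

section \<open>Regularization at t = 1 by divided powers of log (1 - t)\<close>

definition ell :: "real fps" where
  "ell = Abs_fps (\<lambda>m. 1 / of_nat m)"

text \<open>\<open>ell\<close> is -log (1 - t), its constant coefficient being 0 by division by
  zero; hence this is log (1 - t)^j / j!, the coefficient of B^j in (1 - t)^B.\<close>

definition log_power :: "nat \<Rightarrow> real fps" where
  "log_power j = fps_const (1 / fact j) * (- ell) ^ j"

lemma theta_ell: "theta ell = omega LY"
  by (rule fps_ext) (simp add: ell_def)

lemma theta_uminus: "theta (- F) = - theta F"
  by (simp add: theta_def)

lemma theta_const_mult: "theta (fps_const c * F) = fps_const c * theta F"
  by (rule fps_ext) simp

lemma theta_power: "theta (F ^ Suc j) = of_nat (Suc j) * F ^ j * theta F"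
  by (induction j) (simp_all add: theta_mult algebra_simps)

lemma theta_log_power: "theta (log_power (Suc j)) = - (omega LY * log_power j)"
proof -
  have "fps_const (1 / fact (Suc j)) * of_nat (Suc j) = (fps_const (1 / fact j) :: real fps)"
    by (simp add: fps_of_nat[symmetric] fact_Suc del: of_nat_Suc)
  moreover have "theta (log_power (Suc j)) =
      - (omega LY * (fps_const (1 / fact (Suc j)) * of_nat (Suc j) * (- ell) ^ j))"
    unfolding log_power_def theta_const_mult theta_power theta_uminus theta_ell by (simp add: mult_ac del: of_nat_Suc)
  ultimately show ?thesis by (simp add: log_power_def)
qed

lemma log_power_0 [simp]: "log_power 0 = 1"
  by (simp add: log_power_def)

lemma log_power_nth_0: "log_power j $ 0 = (if j = 0 then 1 else 0)"
  by (simp add: log_power_def ell_def power_0_left fps_power_zeroth)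

lemma log_power_mult: "log_power i * log_power j = of_nat ((i + j) choose i) * log_power (i + j)"
proof -
  have "1 / fact i * (1 / fact j) = real ((i + j) choose i) * (1 / fact (i + j))"
    by (simp add: binomial_fact field_simps)
  then have "fps_const (1 / fact i) * fps_const (1 / fact j) =
      (of_nat ((i + j) choose i) * fps_const (1 / fact (i + j)) :: real fps)"
    by (simp add: fps_of_nat[symmetric])
  moreover have "log_power i * log_power j = fps_const (1 / fact i) * fps_const (1 / fact j) * (- ell) ^ (i + j)"
    unfolding log_power_def power_add by (simp only: mult_ac)
  ultimately show ?thesis by (simp only: log_power_def mult.assoc)
qed

text \<open>An integrating factor, written on coefficients of B: \<open>theta\<close> of (1 - t)^B
  is -B t/(1 - t) times (1 - t)^B, which cancels the term with \<open>omega LY\<close> and leaves (1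
  - t)^B times r.\<close>

lemma theta_log_power_conv:
  assumes "theta (A 0) = r 0" "\<And>b. theta (A (Suc b)) = omega LY * A b + r (Suc b)"
  shows "theta (\<Sum>j\<le>b. log_power j * A (b - j)) = (\<Sum>j\<le>b. log_power j * r (b - j))"
proof (cases b)
  case 0
  then show ?thesis using assms by simp
next
  case (Suc n)
  have A: "theta (A k) = (if k = 0 then 0 else omega LY * A (k - 1)) + r k" for k
    using assms by (cases k) auto
  have "theta (\<Sum>j\<le>b. log_power j * A (b - j)) =
      (\<Sum>j\<le>Suc n. theta (log_power j) * A (Suc n - j)) + (\<Sum>j\<le>Suc n. log_power j * theta (A (Suc n - j)))"
    by (simp add: theta_sum theta_mult sum.distrib Suc del: sum.atMost_Suc)
  also have "(\<Sum>j\<le>Suc n. theta (log_power j) * A (Suc n - j)) = - (\<Sum>j\<le>n. omega LY * log_power j * A (n - j))"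
    by (subst sum.atMost_Suc_shift) (simp add: theta_log_power sum_negf)
  also have "(\<Sum>j\<le>Suc n. log_power j * theta (A (Suc n - j))) =
      (\<Sum>j\<le>Suc n. log_power j * (if Suc n - j = 0 then 0 else omega LY * A (Suc n - j - 1))) + (\<Sum>j\<le>b. log_power j * r (b - j))"
    unfolding A by (simp add: algebra_simps sum.distrib Suc del: sum.atMost_Suc)
  also have "(\<Sum>j\<le>Suc n. log_power j * (if Suc n - j = 0 then 0 else omega LY * A (Suc n - j - 1))) =
      (\<Sum>j\<le>n. omega LY * log_power j * A (n - j))"
    by (simp add: mult_ac Suc_diff_le)
  finally show ?thesis by simp
qed

text \<open>On generating functions in \<open>B\<close> over the trailing powers \<open>y^b\<close> this is multiplication by
  \<open>(1 - t)^B\<close>, which removes the divergence at \<open>t = 1\<close>.\<close>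

definition polylog_reg :: "letter list \<Rightarrow> real fps" where
  "polylog_reg = conv polylog (power_char LY log_power)"

lemma character_polylog_reg: "character polylog_reg"
  unfolding polylog_reg_def by (intro character_conv character_polylog character_power_char) (simp_all add: log_power_mult)

lemma polylog_reg_append:
  assumes "w = [] \<or> last w = LX"
  shows "polylog_reg (w @ replicate b LY) = (\<Sum>j\<le>b. log_power j * polylog (w @ replicate (b - j) LY))"
  using assms unfolding polylog_reg_def by (subst conv_power_char_right) (auto simp: mult.commute)

lemma polylog_reg_Nil [simp]: "polylog_reg [] = 1"
  using polylog_reg_append[of "[]" 0] by simp

lemma polylog_reg_LX [simp]: "polylog_reg (w @ [LX]) = polylog (w @ [LX])"
  using polylog_reg_append[of "w @ [LX]" 0] by simp

text \<open>The generating series of the powers of y is (1 - t)^(-B), which the regularizing factor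
  cancels.\<close>

lemma polylog_reg_replicate_LY: "polylog_reg (replicate b LY) = (if b = 0 then 1 else 0)"
proof -
  have "strip_x polylog (replicate b LY) = 0" for b by (cases b) auto
  then have "theta (polylog (replicate (Suc b) LY)) = omega LY * polylog (replicate b LY) + 0" for b
    using theta_polylog[of "replicate b LY" LY] by (simp add: replicate_append_same)
  then have "theta (\<Sum>j\<le>b. log_power j * polylog (replicate (b - j) LY)) = (\<Sum>j\<le>b. log_power j * 0)"
    by (intro theta_log_power_conv[where r = "\<lambda>_. 0"]) simp_all
  then have "theta (polylog_reg (replicate b LY)) = 0"
    using polylog_reg_append[of "[]" b] by simp
  moreover have "polylog_reg (replicate b LY) $ 0 = (if b = 0 then 1 else 0)"
    using polylog_reg_append[of "[]" b]
    by (cases "b = 0") (auto simp: fps_sum_nth log_power_nth_0 polylog_nth_0 intro!: sum.neutral)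
  ultimately show ?thesis by - (rule theta_eqI, auto)
qed

text \<open>The integrating factor has removed the multiplication by t/(1 - t). What remains grows
  slowly enough that one division by m makes the coefficients summable.\<close>

lemma theta_polylog_reg:
  assumes "w = u @ [LX] @ replicate b LY"
  shows "theta (polylog_reg w) = log_power b * polylog u - strip_x polylog_reg w"
proof -
  define r where "r b = (if b = 0 then polylog u else 0) - strip_x polylog (u @ [LX] @ replicate b LY)" for b
  have "theta (polylog ((u @ [LX]) @ replicate (Suc b) LY)) = omega LY * polylog ((u @ [LX]) @ replicate b LY) + r (Suc b)" for b
    using theta_polylog[of "u @ [LX] @ replicate b LY" LY] by (simp add: replicate_append_same r_def)
  moreover have "theta (polylog ((u @ [LX]) @ replicate 0 LY)) = r 0"
    using theta_polylog[of u LX] by (simp add: r_def)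
  ultimately have *: "theta (polylog_reg w) = (\<Sum>j\<le>b. log_power j * r (b - j))"
    using theta_log_power_conv[of "\<lambda>b. polylog ((u @ [LX]) @ replicate b LY)" r b] polylog_reg_append[of "u @ [LX]" b]
    by (simp add: assms)
  also have "\<dots> = (\<Sum>j\<le>b. log_power j * (if b - j = 0 then polylog u else 0)) -
      (\<Sum>j\<le>b. log_power j * strip_x polylog (u @ [LX] @ replicate (b - j) LY))"
    by (simp add: r_def algebra_simps sum_subtractf)
  also have "(\<Sum>j\<le>b. log_power j * (if b - j = 0 then polylog u else 0)) = (\<Sum>j\<in>{b}. log_power j * polylog u)"
    by (rule sum.mono_neutral_cong_right) auto
  also have "(\<Sum>j\<le>b. log_power j * strip_x polylog (u @ [LX] @ replicate (b - j) LY)) = strip_x polylog_reg w"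
  proof (cases u)
    case Nil
    then show ?thesis using polylog_reg_append[of "[]" b] by (simp add: assms)
  next
    case (Cons a v)
    then show ?thesis using polylog_reg_append[of "v @ [LX]" b] by (cases a) (simp_all add: assms)
  qed
  finally show ?thesis by simp
qed

section \<open>Growth of coefficients\<close>

text \<open>The true size of the coefficients is a power of log m times 1/m. The logarithms are
  absorbed into a small power: the exponent -7/8 becomes 1/8 after partial summation and returns to
  -7/8 after division by m, so one exponent serves for all words.\<close>

definition power_bounded :: "real \<Rightarrow> (nat \<Rightarrow> real) \<Rightarrow> bool" where
  "power_bounded e a \<longleftrightarrow> (\<exists>C. \<forall>m\<ge>1. \<bar>a m\<bar> \<le> C * real m powr e)"

lemma power_bounded_add: assumes "power_bounded e a" "power_bounded e b" shows "power_bounded e (\<lambda>m. a m + b m)"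
proof -
  obtain C D where "\<forall>m\<ge>1. \<bar>a m\<bar> \<le> C * real m powr e" "\<forall>m\<ge>1. \<bar>b m\<bar> \<le> D * real m powr e"
    using assms by (auto simp: power_bounded_def)
  then have "\<forall>m\<ge>1. \<bar>a m + b m\<bar> \<le> (C + D) * real m powr e"
    by (smt (verit, best) distrib_right)
  then show ?thesis unfolding power_bounded_def by blast
qed

lemma power_bounded_cmult: assumes "power_bounded e a" shows "power_bounded e (\<lambda>m. c * a m)"
proof -
  obtain C where "\<forall>m\<ge>1. \<bar>a m\<bar> \<le> C * real m powr e"
    using assms by (auto simp: power_bounded_def)
  then have "\<forall>m\<ge>1. \<bar>c * a m\<bar> \<le> (\<bar>c\<bar> * C) * real m powr e"
    by (simp add: abs_mult mult.assoc mult_left_mono)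
  then show ?thesis unfolding power_bounded_def by blast
qed

lemma power_bounded_diff: assumes "power_bounded e a" "power_bounded e b" shows "power_bounded e (\<lambda>m. a m - b m)"
  using power_bounded_add[OF assms(1) power_bounded_cmult[OF assms(2), of "-1"]] by simp

lemma power_bounded_0: "(\<And>m. m \<ge> 1 \<Longrightarrow> a m = 0) \<Longrightarrow> power_bounded e a"
  unfolding power_bounded_def by (rule exI[of _ 0]) auto

lemma power_bounded_mono: assumes "power_bounded e a" "e \<le> e'" shows "power_bounded e' a"
proof -
  obtain C where C: "\<forall>m\<ge>1. \<bar>a m\<bar> \<le> C * real m powr e"
    using assms by (auto simp: power_bounded_def)
  have "\<bar>a m\<bar> \<le> \<bar>C\<bar> * real m powr e'" if "m \<ge> 1" for m
  proof -
    have "\<bar>a m\<bar> \<le> C * real m powr e" using C that by blast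
    also have "\<dots> \<le> \<bar>C\<bar> * real m powr e" by (intro mult_right_mono) auto
    also have "\<dots> \<le> \<bar>C\<bar> * real m powr e'"
      using that assms by (intro mult_left_mono powr_mono) auto
    finally show ?thesis .
  qed
  then show ?thesis unfolding power_bounded_def by blast
qed

lemma power_bounded_sum_list:
  assumes "\<And>x. x \<in> set xs \<Longrightarrow> power_bounded e (f x)"
  shows "power_bounded e (\<lambda>m. \<Sum>x\<leftarrow>xs. f x m)"
  using assms by (induction xs) (auto intro: power_bounded_add power_bounded_0)

lemma power_bounded_sum:
  assumes "\<And>x. x \<in> A \<Longrightarrow> power_bounded e (f x)"
  shows "power_bounded e (\<lambda>m. \<Sum>x\<in>A. f x m)"
  using assms by (induction A rule: infinite_finite_induct) (auto intro: power_bounded_add power_bounded_0)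

lemma power_bounded_divide:
  assumes "power_bounded e a" and b: "\<And>m. m \<ge> 1 \<Longrightarrow> \<bar>b m\<bar> \<le> D / real m"
  shows "power_bounded (e - 1) (\<lambda>m. a m * b m)"
proof -
  obtain C where C: "\<forall>m\<ge>1. \<bar>a m\<bar> \<le> C * real m powr e"
    using assms by (auto simp: power_bounded_def)
  have "\<bar>a m * b m\<bar> \<le> (C * D) * real m powr (e - 1)" if "m \<ge> 1" for m
  proof -
    have "\<bar>a m * b m\<bar> \<le> (C * real m powr e) * (D / real m)"
      unfolding abs_mult using C that by (intro mult_mono b) (auto intro: order_trans[OF abs_ge_zero])
    also have "\<dots> = (C * D) * real m powr (e - 1)"
      using that by (simp add: powr_diff)
    finally show ?thesis .
  qed
  then show ?thesis unfolding power_bounded_def by blast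
qed

lemma power_diff_le: "y ^ Suc n - z ^ Suc n \<le> real (Suc n) * y ^ n * (y - z)"
  if "0 \<le> z" "z \<le> y" for y z :: real
proof (induction n)
  case (Suc n)
  have "y ^ Suc (Suc n) - z ^ Suc (Suc n) = y * (y ^ Suc n - z ^ Suc n) + z ^ Suc n * (y - z)"
    by (simp add: algebra_simps)
  also have "\<dots> \<le> y * (real (Suc n) * y ^ n * (y - z)) + y ^ Suc n * (y - z)"
    using that Suc by (intro add_mono mult_left_mono mult_right_mono power_mono) auto
  also have "\<dots> = real (Suc (Suc n)) * y ^ Suc n * (y - z)"
    by (simp add: algebra_simps)
  finally show ?case .
qed simp

lemma power_bounded_partial_sums:
  assumes "power_bounded (-7/8) a"
  shows "power_bounded (1/8) (\<lambda>m. \<Sum>j<m. a j)"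
proof -
  obtain C where C: "\<forall>m\<ge>1. \<bar>a m\<bar> \<le> C * real m powr (-7/8)"
    using assms by (auto simp: power_bounded_def)
  have "C \<ge> 0" using C[rule_format, of 1] by simp
  \<comment> \<open>The comparison of the sum of m^(-7/8) with its integral, done algebraically: y
    and z are the eighth roots of m + 1 and m, and 1 = y^8 - z^8 is at most 8 y^7 (y - z).\<close>
  have step: "real (Suc m) powr (-7/8) \<le> 8 * (real (Suc m) powr (1/8) - real m powr (1/8))" for m
  proof -
    define y where "y = real (Suc m) powr (1/8)"
    define z where "z = real m powr (1/8)"
    have y: "y ^ 8 = real (Suc m)" and z: "z ^ 8 = real m"
      by (simp_all add: y_def z_def powr_power, cases "m = 0") (simp_all add: powr_power)
    have pos: "y > 0" "0 \<le> z" "z \<le> y" by (auto simp: y_def z_def intro: powr_mono2)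
    have "y ^ Suc 7 - z ^ Suc 7 \<le> real (Suc 7) * y ^ 7 * (y - z)"
      using pos by (intro power_diff_le) auto
    then have "1 \<le> 8 * y ^ 7 * (y - z)" using y z by simp
    then have "1 / y ^ 7 \<le> 8 * (y - z)" using pos by (simp add: field_simps)
    moreover have "1 / y ^ 7 = real (Suc m) powr (-7/8)"
    proof -
      have "y ^ 7 = y powr 7" using pos by simp
      also have "\<dots> = real (Suc m) powr (7/8)" by (simp only: y_def powr_powr) simp
      finally have "y ^ 7 = real (Suc m) powr (7/8)" .
      moreover have "(-7/8 :: real) = - (7/8)" by simp
      ultimately show ?thesis by (simp only: powr_minus_divide)
    qed
    ultimately show ?thesis by (simp add: y_def z_def)
  qed
  have *: "\<bar>\<Sum>j<Suc m. a j\<bar> \<le> \<bar>a 0\<bar> + 8 * C * real m powr (1/8)" for m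
  proof (induction m)
    case (Suc m)
    have "\<bar>\<Sum>j<Suc (Suc m). a j\<bar> \<le> \<bar>\<Sum>j<Suc m. a j\<bar> + \<bar>a (Suc m)\<bar>" by simp
    also have "\<dots> \<le> (\<bar>a 0\<bar> + 8 * C * real m powr (1/8)) + C * (8 * (real (Suc m) powr (1/8) - real m powr (1/8)))"
      using C[rule_format, of "Suc m"] mult_left_mono[OF step[of m] \<open>C \<ge> 0\<close>] Suc by linarith
    finally show ?case by (simp add: algebra_simps)
  qed simp
  have "\<bar>\<Sum>j<m. a j\<bar> \<le> (\<bar>a 0\<bar> + 8 * C) * real m powr (1/8)" if m: "m \<ge> 1" for m
  proof -
    obtain n where n: "m = Suc n" using m by (cases m) auto
    have "\<bar>\<Sum>j<m. a j\<bar> \<le> \<bar>a 0\<bar> + 8 * C * real n powr (1/8)" using * n by blast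
    also have "\<dots> \<le> \<bar>a 0\<bar> * real m powr (1/8) + 8 * C * real m powr (1/8)"
      using \<open>C \<ge> 0\<close> n
      by (intro add_mono mult_left_mono powr_mono2) (auto simp: ge_one_powr_ge_zero mult_le_cancel_left1)
    finally show ?thesis by (simp add: algebra_simps)
  qed
  then show ?thesis unfolding power_bounded_def by blast
qed

lemma power_bounded_summable:
  assumes "power_bounded e a" "e < -1"
  shows "summable (\<lambda>m. \<bar>a m\<bar>)"
proof -
  obtain C where C: "\<forall>m\<ge>1. \<bar>a m\<bar> \<le> C * real m powr e"
    using assms by (auto simp: power_bounded_def)
  show ?thesis
  proof (rule summable_comparison_test)
    show "\<exists>N. \<forall>n\<ge>N. norm \<bar>a n\<bar> \<le> C * real n powr e"
      using C by (intro exI[of _ 1]) auto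
    show "summable (\<lambda>n. C * real n powr e)"
      using assms by (intro summable_mult) (simp add: summable_real_powr_iff)
  qed
qed

lemma power_bounded_polylog: "power_bounded (-7/8) (fps_nth (polylog w))"
proof (induction "length w" arbitrary: w rule: less_induct)
  case less
  show ?case
  proof (cases "w = []")
    case True
    then show ?thesis by (intro power_bounded_0) simp
  next
    case False
    have IH: "power_bounded (-7/8) (fps_nth (polylog (butlast w)))" "power_bounded (-7/8) (fps_nth (polylog (tl w)))"
      by (rule less, simp add: False)+
    have "power_bounded (1/8) (fps_nth (omega (last w) * polylog (butlast w)))"
    proof (cases "last w")
      case LX
      then show ?thesis using IH(1) by (auto intro: power_bounded_mono)
    next
      case LY
      show ?thesis unfolding LY omega_LY_mult_nth using IH(1) by (rule power_bounded_partial_sums)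
    qed
    moreover have "power_bounded (1/8) (fps_nth (if hd w = LX then polylog (tl w) else 0))"
      using IH(2) by (auto intro: power_bounded_mono power_bounded_0)
    ultimately have "power_bounded (1/8) (\<lambda>m. (omega (last w) * polylog (butlast w) - (if hd w = LX then polylog (tl w) else 0)) $ m)"
      unfolding fps_sub_nth by (rule power_bounded_diff)
    from power_bounded_divide[OF this, of "\<lambda>m. 1 / real m" 1]
    have "power_bounded (-7/8) (\<lambda>m. (omega (last w) * polylog (butlast w) - (if hd w = LX then polylog (tl w) else 0)) $ m *
        (1 / real m))" by simp
    also have "(\<lambda>m. (omega (last w) * polylog (butlast w) - (if hd w = LX then polylog (tl w) else 0)) $ m *
        (1 / real m)) = fps_nth (polylog w)"
      using False by (subst (3) polylog.simps) (simp add: fun_eq_iff)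
    finally show ?thesis .
  qed
qed

lemma fps_nth_sum_list: "(\<Sum>x\<leftarrow>xs. f x) $ m = (\<Sum>x\<leftarrow>xs. f x $ m)"
  by (induction xs) simp_all

text \<open>No Cauchy product has to be estimated: by the shuffle identity the product is a finite
  sum of series already bounded. Powers of log (1 - t) are covered too, being up to sign the series
  of y^b.\<close>

lemma power_bounded_polylog_mult: "power_bounded (-7/8) (fps_nth (polylog u * polylog v))"
proof -
  have "fps_nth (polylog u * polylog v) = (\<lambda>m. \<Sum>w\<leftarrow>shuffle_list u v. polylog w $ m)"
    by (simp add: sum_shuffle_list_polylog[symmetric] fps_nth_sum_list fun_eq_iff)
  then show ?thesis by (simp only: power_bounded_sum_list[OF power_bounded_polylog])
qed

lemma polylog_replicate_LY: "polylog (replicate b LY) = fps_const ((-1) ^ b) * log_power b"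
proof (induction b)
  case (Suc b)
  have "strip_x polylog (replicate b LY @ [LY]) = 0" by (simp add: replicate_append_same)
  then have "theta (polylog (replicate (Suc b) LY)) = omega LY * (fps_const ((-1) ^ b) * log_power b)"
    using theta_polylog[of "replicate b LY" LY] by (simp add: replicate_append_same Suc)
  also have "\<dots> = - fps_const ((-1) ^ b) * - (omega LY * log_power b)"
    by (simp only: minus_mult_minus mult.left_commute)
  also have "\<dots> = theta (fps_const ((-1) ^ Suc b) * log_power (Suc b))"
    by (simp only: theta_const_mult theta_log_power fps_const_neg power_Suc mult_minus1)
  finally show ?case by (rule theta_eqI) (simp add: polylog_nth_0 log_power_nth_0)
qed simp

lemma log_power_eq_polylog: "log_power b = fps_const ((-1) ^ b) * polylog (replicate b LY)"
proof -
  have "fps_const ((-1) ^ b) * fps_const ((-1) ^ b :: real) = 1"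
    by (simp flip: power_mult_distrib)
  then show ?thesis unfolding polylog_replicate_LY by (metis mult.assoc mult_1)
qed

lemma power_bounded_log_power_polylog: "power_bounded (-7/8) (fps_nth (log_power b * polylog u))"
  unfolding log_power_eq_polylog mult.assoc fps_mult_left_const_nth by (intro power_bounded_cmult power_bounded_polylog_mult)

lemma word_split_LY:
  obtains b where "w = replicate b LY" | b u where "w = u @ [LX] @ replicate b LY"
proof -
  have "(\<exists>b. w = replicate b LY) \<or> (\<exists>b u. w = u @ [LX] @ replicate b LY)"
  proof (induction w rule: rev_induct)
    case (snoc q w)
    show ?case
    proof (cases q)
      case LX
      then show ?thesis by (metis append_Nil2 replicate_0)
    next
      case LY
      then show ?thesis using snoc by (metis append.assoc replicate_Suc replicate_append_same)
    qed
  qed (simp add: exI[of _ 0])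
  then show ?thesis using that by blast
qed

text \<open>Two passes: the expansion in powers of log (1 - t) gives the weak exponent -7/8, and
  with it the right-hand side of \<open>theta_polylog_reg\<close> is bounded by the same power, so
  dividing by m yields -15/8 < -1.\<close>

lemma power_bounded_polylog_reg: "power_bounded (-15/8) (fps_nth (polylog_reg w))"
proof (cases w rule: word_split_LY)
  case (1 b)
  then show ?thesis by (intro power_bounded_0) (simp add: polylog_reg_replicate_LY)
next
  case (2 b u)
  have weak: "power_bounded (-7/8) (fps_nth (polylog_reg v))" for v
  proof (cases v rule: word_split_LY)
    case (1 b)
    then show ?thesis by (intro power_bounded_0) (simp add: polylog_reg_replicate_LY)
  next
    case (2 b u)
    have "fps_nth (polylog_reg v) = (\<lambda>m. \<Sum>j\<le>b. (log_power j * polylog ((u @ [LX]) @ replicate (b - j) LY)) $ m)"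
      using polylog_reg_append[of "u @ [LX]" b] by (simp add: 2 fps_sum_nth fun_eq_iff)
    then show ?thesis by (simp only: power_bounded_sum[OF power_bounded_log_power_polylog])
  qed
  have "power_bounded (-7/8) (fps_nth (strip_x polylog_reg w))"
    using weak by (auto simp: strip_x_def power_bounded_0 split: list.split)
  then have "power_bounded (-7/8) (\<lambda>m. (log_power b * polylog u - strip_x polylog_reg w) $ m)"
    unfolding fps_sub_nth by (intro power_bounded_diff power_bounded_log_power_polylog)
  then have "power_bounded (-7/8) (\<lambda>m. theta (polylog_reg w) $ m)"
    by (simp only: theta_polylog_reg[OF 2])
  from power_bounded_divide[OF this, of "\<lambda>m. 1 / real m" 1]
  have "power_bounded (-15/8) (\<lambda>m. theta (polylog_reg w) $ m * (1 / real m))" by simp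
  then show ?thesis by (auto simp: power_bounded_def)
qed

lemma summable_polylog_reg: "summable (\<lambda>m. \<bar>polylog_reg w $ m\<bar>)"
  by (rule power_bounded_summable[OF power_bounded_polylog_reg]) simp

definition Zreg :: "letter list \<Rightarrow> real" where
  "Zreg w = suminf (fps_nth (polylog_reg w))"

lemma polylog_reg_sums: "(\<lambda>m. polylog_reg w $ m) sums Zreg w"
  unfolding Zreg_def by (rule summable_sums[OF summable_rabs_cancel[OF summable_polylog_reg]])

lemma sums_sum_list: "(\<And>x. x \<in> set xs \<Longrightarrow> f x sums g x) \<Longrightarrow>
    (\<lambda>m. \<Sum>x\<leftarrow>xs. f x m) sums (\<Sum>x\<leftarrow>xs. g x)" for f :: "'a \<Rightarrow> nat \<Rightarrow> real"
  by (induction xs) (auto intro: sums_add)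

text \<open>Evaluation at t = 1 of an absolutely convergent series is multiplicative for Cauchy
  products, so the shuffle identity of the series passes to their sums.\<close>

lemma character_Zreg: "character Zreg"
proof -
  have "(\<Sum>w\<leftarrow>shuffle_list u v. Zreg w) = Zreg u * Zreg v" for u v
  proof -
    have "(\<lambda>m. \<Sum>w\<leftarrow>shuffle_list u v. polylog_reg w $ m) sums (\<Sum>w\<leftarrow>shuffle_list u v. Zreg w)"
      by (intro sums_sum_list polylog_reg_sums)
    also have "(\<lambda>m. \<Sum>w\<leftarrow>shuffle_list u v. polylog_reg w $ m) = (\<lambda>m. (polylog_reg u * polylog_reg v) $ m)"
      using character_polylog_reg by (simp add: fps_nth_sum_list[symmetric] character_def)
    also have "\<dots> = (\<lambda>m. \<Sum>i\<le>m. polylog_reg u $ i * polylog_reg v $ (m - i))"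
      by (simp add: fps_mult_nth atLeast0AtMost)
    finally show ?thesis
      using Cauchy_product_sums[of "\<lambda>m. polylog_reg u $ m" "\<lambda>m. polylog_reg v $ m"] summable_polylog_reg
      by (auto simp: Zreg_def dest: sums_unique2)
  qed
  moreover have "Zreg [] = 1"
    using suminf_finite[of "{0}" "fps_nth (1 :: real fps)"] by (simp add: Zreg_def)
  ultimately show ?thesis by (simp add: character_def)
qed

lemma Zreg_LY: "Zreg [LY] = 0"
  using polylog_reg_replicate_LY[of 1] polylog_reg_sums[of "[LY]"] by (simp add: sums_iff)

lemma Zreg_LX: "Zreg [LX] = 0"
proof -
  have "theta (polylog [LX]) = theta 0" using theta_polylog[of "[]" LX] by simp
  then have "polylog [LX] = 0" by (rule theta_eqI) (simp add: polylog_nth_0)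
  then show ?thesis using polylog_reg_LX[of "[]"] polylog_reg_sums[of "[LX]"] by (simp add: sums_iff)
qed

lemma Zreg_sums_LX: "(\<lambda>m. polylog (w @ [LX]) $ m) sums Zreg (w @ [LX])"
  using polylog_reg_sums[of "w @ [LX]"] by simp

section \<open>The regularization map\<close>

lemma index_word_snoc: "index_word (ks @ [k]) = index_word ks @ LY # replicate (k - 1) LX"
  by (simp add: index_word_def)

lemma strip_x_index_word_append: "strip_x polylog (index_word ks @ LY # w) = 0"
  by (cases ks) (simp_all add: index_word_Cons index_word_def)

lemma polylog_index_word_snoc:
  "polylog (index_word ks @ LY # replicate n LX) $ m = (\<Sum>j<m. polylog (index_word ks) $ j) / real m ^ Suc n"
proof (induction n)
  case 0
  have "theta (polylog (index_word ks @ [LY])) $ m = (\<Sum>j<m. polylog (index_word ks) $ j)"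
    unfolding theta_polylog by (simp add: strip_x_index_word_append omega_LY_mult_nth del: omega.simps)
  then show ?case by (cases "m = 0") (auto simp: polylog_nth_0 field_simps)
next
  case (Suc n)
  have "strip_x polylog (index_word ks @ LY # replicate n LX @ [LX]) = 0"
    using strip_x_index_word_append[of ks "replicate n LX @ [LX]"] by simp
  then have "theta (polylog (index_word ks @ LY # replicate (Suc n) LX)) $ m = polylog (index_word ks @ LY # replicate n LX) $ m"
    using theta_polylog[of "index_word ks @ LY # replicate n LX" LX] by (simp add: replicate_append_same)
  then show ?case using Suc by (cases "m = 0") (auto simp: polylog_nth_0 field_simps)
qed

definition bounded_seqs :: "nat \<Rightarrow> nat \<Rightarrow> nat list set" where
  "bounded_seqs d m = {ms. length ms = d \<and> sorted_wrt (<) ms \<and> 0 \<notin> set ms \<and> (\<forall>x\<in>set ms. x < m)}"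

lemma finite_bounded_seqs: "finite (bounded_seqs d m)"
proof (rule finite_subset)
  show "bounded_seqs d m \<subseteq> {ms. set ms \<subseteq> {..<m} \<and> length ms = d}"
    by (auto simp: bounded_seqs_def)
qed (rule finite_lists_length_eq, simp)

lemma bounded_seqs_Suc:
  "bounded_seqs (Suc d) m = (\<lambda>(j, ms). ms @ [j]) ` (SIGMA j:{1..<m}. bounded_seqs d j)"
proof (intro equalityI subsetI)
  fix ms assume "ms \<in> bounded_seqs (Suc d) m"
  then show "ms \<in> (\<lambda>(j, ms). ms @ [j]) ` (SIGMA j:{1..<m}. bounded_seqs d j)"
    by (cases ms rule: rev_cases) (auto simp: bounded_seqs_def sorted_wrt_append intro!: image_eqI[of _ _ "(last ms, butlast ms)"])
qed (force simp: bounded_seqs_def sorted_wrt_append)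

definition seq_weight :: "nat list \<Rightarrow> nat list \<Rightarrow> real" where
  "seq_weight ks ms = (\<Prod>i<length ks. 1 / real (ms ! i) ^ (ks ! i))"

lemma seq_weight_snoc:
  "length ms = length ks \<Longrightarrow> seq_weight (ks @ [k]) (ms @ [m]) = seq_weight ks ms / real m ^ k"
  by (simp add: seq_weight_def nth_append)

lemma seq_weight_nonneg: "seq_weight ks ms \<ge> 0"
  by (simp add: seq_weight_def prod_nonneg)

lemma inj_snoc: "inj_on (\<lambda>(j, ms). ms @ [j]) A"
  by (auto simp: inj_on_def)

lemma sum_seq_weight:
  assumes "0 \<notin> set ks" "m \<ge> 1"
  shows "(\<Sum>ms\<in>bounded_seqs (length ks) m. seq_weight ks ms) = (\<Sum>j<m. polylog (index_word ks) $ j)"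
  using assms
proof (induction ks arbitrary: m rule: rev_induct)
  case Nil
  have "bounded_seqs 0 m = {[]}" by (auto simp: bounded_seqs_def)
  moreover have "(\<Sum>j<m. (1 :: real fps) $ j) = (\<Sum>j\<in>{0::nat}. 1)"
    by (rule sum.mono_neutral_cong_right) (use Nil in auto)
  ultimately show ?case by (simp add: seq_weight_def index_word_def)
next
  case (snoc k ks)
  have "(\<Sum>ms\<in>bounded_seqs (length (ks @ [k])) m. seq_weight (ks @ [k]) ms) =
      (\<Sum>(j, ms)\<in>(SIGMA j:{1..<m}. bounded_seqs (length ks) j). seq_weight (ks @ [k]) (ms @ [j]))"
    unfolding length_append_singleton bounded_seqs_Suc
    by (subst sum.reindex[OF inj_snoc]) (simp add: case_prod_unfold comp_def)
  also have "\<dots> = (\<Sum>j\<in>{1..<m}. \<Sum>ms\<in>bounded_seqs (length ks) j. seq_weight (ks @ [k]) (ms @ [j]))"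
    by (subst sum.Sigma) (simp_all add: finite_bounded_seqs)
  also have "\<dots> = (\<Sum>j\<in>{1..<m}. (\<Sum>ms\<in>bounded_seqs (length ks) j. seq_weight ks ms) / real j ^ k)"
    unfolding sum_divide_distrib
    by (intro sum.cong refl seq_weight_snoc) (auto simp: bounded_seqs_def)
  also have "\<dots> = (\<Sum>j\<in>{1..<m}. polylog (index_word (ks @ [k])) $ j)"
    using snoc by (intro sum.cong refl) (auto simp: index_word_snoc polylog_index_word_snoc)
  also have "\<dots> = (\<Sum>j<m. polylog (index_word (ks @ [k])) $ j)"
    by (intro sum.mono_neutral_left) (auto simp: polylog_nth_0 index_word_snoc Suc_le_eq)
  finally show ?case .
qed

text \<open>The last entry is at least 2, so the word ends in x and no regularization at 1 takes
  place. All terms are nonnegative, hence the series over the largest index unfolds into the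
  unordered sum defining \<open>mzv\<close>.\<close>

lemma Zreg_index_word:
  assumes ks: "0 \<notin> set ks"
  shows "Zreg (index_word (ks @ [Suc (Suc n)])) = mzv (ks @ [Suc (Suc n)])"
proof -
  define k where "k = Suc (Suc n)"
  define w where "w = index_word (ks @ [k])"
  have w: "w = (index_word ks @ LY # replicate n LX) @ [LX]"
    by (simp add: w_def k_def index_word_snoc replicate_append_same)
  have "(\<lambda>m. polylog w $ m) sums Zreg w"
    unfolding w by (rule Zreg_sums_LX)
  moreover have Lm: "polylog w $ m = (\<Sum>ms\<in>bounded_seqs (length ks) m. seq_weight ks ms) / real m ^ k"
    if "m \<ge> 1" for m
    using that sum_seq_weight[OF ks that] polylog_index_word_snoc[of ks "Suc n" m]
    by (simp add: w_def k_def index_word_snoc)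
  have nonneg: "polylog w $ m \<ge> 0" for m
    using Lm[of m] by (cases "m = 0") (auto simp: polylog_nth_0 w intro!: divide_nonneg_nonneg sum_nonneg seq_weight_nonneg)
  ultimately have "((\<lambda>m. polylog w $ m) has_sum Zreg w) UNIV"
    by (intro sums_nonneg_imp_has_sum) auto
  then have has: "((\<lambda>m. polylog w $ m) has_sum Zreg w) {1..}"
    by (rule has_sum_cong_neutral[THEN iffD1, rotated -1]) (auto simp: polylog_nth_0 w Suc_le_eq)
  define f where "f p = (case p of (m, ms) \<Rightarrow> seq_weight (ks @ [k]) (ms @ [m]))" for p
  have f: "((\<lambda>ms. f (m, ms)) has_sum polylog w $ m) (bounded_seqs (length ks) m)" if "m \<in> {1..}" for m
  proof -
    have "polylog w $ m = (\<Sum>ms\<in>bounded_seqs (length ks) m. f (m, ms))"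
      unfolding f_def Lm[OF that[unfolded atLeast_iff]] sum_divide_distrib prod.case
      by (intro sum.cong refl seq_weight_snoc[symmetric]) (auto simp: bounded_seqs_def)
    then show ?thesis using finite_bounded_seqs by (simp add: has_sum_finiteI)
  qed
  have fsum: "f summable_on (SIGMA m:{1..}. bounded_seqs (length ks) m)"
    using has by (intro summable_on_SigmaI[OF f]) (auto simp: f_def seq_weight_nonneg summable_on_def)
  have "(f has_sum Zreg w) (SIGMA m:{1..}. bounded_seqs (length ks) m)"
    by (rule has_sum_SigmaI[OF f has fsum])
  then have "(seq_weight (ks @ [k]) has_sum Zreg w)
      ((\<lambda>(j, ms). ms @ [j]) ` (SIGMA m:{1..}. bounded_seqs (length ks) m))"
    by (subst has_sum_reindex[OF inj_snoc]) (simp add: f_def[abs_def] comp_def case_prod_unfold)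
  also have "(\<lambda>(j, ms). ms @ [j]) ` (SIGMA m:{1..}. bounded_seqs (length ks) m) =
      {ms. length ms = length (ks @ [k]) \<and> sorted_wrt (<) ms \<and> 0 \<notin> set ms}"
  proof (intro equalityI subsetI)
    fix ms :: "nat list" assume "ms \<in> {ms. length ms = length (ks @ [k]) \<and> sorted_wrt (<) ms \<and> 0 \<notin> set ms}"
    then show "ms \<in> (\<lambda>(j, ms). ms @ [j]) ` (SIGMA m:{1..}. bounded_seqs (length ks) m)"
      by (cases ms rule: rev_cases) (auto simp: bounded_seqs_def sorted_wrt_append intro!: image_eqI[of _ _ "(last ms, butlast ms)"])
  qed (force simp: bounded_seqs_def sorted_wrt_append)
  finally show ?thesis
    by (simp add: mzv_def seq_weight_def[abs_def] w_def k_def infsumI)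
qed

lemma index_word_exists: "\<exists>ks k. 0 \<notin> set ks \<and> LY # z = index_word (ks @ [Suc k])"
proof (induction z rule: rev_induct)
  case Nil
  show ?case by (rule exI[of _ "[]"]) (auto simp: index_word_def intro!: exI[of _ 0])
next
  case (snoc q z)
  then obtain ks k where ks: "0 \<notin> set ks" "LY # z = index_word (ks @ [Suc k])" by blast
  show ?case
  proof (cases q)
    case LX
    then have "LY # z @ [q] = index_word (ks @ [Suc (Suc k)])"
      using ks(2) by (simp add: index_word_snoc replicate_append_same[symmetric])
    then show ?thesis using ks(1) by blast
  next
    case LY
    then have "LY # z @ [q] = index_word ((ks @ [Suc k]) @ [Suc 0])"
      using ks(2) unfolding index_word_snoc[of "ks @ [Suc k]"] by simp
    then show ?thesis using ks(1) by (intro exI[of _ "ks @ [Suc k]"] exI[of _ 0]) auto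
  qed
qed

lemma Zreg_eq_mzv: "Zreg (LY # z @ [LX]) = mzv (word_index (LY # z @ [LX]))"
proof -
  obtain ks k where ks: "0 \<notin> set ks" "LY # z = index_word (ks @ [Suc k])"
    using index_word_exists by blast
  then have w: "LY # z @ [LX] = index_word (ks @ [Suc (Suc k)])"
    by (simp add: index_word_snoc replicate_append_same[symmetric])
  show ?thesis unfolding w using ks(1) by (simp add: Zreg_index_word word_index_index_word)
qed

lemma mzv_Nil: "mzv [] = 1"
proof -
  have "{ms :: nat list. length ms = length ([] :: nat list) \<and> sorted_wrt (<) ms \<and> 0 \<notin> set ms} = {[]}"
    by auto
  then show ?thesis by (simp add: mzv_def)
qed

lemma Zconv_add: "Zconv (p + q) = Zconv p + Zconv q"
  unfolding Zconv_def by (rule sum_keys_add) (simp_all add: of_rat_add algebra_simps)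

lemma Zconv_single: "Zconv (Poly_Mapping.single u c) = of_rat c * mzv (word_index u)"
  by (simp add: Zconv_def)

section \<open>The regularization with polynomial values: existence and uniqueness\<close>

definition qconst :: "rat \<Rightarrow> real poly poly" where
  "qconst c = [:[:of_rat c:]:]"

interpretation qc: rat_hom qconst
  by standard (simp_all add: qconst_def of_rat_add of_rat_mult one_pCons)

definition Zreg_poly :: "letter list \<Rightarrow> real poly poly" where
  "Zreg_poly w = [:[:Zreg w:]:]"

definition divpow :: "real poly poly \<Rightarrow> nat \<Rightarrow> real poly poly" where
  "divpow P n = [:[:1 / fact n:]:] * P ^ n"

text \<open>The exponential of x acts on the left and that of y on the right, where the divergences
  at 0 and 1 sit. As \<open>Zreg\<close> vanishes on x and on y, the letters get the values P and Q,
  and on words y...x both exponentials contribute only their value 1.\<close>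

definition Zword :: "real poly poly \<Rightarrow> real poly poly \<Rightarrow> letter list \<Rightarrow> real poly poly" where
  "Zword P Q = conv (power_char LX (divpow P)) (conv Zreg_poly (power_char LY (divpow Q)))"

lemma divpow_mult: "divpow P i * divpow P j = of_nat ((i + j) choose i) * divpow P (i + j)"
proof -
  have "1 / fact i * (1 / fact j) = real ((i + j) choose i) * (1 / fact (i + j))"
    by (simp add: binomial_fact field_simps)
  then have "[:[:1 / fact i:]:] * [:[:1 / fact j:]:] =
      of_nat ((i + j) choose i) * [:[:1 / fact (i + j) :: real:]:]"
    by (simp add: of_nat_poly)
  moreover have "divpow P i * divpow P j = [:[:1 / fact i:]:] * [:[:1 / fact j:]:] * P ^ (i + j)"
    unfolding divpow_def power_add by (simp only: mult_ac)
  ultimately show ?thesis by (simp only: divpow_def mult.assoc)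
qed

lemma divpow_0 [simp]: "divpow P 0 = 1"
  by (simp add: divpow_def one_pCons)

lemma divpow_1 [simp]: "divpow P (Suc 0) = P"
  by (simp add: divpow_def one_pCons[symmetric])

lemma character_Zreg_poly: "character Zreg_poly"
proof -
  have "(\<Sum>w\<leftarrow>xs. Zreg_poly w) = [:[:\<Sum>w\<leftarrow>xs. Zreg w:]:]" for xs
    by (induction xs) (simp_all add: Zreg_poly_def)
  then show ?thesis
    using character_Zreg by (simp add: character_def Zreg_poly_def one_pCons)
qed

lemma character_Zword: "character (Zword P Q)"
  unfolding Zword_def
  by (intro character_conv character_Zreg_poly character_power_char) (simp_all add: divpow_mult)

lemma Zword_expand:
  assumes "v = [] \<or> (hd v = LY \<and> last v = LX)"
  shows "Zword P Q (replicate a LX @ v @ replicate b LY) =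
    (\<Sum>i\<le>a. \<Sum>j\<le>b. divpow P i * divpow Q j * Zreg_poly (replicate (a - i) LX @ v @ replicate (b - j) LY))"
proof -
  have "v @ replicate b LY = [] \<or> hd (v @ replicate b LY) \<noteq> LX"
    using assms by (cases v; cases b) auto
  then have "Zword P Q (replicate a LX @ v @ replicate b LY) =
      (\<Sum>i\<le>a. divpow P i * conv Zreg_poly (power_char LY (divpow Q)) ((replicate (a - i) LX @ v) @ replicate b LY))"
    unfolding Zword_def by (subst conv_power_char_left) simp_all
  also have "\<dots> = (\<Sum>i\<le>a. divpow P i * (\<Sum>j\<le>b. Zreg_poly ((replicate (a - i) LX @ v) @ replicate (b - j) LY) * divpow Q j))"
  proof (intro sum.cong refl arg_cong2[of _ _ _ _ "(*)"] conv_power_char_right)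
    fix i show "replicate (a - i) LX @ v = [] \<or> last (replicate (a - i) LX @ v) \<noteq> LY"
      using assms by (cases "v = []"; cases "a - i") (auto simp: replicate_append_same[symmetric] simp del: replicate.simps)
  qed
  finally show ?thesis by (simp add: sum_distrib_left mult_ac)
qed

lemma Zword_admissible: "v = [] \<or> (hd v = LY \<and> last v = LX) \<Longrightarrow> Zword P Q v = Zreg_poly v"
  using Zword_expand[of v P Q 0 0] by simp

lemma word_Nil: "word [] = 1"
  by (simp add: word_def single_one[symmetric] zero_list_def del: single_one)

lemma scal_mult_word: "scal c * word u = Poly_Mapping.single u c"
  by (simp add: scal_def word_def mult_single plus_list_def)

lemma is_Zsh_lin_ext_Zword: "is_Zsh P Q (lin_ext qconst (Zword P Q))"
  unfolding is_Zsh_def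
proof (intro conjI allI ballI)
  fix v w :: ncpoly and c
  show "lin_ext qconst (Zword P Q) (v + w) = lin_ext qconst (Zword P Q) v + lin_ext qconst (Zword P Q) w"
    by (rule qc.lin_ext_add)
  show "lin_ext qconst (Zword P Q) (scal c * w) = smult [:of_rat c:] (lin_ext qconst (Zword P Q) w)"
    by (simp add: qc.lin_ext_scal_mult qconst_def)
  show "lin_ext qconst (Zword P Q) (shuffle v w) = lin_ext qconst (Zword P Q) v * lin_ext qconst (Zword P Q) w"
    by (rule qc.lin_ext_shuffle[OF character_Zword])
next
  have "Zword P Q ([LX] @ [] @ []) = P"
    using Zword_expand[of "[]" P Q 1 0] by (simp add: Zreg_poly_def Zreg_LX character_Zreg[unfolded character_def] one_pCons[symmetric])
  then show "lin_ext qconst (Zword P Q) hx = P" by simp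
  have "Zword P Q ([] @ [] @ [LY]) = Q"
    using Zword_expand[of "[]" P Q 0 1] by (simp add: Zreg_poly_def Zreg_LY character_Zreg[unfolded character_def] one_pCons[symmetric])
  then show "lin_ext qconst (Zword P Q) hy = Q" by simp
next
  fix w assume "w \<in> h0"
  then obtain c v where w: "w = scal c + hy * v * hx" by (auto simp: h0_def)
  have "lin_ext qconst (Zword P Q) (hy * v * hx) = [:[:Zconv (hy * v * hx):]:]"
  proof (induction v rule: poly_mapping_additive_induct)
    case (single u c)
    have "hy * Poly_Mapping.single u c * hx = Poly_Mapping.single (LY # u @ [LX]) c"
      by (simp add: word_def mult_single plus_list_def)
    then show ?case
      by (simp add: qc.lin_ext_single Zword_admissible Zreg_poly_def Zconv_single Zreg_eq_mzv)
         (simp add: qconst_def)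
  next
    case (add p q)
    then show ?case by (simp add: algebra_simps qc.lin_ext_add Zconv_add)
  qed
  moreover have "lin_ext qconst (Zword P Q) (scal c) = [:[:Zconv (scal c):]:]"
    using word_index_index_word[of "[]"] character_Zreg
    by (simp add: scal_def qc.lin_ext_single Zconv_single Zword_admissible Zreg_poly_def index_word_def
        mzv_Nil character_def) (simp add: qconst_def)
  ultimately show "lin_ext qconst (Zword P Q) w = [:[:Zconv w:]:]"
    by (simp add: w qc.lin_ext_add Zconv_add)
qed

text \<open>Shuffling a word with one letter reduces all values to those on \<open>h0\<close>:
  trailing letters y are removed first, then leading letters x. Each reduction yields a positive
  multiple of the wanted value, which cancels in characteristic 0.\<close>

lemma is_Zsh_unique:
  assumes f: "is_Zsh P Q f" and g: "is_Zsh P Q g"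
  shows "f = g"
proof -
  have add: "f (v + w) = f v + f w" "g (v + w) = g v + g w" for v w
    using f g by (auto simp: is_Zsh_def)
  have scal: "f (scal c * w) = smult [:of_rat c:] (f w)" "g (scal c * w) = smult [:of_rat c:] (g w)" for c w
    using f g by (auto simp: is_Zsh_def)
  have h0: "f w = g w" if "w \<in> h0" for w
    using f g that by (auto simp: is_Zsh_def)
  have sh: "f (shuffle v w) = f v * f w" "g (shuffle v w) = g v * g w" for v w
    using f g by (auto simp: is_Zsh_def)
  have xy: "f hx = g hx" "f hy = g hy"
    using f g by (auto simp: is_Zsh_def)
  have z: "f 0 = 0" "g 0 = 0" using add[of 0 0] by auto
  have suml: "f (\<Sum>w\<leftarrow>xs. word w) = (\<Sum>w\<leftarrow>xs. f (word w))" "g (\<Sum>w\<leftarrow>xs. word w) = (\<Sum>w\<leftarrow>xs. g (word w))" for xs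
    by (induction xs) (simp_all add: add z)
  have shuffle_list: "shuffle (word u) (word v) = (\<Sum>w\<leftarrow>shuffle_list u v. word w)" for u v
    by (simp add: shuffle_def word_def scal_def[symmetric] shuffle_word_eq)
       (simp add: scal_def zero_list_def[symmetric])
  have fw: "(\<Sum>w\<leftarrow>shuffle_list u v. f (word w)) = f (word u) * f (word v)" for u v
    using sh[of "word u" "word v"] by (simp add: shuffle_list suml)
  have gw: "(\<Sum>w\<leftarrow>shuffle_list u v. g (word w)) = g (word u) * g (word v)" for u v
    using sh[of "word u" "word v"] by (simp add: shuffle_list suml)
  have cancel: "p = q" if "of_nat (Suc n) * p = of_nat (Suc n) * q" for n and p q :: "real poly poly"
    using that by (simp del: of_nat_Suc)
  have emp: "f (word []) = g (word [])"
  proof (rule h0)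
    show "word [] \<in> h0" unfolding h0_def
      by (rule CollectI, rule exI[of _ 1], rule exI[of _ 0]) (simp add: scal_def word_def)
  qed
  have pow: "f (word (replicate n q)) = g (word (replicate n q))" for n q
  proof (induction n)
    case (Suc n)
    show ?case
    proof (rule cancel[of n])
      show "of_nat (Suc n) * f (word (replicate (Suc n) q)) = of_nat (Suc n) * g (word (replicate (Suc n) q))"
        using sum_shuffle_list_replicate[of "\<lambda>w. f (word w)" q n] sum_shuffle_list_replicate[of "\<lambda>w. g (word w)" q n] xy Suc
        by (cases q) (simp_all add: fw gw del: of_nat_Suc replicate_Suc)
    qed
  qed (simp add: emp)
  have ty: "f (word (LY # u @ [LX] @ replicate n LY)) = g (word (LY # u @ [LX] @ replicate n LY))" for n u
  proof (induction n arbitrary: u)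
    case 0
    have "word (LY # u @ [LX] @ replicate 0 LY) = scal 0 + hy * word u * hx"
      by (simp add: word_mult scal_0)
    then show ?case by (intro h0) (auto simp: h0_def)
  next
    case (Suc n)
    \<comment> \<open>Both words shuffled here begin with y, so every shuffle does, and the
      induction hypothesis covers all of them.\<close>
    have "map (\<lambda>w. f (word (w @ [LX] @ replicate n LY))) (shuffle_list [LY] (LY # u)) =
        map (\<lambda>w. g (word (w @ [LX] @ replicate n LY))) (shuffle_list [LY] (LY # u))"
    proof (rule map_cong[OF refl])
      fix w assume "w \<in> set (shuffle_list [LY] (LY # u))"
      then obtain w' where "w = LY # w'" by auto
      then show "f (word (w @ [LX] @ replicate n LY)) = g (word (w @ [LX] @ replicate n LY))"
        using Suc.IH[of w'] by simp
    qed
    then have M: "(\<Sum>w\<leftarrow>shuffle_list [LY] (LY # u). f (word (w @ [LX] @ replicate n LY))) =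
        (\<Sum>w\<leftarrow>shuffle_list [LY] (LY # u). g (word (w @ [LX] @ replicate n LY)))"
      by (rule arg_cong)
    have "f hy * f (word ((LY # u) @ [LX] @ replicate n LY)) = g hy * g (word ((LY # u) @ [LX] @ replicate n LY))"
      using xy Suc.IH[of u] by simp
    from sum_shuffle_list_insert[of "\<lambda>w. f (word w)" LY "LY # u" LX n, unfolded fw M, symmetric,
        THEN trans, OF this, THEN trans, OF sum_shuffle_list_insert[of "\<lambda>w. g (word w)" LY "LY # u" LX n, unfolded gw],
        THEN add_right_imp_eq, THEN cancel]
    show ?case by simp
  qed
  have y: "f (word (LY # u)) = g (word (LY # u))" for u
  proof (cases "LY # u" rule: word_split_LY)
    case (1 b)
    then show ?thesis by (simp add: pow)
  next
    case (2 b u')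
    then obtain u'' where "u' = LY # u''" by (cases u') auto
    then show ?thesis using 2 ty[of u'' b] by simp
  qed
  \<comment> \<open>The same reduction from the left: shuffling x into x^n y u gives n + 1 times the
    word with one more leading x, plus words with n of them.\<close>
  have x: "f (word (replicate n LX @ LY # u)) = g (word (replicate n LX @ LY # u))" for n u
  proof (induction n arbitrary: u)
    case (Suc n)
    show ?case
      using sum_shuffle_list_insert_front[of LY LX "\<lambda>w. f (word w)" n u]
        sum_shuffle_list_insert_front[of LY LX "\<lambda>w. g (word w)" n u] xy Suc.IH
      by - (rule cancel[of n], simp add: fw gw del: of_nat_Suc)
  qed (simp add: y)
  have "f (word u) = g (word u)" for u
  proof -
    have "u = takeWhile ((=) LX) u @ dropWhile ((=) LX) u" by simp
    moreover have "takeWhile ((=) LX) u = replicate (length (takeWhile ((=) LX) u)) LX"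
      by (rule replicate_length_same[symmetric]) (auto dest: set_takeWhileD)
    moreover have "dropWhile ((=) LX) u = [] \<or> hd (dropWhile ((=) LX) u) = LY"
      using hd_dropWhile[of "(=) LX" u] by (cases "hd (dropWhile ((=) LX) u)") auto
    ultimately obtain n z where "u = replicate n LX @ z" "z = [] \<or> (\<exists>v. z = LY # v)"
      by (metis list.collapse)
    then show ?thesis using pow[of n LX] x by auto
  qed
  then have "f p = g p" for p
    by (induction p rule: poly_mapping_additive_induct) (simp_all add: add scal_mult_word[symmetric] scal)
  then show ?thesis by (rule ext)
qed

lemma Zsh_eq: "Zsh P Q = lin_ext qconst (Zword P Q)"
  unfolding Zsh_def using is_Zsh_lin_ext_Zword is_Zsh_unique by blast

section \<open>Coefficients of the map sigma\<close>

text \<open>The recursion is \<sigma>(w y) = \<sigma>(w) y + \<sigma>(w y) x T, a consequence of y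
  (1 - xT)^(-1) = y + y (1 - xT)^(-1) xT. It peels off the last letter, hence the reversed
  argument.\<close>

fun sigma_words_rev :: "nat \<Rightarrow> letter list \<Rightarrow> letter list list" where
  "sigma_words_rev n [] = (if n = 0 then [[]] else [])"
| "sigma_words_rev n (LX # r) = map (\<lambda>z. z @ [LX]) (sigma_words_rev n r)"
| "sigma_words_rev 0 (LY # r) = map (\<lambda>z. z @ [LY]) (sigma_words_rev 0 r)"
| "sigma_words_rev (Suc n) (LY # r) = map (\<lambda>z. z @ [LY]) (sigma_words_rev (Suc n) r) @ map (\<lambda>z. z @ [LX]) (sigma_words_rev n (LY # r))"

text \<open>The words occurring in the coefficient of \<open>T^n\<close> in the image of \<open>w\<close> under \<open>\<sigma>\<close>.\<close>

definition sigma_words :: "nat \<Rightarrow> letter list \<Rightarrow> letter list list" where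
  "sigma_words n w = sigma_words_rev n (rev w)"

lemma sigma_words_Nil [simp]: "sigma_words n [] = (if n = 0 then [[]] else [])"
  and sigma_words_LX: "sigma_words n (w @ [LX]) = map (\<lambda>z. z @ [LX]) (sigma_words n w)"
  and sigma_words_LY: "sigma_words n (w @ [LY]) = map (\<lambda>z. z @ [LY]) (sigma_words n w) @
    (if n = 0 then [] else map (\<lambda>z. z @ [LX]) (sigma_words (n - 1) (w @ [LY])))"
  by (simp_all add: sigma_words_def) (cases n; simp)

lemma sigma_words_Cons_LX: "sigma_words n (LX # w) = map ((#) LX) (sigma_words n w)"
proof -
  have "sigma_words_rev n (r @ [LX]) = map ((#) LX) (sigma_words_rev n r)" for r
    by (induction n r rule: sigma_words_rev.induct) (simp_all add: comp_def)
  then show ?thesis by (simp add: sigma_words_def)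
qed

lemma sigma_words_Cons_LY: "z \<in> set (sigma_words n (LY # w)) \<Longrightarrow> \<exists>z'. z = LY # z'"
proof -
  have "\<exists>z'. z = LY # z'" if "z \<in> set (sigma_words_rev n (r @ [LY]))" for r
    using that
  proof (induction n r arbitrary: z rule: sigma_words_rev.induct)
    case (1 n)
    then show ?case
    proof (induction n arbitrary: z)
      case (Suc n)
      then show ?case by fastforce
    qed simp
  qed fastforce+
  then show "z \<in> set (sigma_words n (LY # w)) \<Longrightarrow> \<exists>z'. z = LY # z'" by (simp add: sigma_words_def)
qed

text \<open>\<sigma> fixes a leading x and keeps a leading y in front, so it commutes with removing
  a leading x.\<close>

lemma sum_sigma_words_strip_x:
  "(\<Sum>z\<leftarrow>sigma_words n w. strip_x f z) = strip_x (\<lambda>w. \<Sum>z\<leftarrow>sigma_words n w. f z) w"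
  for f :: "letter list \<Rightarrow> 'b::comm_monoid_add"
proof (cases w)
  case (Cons q u)
  show ?thesis
  proof (cases q)
    case LX
    then show ?thesis by (simp add: Cons sigma_words_Cons_LX comp_def)
  next
    case LY
    have "strip_x f z = 0" if "z \<in> set (sigma_words n (LY # u))" for z
      using sigma_words_Cons_LY[OF that] by auto
    then have "map (strip_x f) (sigma_words n (LY # u)) = map (\<lambda>_. 0) (sigma_words n (LY # u))" by simp
    then show ?thesis by (simp only: Cons LY) (simp add: sum_list_triv)
  qed
qed simp

lemma sigma_map_word_nth: "sigma_map (word w) $ n = (\<Sum>z\<leftarrow>sigma_words n w. word z)"
proof (induction w arbitrary: n rule: rev_induct)
  case Nil
  show ?case by (simp add: word_Nil sigma_map_1)
next
  case (snoc q w)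
  have S: "sigma_map (word (w @ [q])) = sigma_map (word w) * sigma_map (word [q])"
    by (simp add: word_mult[symmetric] sigma_map_mult)
  show ?case
  proof (cases q)
    case LX
    then show ?thesis
      by (simp add: S sigma_map_mult sigma_map_letters snoc sigma_words_LX comp_def word_mult[symmetric] sum_list_mult_const)
  next
    case LY
    have "geom_x = 1 + geom_x * (fps_const hx * fps_X)"
      using geom_x_inverse(2) by (simp add: algebra_simps)
    then have G: "F * (Y * geom_x) = F * (Y * (1 + geom_x * (fps_const hx * fps_X)))" for F Y
      by (rule arg_cong)
    have rec: "sigma_map (word (w @ [LY])) =
        sigma_map (word w) * fps_const hy + sigma_map (word (w @ [LY])) * (fps_const hx * fps_X)"
      unfolding S[unfolded LY] sigma_map_letters
      by (rule trans[OF G]) (simp only: distrib_left mult.assoc mult.right_neutral)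
    show ?thesis
    proof (induction n)
      case 0
      show ?case unfolding LY
        by (subst rec) (simp add: snoc sigma_words_LY comp_def word_mult[symmetric] sum_list_mult_const)
    next
      case (Suc n)
      have "(F * (fps_const hx * fps_X)) $ Suc n = F $ n * hx" for F :: "ncpoly fps"
        by (simp flip: mult.assoc)
      then show ?case using Suc unfolding LY
        by (subst rec, subst sigma_words_LY)
          (simp add: snoc comp_def word_mult[symmetric] sum_list_mult_const del: sigma_words_LY)
    qed
  qed
qed

definition polylog_sigma :: "nat \<Rightarrow> letter list \<Rightarrow> real fps" where
  "polylog_sigma n w = (\<Sum>z\<leftarrow>sigma_words n w. polylog z)"

definition polylog_reg_sigma :: "nat \<Rightarrow> letter list \<Rightarrow> real fps" where
  "polylog_reg_sigma n w = (\<Sum>z\<leftarrow>sigma_words n w. polylog_reg z)"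

lemma theta_polylog_sigma_LX: "theta (polylog_sigma n (w @ [LX])) = polylog_sigma n w - strip_x (polylog_sigma n) (w @ [LX])"
proof -
  have "theta (polylog_sigma n (w @ [LX])) = (\<Sum>z\<leftarrow>sigma_words n w. polylog z - strip_x polylog (z @ [LX]))"
    by (simp add: polylog_sigma_def sigma_words_LX theta_sum_list comp_def theta_polylog)
  also have "\<dots> = polylog_sigma n w - (\<Sum>z\<leftarrow>sigma_words n (w @ [LX]). strip_x polylog z)"
    by (simp add: polylog_sigma_def sum_list_subtractf sigma_words_LX comp_def)
  finally show ?thesis by (simp add: sum_sigma_words_strip_x polylog_sigma_def[abs_def])
qed

text \<open>The middle term is T times the series of the same word. Moved to the left-hand side, it
  is the source of the shift m - T attached to the letter y.\<close>

lemma theta_polylog_sigma_LY: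
  "theta (polylog_sigma n (w @ [LY])) =
    omega LY * polylog_sigma n w + (if n = 0 then 0 else polylog_sigma (n - 1) (w @ [LY])) - strip_x (polylog_sigma n) (w @ [LY])"
proof -
  define S where "S = (if n = 0 then [] else sigma_words (n - 1) (w @ [LY]))"
  have sigma_words: "sigma_words n (w @ [LY]) = map (\<lambda>z. z @ [LY]) (sigma_words n w) @ map (\<lambda>z. z @ [LX]) S"
    by (simp add: sigma_words_LY S_def)
  have "theta (polylog_sigma n (w @ [LY])) =
      (\<Sum>z\<leftarrow>sigma_words n w. omega LY * polylog z - strip_x polylog (z @ [LY])) + (\<Sum>z\<leftarrow>S. polylog z - strip_x polylog (z @ [LX]))"
    unfolding polylog_sigma_def sigma_words by (simp add: theta_sum_list comp_def theta_polylog theta_add del: omega.simps(2))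
  also have "\<dots> = omega LY * polylog_sigma n w + (\<Sum>z\<leftarrow>S. polylog z) - (\<Sum>z\<leftarrow>sigma_words n (w @ [LY]). strip_x polylog z)"
    unfolding sigma_words by (simp add: polylog_sigma_def sum_list_subtractf comp_def sum_list_const_mult del: omega.simps(2))
  also have "(\<Sum>z\<leftarrow>S. polylog z) = (if n = 0 then 0 else polylog_sigma (n - 1) (w @ [LY]))"
    by (simp add: S_def polylog_sigma_def)
  finally show ?thesis by (simp only: sum_sigma_words_strip_x polylog_sigma_def[abs_def])
qed

text \<open>Only cuts whose right part is a power of y contribute. A trailing y that \<sigma> has
  expanded to y x^k with k > 0 ends such a power, so cutting off y^j leaves exactly the words coming
  from w y^(b - j).\<close>

lemma sum_sigma_words_conv_right:
  fixes f :: "letter list \<Rightarrow> 'a::comm_ring_1"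
  assumes "w = [] \<or> last w = LX"
  shows "(\<Sum>z\<leftarrow>sigma_words n (w @ replicate b LY). conv f (power_char LY e) z) =
    (\<Sum>j\<le>b. (\<Sum>z\<leftarrow>sigma_words n (w @ replicate (b - j) LY). f z) * e j)"
proof -
  define c where "c k = split_sum (\<lambda>u v. f u * power_char LY (\<lambda>j. e (k + j)) v)" for k
  have cX: "c k (u @ [LX]) = f (u @ [LX]) * e k" for k u
    unfolding c_def split_sum_snoc by (subst split_sum_0) (simp_all add: power_char_def)
  have cY: "c k (u @ [LY]) = f (u @ [LY]) * e k + c (Suc k) u" for k u
    unfolding c_def split_sum_snoc by (simp add: power_char_def cong: if_cong)
  have "(\<Sum>z\<leftarrow>sigma_words n (w @ replicate b LY). c k z) =
      (\<Sum>j\<le>b. (\<Sum>z\<leftarrow>sigma_words n (w @ replicate (b - j) LY). f z) * e (k + j))" for k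
  proof (induction b arbitrary: k)
    case 0
    show ?case
    proof (cases w rule: rev_cases)
      case (snoc u q)
      then have "w = u @ [LX]" using assms by simp
      then show ?thesis by (simp add: sigma_words_LX comp_def cX sum_list_mult_const)
    qed (simp add: c_def power_char_def)
  next
    case (Suc b)
    define u where "u = w @ replicate b LY"
    have u: "w @ replicate (Suc b) LY = u @ [LY]" by (simp add: u_def replicate_append_same)
    define S where "S = (if n = 0 then [] else sigma_words (n - 1) (u @ [LY]))"
    have sigma_words: "sigma_words n (u @ [LY]) = map (\<lambda>z. z @ [LY]) (sigma_words n u) @ map (\<lambda>z. z @ [LX]) S"
      by (simp add: sigma_words_LY S_def)
    have "(\<Sum>z\<leftarrow>sigma_words n (u @ [LY]). c k z) = (\<Sum>z\<leftarrow>sigma_words n (u @ [LY]). f z) * e k + (\<Sum>z\<leftarrow>sigma_words n u. c (Suc k) z)"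
      unfolding sigma_words by (simp add: comp_def cX cY sum_list_addf sum_list_const_mult sum_list_mult_const algebra_simps)
    then show ?case using Suc[of "Suc k"]
      by (subst sum.atMost_Suc_shift) (simp add: u u_def replicate_append_same)
  qed
  from this[of 0] show ?thesis by (simp add: c_def conv_def[abs_def])
qed

lemma polylog_reg_sigma_append:
  assumes "w = [] \<or> last w = LX"
  shows "polylog_reg_sigma n (w @ replicate b LY) = (\<Sum>j\<le>b. log_power j * polylog_sigma n (w @ replicate (b - j) LY))"
  using sum_sigma_words_conv_right[OF assms] by (simp add: polylog_reg_sigma_def polylog_sigma_def polylog_reg_def mult.commute)

text \<open>Every word is uniquely \<open>x^a v y^b\<close> with \<open>v\<close> admissible. In the generating series below \<open>B\<close> is
  the outermost and \<open>T\<close> the innermost variable, and the coefficient of \<open>A^a B^b T^n\<close> comes from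
  the coefficient of \<open>T^n\<close> in the image of \<open>x^a v y^b\<close> under \<open>\<sigma>\<close>.\<close>

definition admissible :: "letter list \<Rightarrow> bool" where
  "admissible v \<longleftrightarrow> v = [] \<or> (hd v = LY \<and> last v = LX)"

definition Zreg_sigma :: "nat \<Rightarrow> letter list \<Rightarrow> real" where
  "Zreg_sigma n w = (\<Sum>z\<leftarrow>sigma_words n w. Zreg z)"

definition zeta_series :: "letter list \<Rightarrow> real fps fps fps" where
  "zeta_series v = Abs_fps (\<lambda>b. Abs_fps (\<lambda>a. Abs_fps (\<lambda>n. Zreg_sigma n (replicate a LX @ v @ replicate b LY))))"

definition polylog_reg_series :: "letter list \<Rightarrow> nat \<Rightarrow> real fps fps fps" where
  "polylog_reg_series v M = Abs_fps (\<lambda>b. Abs_fps (\<lambda>a. Abs_fps (\<lambda>n. polylog_reg_sigma n (replicate a LX @ v @ replicate b LY) $ M)))"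

definition polylog_series :: "letter list \<Rightarrow> nat \<Rightarrow> real fps fps" where
  "polylog_series v m = Abs_fps (\<lambda>a. Abs_fps (\<lambda>n. polylog_sigma n (replicate a LX @ v) $ m))"

definition log_power_series :: "nat \<Rightarrow> real fps fps fps" where
  "log_power_series j = Abs_fps (\<lambda>b. fps_const (fps_const (log_power b $ j)))"

lemma polylog_reg_series_sums: "(\<lambda>M. polylog_reg_series v M $ b $ a $ n) sums (zeta_series v $ b $ a $ n)"
  unfolding polylog_reg_series_def zeta_series_def polylog_reg_sigma_def Zreg_sigma_def by (simp add: fps_nth_sum_list sums_sum_list polylog_reg_sums)

lemma strip_x_replicate:
  "strip_x f (replicate a LX @ z) = (if a = 0 then strip_x f z else f (replicate (a - 1) LX @ z))"
  by (cases a) simp_all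

text \<open>Coefficient m of the differential equation. Removing a leading x lowers a by one, which
  on generating series is multiplication by A, the outer variable \<open>fps_X\<close>; the constant
  \<open>fps_const fps_X\<close> is T.\<close>

lemma polylog_series_LX:
  assumes "hd v = LY" "v \<noteq> []"
  shows "(of_nat m + fps_X) * polylog_series (v @ [LX]) m = polylog_series v m"
proof -
  have strip_x: "strip_x f (v @ [LX]) = 0" for f :: "letter list \<Rightarrow> real fps" using assms by (cases v) auto
  have *: "of_nat m * polylog_sigma n (replicate a LX @ v @ [LX]) $ m =
      polylog_sigma n (replicate a LX @ v) $ m - (if a = 0 then 0 else polylog_sigma n (replicate (a - 1) LX @ v @ [LX]) $ m)" for a n
    using arg_cong[OF theta_polylog_sigma_LX[of n "replicate a LX @ v"], of "\<lambda>F. F $ m"] by (simp add: strip_x_replicate strip_x)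
  show ?thesis
  proof (intro fps_ext)
    fix a n show "((of_nat m + fps_X) * polylog_series (v @ [LX]) m) $ a $ n = polylog_series v m $ a $ n"
      using *[of n a] by (cases "a = 0") (simp_all add: polylog_series_def algebra_simps fps_of_nat[symmetric] fps_X_mult_nth del: fps_of_nat)
  qed
qed

lemma polylog_series_LY:
  assumes "v = [] \<or> hd v = LY"
  shows "(of_nat m + fps_X - fps_const fps_X) * polylog_series (v @ [LY]) m = (\<Sum>j<m. polylog_series v j)"
proof -
  have strip_x: "strip_x f (v @ [LY]) = 0" for f :: "letter list \<Rightarrow> real fps" using assms by (cases v) auto
  have *: "of_nat m * polylog_sigma n (replicate a LX @ v @ [LY]) $ m =
      (\<Sum>j<m. polylog_sigma n (replicate a LX @ v) $ j) + (if n = 0 then 0 else polylog_sigma (n - 1) (replicate a LX @ v @ [LY]) $ m)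
       - (if a = 0 then 0 else polylog_sigma n (replicate (a - 1) LX @ v @ [LY]) $ m)" for a n
    using arg_cong[OF theta_polylog_sigma_LY[of n "replicate a LX @ v"], of "\<lambda>F. F $ m"]
    by (simp add: strip_x_replicate strip_x omega_LY_mult_nth del: omega.simps)
  show ?thesis
  proof (intro fps_ext)
    fix a n show "((of_nat m + fps_X - fps_const fps_X) * polylog_series (v @ [LY]) m) $ a $ n = (\<Sum>j<m. polylog_series v j) $ a $ n"
      using *[of n a]
      by (cases "a = 0"; cases "n = 0") (simp_all add: polylog_series_def algebra_simps fps_of_nat[symmetric] fps_X_mult_nth fps_sum_nth del: fps_of_nat)
  qed
qed

lemma polylog_series_Nil: "polylog_series [] m = (if m = 0 then 1 else 0)"
proof -
  have sigma_words: "sigma_words n (replicate a LX) = (if n = 0 then [replicate a LX] else [])" for n a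
    by (induction a) (simp_all add: sigma_words_Cons_LX)
  have Lx: "polylog (replicate a LX) = (if a = 0 then 1 else 0)" for a
  proof (cases a)
    case (Suc c)
    then have "theta (polylog (replicate a LX)) = theta 0"
      using theta_polylog[of "replicate c LX" LX] by (simp add: replicate_append_same)
    then show ?thesis using Suc by - (rule theta_eqI, simp_all add: polylog_nth_0)
  qed simp
  show ?thesis
    by (intro fps_ext) (auto simp: polylog_series_def polylog_sigma_def sigma_words Lx)
qed

lemma polylog_sigma_nth_0: "v \<noteq> [] \<Longrightarrow> polylog_sigma n v $ 0 = 0"
  by (cases v rule: rev_cases; cases "last v")
    (auto simp: polylog_sigma_def sigma_words_LX sigma_words_LY fps_nth_sum_list comp_def polylog_nth_0 sum_list_triv)

lemma polylog_series_0: "v \<noteq> [] \<Longrightarrow> polylog_series v 0 = 0"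
  by (intro fps_ext) (simp add: polylog_series_def polylog_sigma_nth_0)

lemma log_power_series_0: "log_power_series 0 = 1"
  by (intro fps_ext) (auto simp: log_power_series_def log_power_nth_0)

text \<open>\<open>log_power_series j\<close> is the coefficient of t^j in (1 - t)^B. The
  differential equation expresses it through a sum over smaller indices, and subtracting consecutive
  instances gives this two-term recursion.\<close>

lemma log_power_series_rec: "of_nat (Suc j) * log_power_series (Suc j) = (of_nat j - fps_X) * log_power_series j"
proof -
  have eqs: "of_nat j * log_power b $ j = (if b = 0 then 0 else - (\<Sum>i<j. log_power (b - 1) $ i))" for b j
  proof (cases b)
    case (Suc c)
    show ?thesis using arg_cong[OF theta_log_power[of c], of "\<lambda>F. F $ j"]
      by (simp add: omega_LY_mult_nth Suc del: omega.simps)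
  qed simp
  have log_power_series: "of_nat j * log_power_series j = - (fps_X * (\<Sum>i<j. log_power_series i))" for j
  proof (rule fps_ext)
    fix b
    have "(of_nat j * log_power_series j) $ b = fps_const (fps_const (of_nat j * log_power b $ j))"
      by (simp add: log_power_series_def fps_of_nat[symmetric] del: fps_of_nat)
    also have "\<dots> = (- (fps_X * (\<Sum>i<j. log_power_series i))) $ b"
      unfolding eqs by (intro fps_ext) (simp add: log_power_series_def fps_X_mult_nth fps_sum_nth)
    finally show "(of_nat j * log_power_series j) $ b = (- (fps_X * (\<Sum>i<j. log_power_series i))) $ b" .
  qed
  show ?thesis unfolding log_power_series by (simp add: algebra_simps log_power_series)
qed

text \<open>The integrating factor again: applying t d/dt + A - T to the regularized series of all
  x^a v y^b gives (1 - t)^B times the same operator applied to the series of all x^a v. With B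
  outermost, A is \<open>fps_const fps_X\<close> and T is
  \<open>fps_const (fps_const fps_X)\<close>.\<close>

lemma polylog_reg_series_rec:
  assumes "admissible v"
  shows "(of_nat M + fps_const fps_X - fps_const (fps_const fps_X)) * polylog_reg_series v M =
    (\<Sum>i\<le>M. log_power_series (M - i) * fps_const ((of_nat i + fps_X - fps_const fps_X) * polylog_series v i))"
proof -
  define W where "W a b = replicate a LX @ v @ replicate b LY" for a b
  define r where "r n a b = (if n = 0 then 0 else polylog_sigma (n - 1) (W a b)) - (if a = 0 then 0 else polylog_sigma n (W (a - 1) b))" for n a b
  define R where "R n a = theta (polylog_sigma n (W a 0)) - r n a 0" for n a
  have main: "theta (polylog_reg_sigma n (W a b)) = log_power b * R n a + (if n = 0 then 0 else polylog_reg_sigma (n - 1) (W a b)) -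
      (if a = 0 then 0 else polylog_reg_sigma n (W (a - 1) b))" for n a b
  proof -
    have polylog_reg_sigma: "polylog_reg_sigma n (W a b) = (\<Sum>j\<le>b. log_power j * polylog_sigma n (W a (b - j)))" for n a b
      using polylog_reg_sigma_append[of "replicate a LX @ v" n b] assms
      by (cases "v = []"; cases a)
        (auto simp: W_def admissible_def replicate_append_same[symmetric] simp del: replicate.simps)
    define q where "q b = (if b = 0 then theta (polylog_sigma n (W a 0)) else r n a b)" for b
    have "strip_x (polylog_sigma n) (W a (Suc b)) = (if a = 0 then 0 else polylog_sigma n (W (a - 1) (Suc b)))" for b
      using assms by (cases v) (auto simp: W_def strip_x_replicate admissible_def)
    then have "theta (polylog_sigma n (W a (Suc b))) = omega LY * polylog_sigma n (W a b) + q (Suc b)" for b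
      using theta_polylog_sigma_LY[of n "W a b"] by (simp add: W_def replicate_append_same q_def r_def algebra_simps del: omega.simps)
    then have "theta (polylog_reg_sigma n (W a b)) = (\<Sum>j\<le>b. log_power j * q (b - j))"
      unfolding polylog_reg_sigma by (intro theta_log_power_conv) (simp_all add: q_def)
    also have "\<dots> = (\<Sum>j\<le>b. log_power j * ((if j = b then R n a else 0) + r n a (b - j)))"
      by (intro sum.cong refl) (auto simp: q_def R_def)
    also have "\<dots> = (\<Sum>j\<le>b. if j = b then log_power b * R n a else 0) + (\<Sum>j\<le>b. log_power j * r n a (b - j))"
      unfolding distrib_left sum.distrib by (intro arg_cong2[of _ _ _ _ "(+)"] sum.cong) auto
    also have "(\<Sum>j\<le>b. if j = b then log_power b * R n a else 0) = log_power b * R n a" by simp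
    also have "(\<Sum>j\<le>b. log_power j * r n a (b - j)) = (if n = 0 then 0 else polylog_reg_sigma (n - 1) (W a b)) -
        (if a = 0 then 0 else polylog_reg_sigma n (W (a - 1) b))"
      unfolding polylog_reg_sigma r_def by (auto simp: right_diff_distrib sum_subtractf sum_negf)
    finally show ?thesis by simp
  qed
  have RL: "((of_nat i + fps_X - fps_const fps_X) * polylog_series v i) $ a $ n = R n a $ i" for i a n
    by (simp add: polylog_series_def R_def r_def W_def algebra_simps fps_of_nat[symmetric] fps_X_mult_nth del: fps_of_nat)
  show ?thesis
  proof (intro fps_ext)
    fix b a n
    have "((of_nat M + fps_const fps_X - fps_const (fps_const fps_X)) * polylog_reg_series v M) $ b $ a $ n =
        of_nat M * polylog_reg_sigma n (W a b) $ M + (if a = 0 then 0 else polylog_reg_sigma n (W (a - 1) b) $ M)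
        - (if n = 0 then 0 else polylog_reg_sigma (n - 1) (W a b) $ M)"
      by (simp add: polylog_reg_series_def W_def algebra_simps fps_of_nat[symmetric] fps_X_mult_nth del: fps_of_nat)
    also have "\<dots> = (log_power b * R n a) $ M"
      using arg_cong[OF main[of n a b], of "\<lambda>F. F $ M"] by (simp split: if_splits)
    also have "\<dots> = (R n a * log_power b) $ M" by (simp only: mult.commute)
    also have "\<dots> = (\<Sum>i\<le>M. log_power b $ (M - i) * R n a $ i)"
      unfolding fps_mult_nth atLeast0AtMost by (intro sum.cong refl) (rule mult.commute)
    also have "\<dots> = (\<Sum>i\<le>M. log_power_series (M - i) * fps_const ((of_nat i + fps_X - fps_const fps_X) * polylog_series v i)) $ b $ a $ n"
      by (simp only: fps_sum_nth fps_mult_right_const_nth log_power_series_def fps_nth_Abs_fps fps_mult_left_const_nth RL)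
    finally show "((of_nat M + fps_const fps_X - fps_const (fps_const fps_X)) * polylog_reg_series v M) $ b $ a $ n =
      (\<Sum>i\<le>M. log_power_series (M - i) * fps_const ((of_nat i + fps_X - fps_const fps_X) * polylog_series v i)) $ b $ a $ n" .
  qed
qed

section \<open>Specialization to one variable\<close>

text \<open>The substitution \<open>U := c X\<close> in a power series in \<open>U\<close> over power series in \<open>X\<close>.\<close>

definition diag :: "'a \<Rightarrow> 'a fps fps \<Rightarrow> 'a::comm_ring_1 fps" where
  "diag c F = Abs_fps (\<lambda>N. \<Sum>i\<le>N. c ^ i * F $ i $ (N - i))"

lemma diag_add: "diag c (F + G) = diag c F + diag c G"
  by (rule fps_ext) (simp add: diag_def sum.distrib algebra_simps)

lemma diag_const: "diag c (fps_const f) = f"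
proof (rule fps_ext)
  fix N
  have "(\<Sum>i\<le>N. c ^ i * fps_const f $ i $ (N - i)) = (\<Sum>i\<in>{0}. c ^ i * fps_const f $ i $ (N - i))"
    by (rule sum.mono_neutral_right) auto
  then show "diag c (fps_const f) $ N = f $ N" by (simp add: diag_def)
qed

lemma diag_const_mult: "diag c (fps_const f * F) = f * diag c F"
proof (rule fps_ext)
  fix N
  have "diag c (fps_const f * F) $ N = (\<Sum>i\<le>N. \<Sum>j\<le>N - i. f $ j * (c ^ i * F $ i $ (N - i - j)))"
    by (simp add: diag_def fps_mult_nth[of f] atLeast0AtMost sum_distrib_left mult_ac)
  also have "\<dots> = (\<Sum>(i, j)\<in>(SIGMA i:{..N}. {..N - i}). f $ j * (c ^ i * F $ i $ (N - i - j)))"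
    by (simp add: sum.Sigma)
  also have "\<dots> = (\<Sum>(j, i)\<in>(SIGMA j:{..N}. {..N - j}). f $ j * (c ^ i * F $ i $ (N - j - i)))"
    by (rule sum.reindex_bij_witness[of _ prod.swap prod.swap]) (auto simp: add.commute diff_diff_add)
  also have "\<dots> = (\<Sum>j\<le>N. \<Sum>i\<le>N - j. f $ j * (c ^ i * F $ i $ (N - j - i)))"
    by (simp add: sum.Sigma)
  also have "\<dots> = (f * diag c F) $ N"
    by (simp add: diag_def fps_mult_nth[of f] atLeast0AtMost sum_distrib_left)
  finally show "diag c (fps_const f * F) $ N = (f * diag c F) $ N" .
qed

lemma diag_X_mult: "diag c (fps_X * F) = fps_const c * fps_X * diag c F"
proof (rule fps_ext)
  fix N
  show "diag c (fps_X * F) $ N = (fps_const c * fps_X * diag c F) $ N"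
  proof (cases N)
    case (Suc n)
    have "diag c (fps_X * F) $ N = (\<Sum>i\<le>n. c * (c ^ i * F $ i $ (n - i)))"
      unfolding diag_def fps_nth_Abs_fps Suc by (subst sum.atMost_Suc_shift) (simp add: mult.assoc)
    then show ?thesis by (simp add: Suc diag_def mult.assoc sum_distrib_left)
  qed (simp add: diag_def mult.assoc)
qed

text \<open>The outer variable becomes c X, which raises the order by one. Splitting F into its
  constant coefficient and a multiple of the outer variable therefore reduces a coefficient of the
  product to an earlier one.\<close>

lemma diag_mult: "diag c (F * G) = diag c F * diag c G"
proof (rule fps_ext)
  fix N show "diag c (F * G) $ N = (diag c F * diag c G) $ N"
  proof (induction N arbitrary: F)
    case (0 F)
    show ?case by (simp add: diag_def)
  next
    case (Suc N F)
    have split: "F = fps_const (F $ 0) + fps_X * fps_shift 1 F"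
      by (rule fps_ext) (simp add: fps_X_mult_nth)
    have FG: "F * G = fps_const (F $ 0) * G + fps_X * (fps_shift 1 F * G)"
      by (subst split) (simp only: distrib_right mult.assoc)
    have 1: "diag c (F * G) = F $ 0 * diag c G + fps_const c * fps_X * diag c (fps_shift 1 F * G)"
      unfolding FG by (simp only: diag_add diag_const_mult diag_X_mult)
    have 2: "diag c F * diag c G = F $ 0 * diag c G + fps_const c * fps_X * (diag c (fps_shift 1 F) * diag c G)"
      by (subst split) (simp only: diag_add diag_const diag_X_mult distrib_right mult.assoc)
    show ?case unfolding 1 2 using Suc[of "fps_shift 1 F"] by (simp add: mult.assoc)
  qed
qed

lemma diag_X: "diag c fps_X = fps_const c * fps_X"
  using diag_X_mult[of c 1] diag_const[of c 1] by simp

lemma diag_of_nat: "diag c (of_nat n) = of_nat n"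
  by (simp only: fps_of_nat[symmetric] diag_const)

lemma diag_uminus: "diag c (- F) = - diag c F"
  by (rule fps_ext) (simp add: diag_def sum_negf)

lemma diag_diff: "diag c (F - G) = diag c F - diag c G"
  using diag_add[of c F "- G"] by (simp add: diag_uminus)

lemma diag_0: "diag c 0 = 0"
  using diag_const[of c 0] by simp

lemma diag_1: "diag c 1 = 1"
  using diag_const[of c 1] by simp

lemma diag_sum: "diag c (sum f A) = (\<Sum>i\<in>A. diag c (f i))"
  by (induction A rule: infinite_finite_induct) (simp_all add: diag_add diag_0)

text \<open>The substitution A := a T, B := b T in a series with B outermost and T
  innermost.\<close>

definition specialize :: "'a \<Rightarrow> 'a \<Rightarrow> 'a fps fps fps \<Rightarrow> 'a::comm_ring_1 fps" where
  "specialize a b F = diag b (coeffwise (diag a) F)"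

lemma coeffwise_nth [simp]: "coeffwise f F $ n = f (F $ n)"
  by (simp add: coeffwise_def)

lemma specialize_add: "specialize a b (F + G) = specialize a b F + specialize a b G"
proof -
  have "coeffwise (diag a) (F + G) = coeffwise (diag a) F + coeffwise (diag a) G"
    by (rule fps_ext) (simp add: diag_add)
  then show ?thesis by (simp add: specialize_def diag_add)
qed

lemma specialize_diff: "specialize a b (F - G) = specialize a b F - specialize a b G"
proof -
  have "coeffwise (diag a) (F - G) = coeffwise (diag a) F - coeffwise (diag a) G"
    by (rule fps_ext) (simp add: diag_diff)
  then show ?thesis by (simp add: specialize_def diag_diff)
qed

lemma specialize_mult: "specialize a b (F * G) = specialize a b F * specialize a b G"
proof -
  have "coeffwise (diag a) (F * G) = coeffwise (diag a) F * coeffwise (diag a) G"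
    by (rule fps_ext) (simp add: fps_mult_nth diag_sum diag_mult)
  then show ?thesis by (simp add: specialize_def diag_mult)
qed

lemma specialize_const: "specialize a b (fps_const f) = diag a f"
proof -
  have "coeffwise (diag a) (fps_const f) = fps_const (diag a f)"
    by (rule fps_ext) (simp add: diag_0)
  then show ?thesis by (simp add: specialize_def diag_const)
qed

lemma specialize_X: "specialize a b fps_X = fps_const b * fps_X"
proof -
  have "coeffwise (diag a) fps_X = fps_X"
    by (rule fps_ext) (simp add: diag_0 diag_1 fps_X_def)
  then show ?thesis by (simp add: specialize_def diag_X)
qed

lemma specialize_of_nat: "specialize a b (of_nat n) = of_nat n"
  by (simp only: fps_of_nat[symmetric] specialize_const diag_const)

lemma specialize_1: "specialize a b 1 = 1"
  using specialize_of_nat[of a b 1] by simp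

lemma specialize_0: "specialize a b 0 = 0"
  using specialize_of_nat[of a b 0] by simp

lemma specialize_sum: "specialize a b (sum f A) = (\<Sum>i\<in>A. specialize a b (f i))"
  by (induction A rule: infinite_finite_induct) (simp_all add: specialize_add specialize_0)

lemma specialize_nth: "specialize a b F $ N = (\<Sum>i\<le>N. b ^ i * (\<Sum>k\<le>N - i. a ^ k * F $ i $ k $ (N - i - k)))"
  by (simp add: specialize_def diag_def)

lemma specialize_swap: "specialize a b (Abs_fps (\<lambda>i. Abs_fps (\<lambda>k. F $ k $ i))) = specialize b a F"
proof (rule fps_ext)
  fix N
  have "specialize a b (Abs_fps (\<lambda>i. Abs_fps (\<lambda>k. F $ k $ i))) $ N =
      (\<Sum>i\<le>N. \<Sum>k\<le>N - i. b ^ i * (a ^ k * F $ k $ i $ (N - i - k)))"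
    by (simp add: specialize_nth sum_distrib_left)
  also have "\<dots> = (\<Sum>(i, k)\<in>(SIGMA i:{..N}. {..N - i}). b ^ i * (a ^ k * F $ k $ i $ (N - i - k)))"
    by (simp add: sum.Sigma)
  also have "\<dots> = (\<Sum>(k, i)\<in>(SIGMA k:{..N}. {..N - k}). a ^ k * (b ^ i * F $ k $ i $ (N - k - i)))"
    by (rule sum.reindex_bij_witness[of _ prod.swap prod.swap]) (auto simp: add.commute diff_diff_add mult_ac)
  also have "\<dots> = specialize b a F $ N"
    by (simp add: sum.Sigma[symmetric] specialize_nth sum_distrib_left)
  finally show "specialize a b (Abs_fps (\<lambda>i. Abs_fps (\<lambda>k. F $ k $ i))) $ N = specialize b a F $ N" .
qed

text \<open>The coefficient of X^N of \<open>diag c F\<close> is a polynomial in c whose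
  coefficients form the homogeneous part of F of degree N; it has infinitely many roots.\<close>

lemma diag_inject:
  fixes F :: "'a::{comm_ring_1,ring_no_zero_divisors} fps fps"
  assumes "infinite S" "\<And>c. c \<in> S \<Longrightarrow> diag c F = 0"
  shows "F = 0"
proof -
  have "F $ i $ k = 0" for i k
  proof -
    define N where "N = i + k"
    define p where "p = (\<Sum>j\<le>N. monom (F $ j $ (N - j)) j)"
    have "poly p c = 0" if "c \<in> S" for c
    proof -
      have "poly p c = diag c F $ N"
        by (simp add: p_def poly_sum poly_monom diag_def mult.commute)
      then show ?thesis using assms(2)[OF that] by simp
    qed
    then have "S \<subseteq> {c. poly p c = 0}" by auto
    then have "p = 0" using assms(1) poly_roots_finite[of p] finite_subset by blast
    then have "coeff p i = 0" by simp
    moreover have "coeff p i = F $ i $ k"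
      by (simp add: p_def coeff_sum N_def if_distrib sum.delta cong: if_cong)
    ultimately show ?thesis by simp
  qed
  then show ?thesis by (intro fps_ext) simp
qed

lemma specialize_inject:
  fixes F :: "'a::{comm_ring_1,ring_no_zero_divisors} fps fps fps"
  assumes "infinite S" "\<And>a b. a \<in> S \<Longrightarrow> b \<in> S \<Longrightarrow> specialize a b F = specialize a b G"
  shows "F = G"
proof -
  have "coeffwise (diag a) (F - G) = 0" if "a \<in> S" for a
    using assms that by (intro diag_inject[of S]) (auto simp: specialize_diff specialize_def[symmetric])
  then have "diag a ((F - G) $ i) = 0" if "a \<in> S" for a i
    using that by (metis coeffwise_nth fps_zero_nth)
  then have "(F - G) $ i = 0" for i
    using assms(1) by (intro diag_inject[of S]) auto
  then have "F - G = 0" by (intro fps_ext) simp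
  then show ?thesis by simp
qed

lemma specialize_polylog_reg_series_sums: "(\<lambda>M. specialize a b (polylog_reg_series v M) $ N) sums (specialize a b (zeta_series v) $ N)"
  unfolding specialize_nth by (intro sums_sum sums_mult polylog_reg_series_sums)

section \<open>A Gamma function evaluation\<close>

text \<open>The coefficient of t^j in (1 - t)^(-B).\<close>

definition rising :: "real \<Rightarrow> nat \<Rightarrow> real" where
  "rising B j = pochhammer B j / fact j"

lemma rising_0 [simp]: "rising B 0 = 1"
  by (simp add: rising_def)

lemma rising_Suc: "real (Suc j) * rising B (Suc j) = (real j + B) * rising B j"
  by (simp add: rising_def pochhammer_Suc fact_Suc field_simps del: of_nat_Suc)

lemma rising_nonneg: "B > 0 \<Longrightarrow> rising B j \<ge> 0"
  by (simp add: rising_def pochhammer_nonneg)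

lemma rising_bound:
  assumes "0 < B" "B \<le> 1/4"
  shows "rising B j \<le> (real j + 1) powr (-1/2)"
proof (induction j)
  case (Suc j)
  define x where "x = real j + 1"
  have x: "x \<ge> 1" by (simp add: x_def)
  have eq: "rising B (Suc j) = (x - 1 + B) / x * rising B j"
    using rising_Suc[of j B] x by (simp add: x_def field_simps)
  \<comment> \<open>The ratio of consecutive terms is compared with that of (j + 1)^(-1/2) after
    squaring; x - 3/4 is the worst case B = 1/4.\<close>
  have "((x - 1 + B) / x) ^ 2 \<le> ((x - 3/4) / x) ^ 2"
    using x assms by (intro power_mono divide_right_mono) auto
  also have "\<dots> \<le> x / (x + 1)"
  proof -
    have "(x - 3/4) ^ 2 * (x + 1) \<le> x ^ 3"
    proof -
      have "x ^ 3 - (x - 3/4) ^ 2 * (x + 1) = x ^ 2 / 2 + 15 / 16 * x - 9 / 16"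
        by (simp add: power2_eq_square power3_eq_cube field_simps)
      moreover have "x ^ 2 \<ge> 1" using x by simp
      ultimately show ?thesis using x by linarith
    qed
    then show ?thesis using x by (simp add: field_simps power2_eq_square power3_eq_cube)
  qed
  finally have "(x - 1 + B) / x \<le> sqrt (x / (x + 1))"
    using x assms by (intro real_le_rsqrt)
  then have "rising B (Suc j) \<le> sqrt (x / (x + 1)) * x powr (-1/2)"
    unfolding eq using Suc x assms by (intro mult_mono) (auto simp: x_def rising_nonneg)
  also have "\<dots> = (x + 1) powr (-1/2)"
    using x by (simp add: powr_half_sqrt powr_minus_divide[of _ "1/2", simplified] real_sqrt_divide)
  finally show ?case by (simp add: x_def add.commute)
qed simp

lemma rising_tendsto_0:
  assumes "0 < B" "B \<le> 1/4"
  shows "rising B \<longlonglongrightarrow> 0"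
proof (rule tendsto_sandwich[of "\<lambda>_. 0" _ _ "\<lambda>j. (real j + 1) powr (-1/2)"])
  show "(\<lambda>j. (real j + 1) powr (-1/2)) \<longlonglongrightarrow> 0" by real_asymp
  show "\<forall>\<^sub>F j in sequentially. rising B j \<le> (real j + 1) powr (-1/2)"
    by (intro always_eventually allI rising_bound assms)
qed (use assms in \<open>auto intro!: always_eventually rising_nonneg\<close>)

lemma rising_sums_powr:
  assumes "0 < t" "t < 1"
  shows "(\<lambda>j. rising B j * t ^ j) sums ((1 - t) powr (- B))"
proof -
  have "(\<lambda>n. (- B gchoose n) * (- t) ^ n) sums (1 + - t) powr (- B)"
    using assms by (intro gen_binomial_real) auto
  moreover have "(- B gchoose n) * (- t) ^ n = rising B n * t ^ n" for n
    by (cases "even n") (simp_all add: gbinomial_pochhammer rising_def)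
  ultimately show ?thesis by simp
qed

text \<open>Gauss' summation in the case needed: expanding (1 - t)^(-B) in the Beta integral of t^(z
  - 1) (1 - t)^(-B) and integrating termwise, by monotone convergence since the terms are
  nonnegative.\<close>

lemma rising_sums_Beta:
  assumes z: "z > 0" and B: "0 < B" "B < 1"
  shows "(\<lambda>j. rising B j / (real j + z)) sums (Gamma z * Gamma (1 - B) / Gamma (z + 1 - B))"
proof -
  define g where "g t = t powr (z - 1) * (1 - t) powr (1 - B - 1)" for t :: real
  define f where "f k t = (\<Sum>j<k. rising B j * t powr (real j + z - 1))" for k and t :: real
  have g: "(g has_integral Beta z (1 - B)) {0<..<1}"
    using has_integral_Beta_real[of z "1 - B"] z B
    by (simp add: g_def[abs_def] has_integral_Icc_iff_Ioo)
  have mono: "((\<lambda>t. t powr (real j + z - 1)) has_integral (1 / (real j + z))) {0<..<1}" for j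
    using has_integral_powr_from_0[of "real j + z - 1" 1] z
    by (simp add: has_integral_Icc_iff_Ioo)
  have f: "(f k has_integral (\<Sum>j<k. rising B j * (1 / (real j + z)))) {0<..<1}" for k
    unfolding f_def[abs_def] by (intro has_integral_sum has_integral_mult_right mono) auto
  have lim: "(\<lambda>k. f k t) \<longlonglongrightarrow> g t" if "t \<in> {0<..<1}" for t
  proof -
    have "t powr (real j + z - 1) = t powr (z - 1) * t ^ j" for j
      using that by (simp add: powr_realpow[symmetric] powr_add[symmetric] algebra_simps)
    then have "f k t = t powr (z - 1) * (\<Sum>j<k. rising B j * t ^ j)" for k
      by (simp add: f_def sum_distrib_left mult_ac)
    then show ?thesis
      using rising_sums_powr[of t B] that by (simp add: g_def sums_def tendsto_mult_left)
  qed
  have le: "f k t \<le> f (Suc k) t" if "t \<in> {0<..<1}" for k t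
    using B by (simp add: f_def rising_nonneg)
  have fg: "f k t \<le> g t" if "t \<in> {0<..<1}" for k t
    by (rule incseq_le[OF incseq_SucI lim[OF that]]) (use le[OF that] in auto)
  have "bounded (range (\<lambda>k. integral {0<..<1} (f k)))"
  proof (rule boundedI)
    fix x assume "x \<in> range (\<lambda>k. integral {0<..<1} (f k))"
    then obtain k where k: "x = integral {0<..<1} (f k)" by auto
    have "x \<le> Beta z (1 - B)"
      using has_integral_le[OF f[of k] g fg] f[of k] by (simp add: k integral_unique)
    moreover have "x \<ge> 0"
      unfolding k using B by (intro integral_nonneg) (auto simp: f_def rising_nonneg sum_nonneg intro: has_integral_integrable[OF f])
    ultimately show "norm x \<le> Beta z (1 - B)" by simp
  qed
  then have "(\<lambda>k. integral {0<..<1} (f k)) \<longlonglongrightarrow> integral {0<..<1} g"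
    using monotone_convergence_increasing[of f "{0<..<1}" g] f le lim by (auto simp: integrable_on_def)
  then have "(\<lambda>j. rising B j * (1 / (real j + z))) sums Beta z (1 - B)"
    unfolding sums_def integral_unique[OF f] integral_unique[OF g] .
  then show ?thesis by (simp add: Beta_def add_diff_eq)
qed

text \<open>The Beta integral needs z > 0, whereas here z = -C and the term j = 0 is left out.
  Splitting off the telescoping differences of j \<open>rising B j\<close> / (j - C) raises z to 1 -
  C with a factor 1 - C - B, which the functional equation of Gamma absorbs.\<close>

lemma rising_sums_neg:
  assumes C: "0 < C" "C < 1/2" and B: "0 < B" "B \<le> 1/4"
  shows "(\<lambda>j. if j = 0 then 0 else C * rising B j / (real j - C)) sums
    (1 - Gamma (1 - B) * Gamma (1 - C) / Gamma (1 - C - B))"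
proof -
  define d where "d = 1 - C - B"
  have d: "d > 0" using assms by (simp add: d_def)
  define h where "h j = (if j = 0 then 0 else C * rising B j / (real j - C))" for j
  have step: "h j = (if j = 0 then 1 else 0) - d * (rising B j / (real j + (1 - C)))
      + (real j * rising B j / (real j - C) - real (Suc j) * rising B (Suc j) / (real (Suc j) - C))" for j
  proof -
    have 1: "real j + (1 - C) \<noteq> 0" "real (Suc j) - C = real j + (1 - C)" using C by auto
    show ?thesis
    proof (cases "j = 0")
      case True
      show ?thesis unfolding True rising_Suc using C by (simp add: h_def d_def field_simps)
    next
      case False
      then have 2: "real j - C \<noteq> 0" using C by (cases j) auto
      show ?thesis unfolding rising_Suc 1(2) using 1(1) 2 False
        by (simp add: h_def d_def divide_simps) (simp add: algebra_simps)
    qed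
  qed
  define u where "u j = real j * rising B j / (real j - C)" for j
  have "(\<lambda>j. u j) \<longlonglongrightarrow> 1 * 0"
  proof -
    have "(\<lambda>j. real j / (real j - C)) \<longlonglongrightarrow> 1" by real_asymp
    from tendsto_mult[OF this rising_tendsto_0[OF B]] show ?thesis by (simp add: u_def)
  qed
  then have 1: "(\<lambda>j. u j - u (Suc j)) sums (u 0 - 0)"
    by - (rule telescope_sums', simp)
  have 2: "(\<lambda>j. if j = 0 then 1 else 0) sums (1 :: real)"
    using sums_single[of 0 "\<lambda>_. 1 :: real"] by simp
  have 3: "(\<lambda>j. d * (rising B j / (real j + (1 - C)))) sums
      (d * (Gamma (1 - C) * Gamma (1 - B) / Gamma (1 - C + 1 - B)))"
    using C B by (intro sums_mult rising_sums_Beta) auto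
  have 4: "Gamma (1 - C + 1 - B) = d * Gamma d"
    using Gamma_plus1[of d] d by (simp add: d_def add_ac nonpos_Ints_def algebra_simps)
  have "(\<lambda>j. (if j = 0 then 1 else 0) - d * (rising B j / (real j + (1 - C))) + (u j - u (Suc j)))
      sums (1 - Gamma (1 - C) * Gamma (1 - B) / Gamma d + (u 0 - 0))"
    using sums_add[OF sums_diff[OF 2 3] 1] d unfolding 4 by simp
  then show ?thesis
    unfolding h_def[symmetric] step by (simp add: u_def d_def mult.commute)
qed

lemma rising_Beta_bound:
  assumes "0 < C" "C < 1/2" "0 < B" "B \<le> 1/4"
  shows "power_bounded (-1/4) (\<lambda>i. Gamma (real i - C) * Gamma (1 - B) / Gamma (real i - C + 1 - B))"
proof -
  have sm: "summable (\<lambda>j. (real j + 1) powr (-5/4))"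
    using summable_real_powr_iff[of "-5/4"] summable_Suc_iff[of "\<lambda>j. real j powr (-5/4)"] by (simp add: add.commute)
  define D where "D = suminf (\<lambda>j. 2 * (real j + 1) powr (-5/4))"
  have "\<bar>Gamma (real i - C) * Gamma (1 - B) / Gamma (real i - C + 1 - B)\<bar> \<le> D * real i powr (-1/4)"
    if i: "i \<ge> 1" for i
  proof -
    have pos: "real i - C > 0" using i assms by linarith
    have tm: "rising B j / (real j + (real i - C)) \<le> 2 * (real j + 1) powr (-5/4) * real i powr (-1/4)" for j
    proof -
      define x where "x = real j + real i"
      have x: "x \<ge> 1" "x \<ge> real i" "x \<ge> real j + 1" using i by (auto simp: x_def)
      have "1 / (real j + (real i - C)) \<le> 2 / x"
        using x i assms by (simp add: x_def field_simps)
      \<comment> \<open>One share of the decay makes the sum over j converge, as -1/2 - 3/4 = -5/4 <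
        -1; the other share, -1/4, is the claimed decay in i.\<close>
      also have "2 / x = 2 * (x powr (-3/4) * x powr (-1/4))"
        using x by (simp add: powr_add[symmetric] powr_minus_divide)
      also have "\<dots> \<le> 2 * ((real j + 1) powr (-3/4) * real i powr (-1/4))"
        using x i by (intro mult_left_mono mult_mono powr_mono2') auto
      finally have "rising B j * (1 / (real j + (real i - C))) \<le>
          (real j + 1) powr (-1/2) * (2 * ((real j + 1) powr (-3/4) * real i powr (-1/4)))"
        using assms pos by (intro mult_mono rising_bound) auto
      also have "\<dots> = 2 * ((real j + 1) powr (-1/2) * (real j + 1) powr (-3/4)) * real i powr (-1/4)"
        by (simp only: mult_ac)
      also have "(real j + 1) powr (-1/2) * (real j + 1) powr (-3/4) = (real j + 1) powr (-5/4)"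
        by (simp add: powr_add[symmetric])
      finally show ?thesis by simp
    qed
    have sums: "(\<lambda>j. rising B j / (real j + (real i - C))) sums
        (Gamma (real i - C) * Gamma (1 - B) / Gamma (real i - C + 1 - B))"
      using pos assms by (intro rising_sums_Beta) auto
    have "(\<lambda>j. 2 * (real j + 1) powr (-5/4) * real i powr (-1/4)) sums (D * real i powr (-1/4))"
      unfolding D_def by (intro sums_mult2 summable_sums summable_mult sm)
    from sums_le[OF tm sums this]
    have "Gamma (real i - C) * Gamma (1 - B) / Gamma (real i - C + 1 - B) \<le> D * real i powr (-1/4)" .
    moreover have "Gamma (real i - C) * Gamma (1 - B) / Gamma (real i - C + 1 - B) \<ge> 0"
      using pos assms by (intro divide_nonneg_nonneg mult_nonneg_nonneg less_imp_le[OF Gamma_real_pos]) auto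
    ultimately show ?thesis by simp
  qed
  then show ?thesis unfolding power_bounded_def by blast
qed

section \<open>Evaluation at small positive reals\<close>

text \<open>Nonnegativity of the coefficients is carried along with the value at s, so that products
  and infinite sums of such series can be evaluated termwise.\<close>

definition nonneg_sums :: "real \<Rightarrow> real fps \<Rightarrow> real \<Rightarrow> bool" where
  "nonneg_sums s F r \<longleftrightarrow> (\<forall>N. F $ N \<ge> 0) \<and> (\<lambda>N. F $ N * s ^ N) sums r"

lemma nonneg_sums_add: "nonneg_sums s F r \<Longrightarrow> nonneg_sums s G q \<Longrightarrow> nonneg_sums s (F + G) (r + q)"
  unfolding nonneg_sums_def using sums_add[of "\<lambda>N. F $ N * s ^ N" r "\<lambda>N. G $ N * s ^ N" q]
  by (simp add: distrib_right)

lemma sums_fps_mult: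
  fixes F G :: "real fps"
  assumes "summable (\<lambda>N. norm (F $ N * s ^ N))" "summable (\<lambda>N. norm (G $ N * s ^ N))"
    "(\<lambda>N. F $ N * s ^ N) sums a" "(\<lambda>N. G $ N * s ^ N) sums b"
  shows "(\<lambda>N. (F * G) $ N * s ^ N) sums (a * b)"
proof -
  have "(\<lambda>k. \<Sum>i\<le>k. F $ i * s ^ i * (G $ (k - i) * s ^ (k - i))) sums (a * b)"
    using Cauchy_product_sums[OF assms(1,2)] assms(3,4) by (simp add: sums_iff)
  also have "(\<lambda>k. \<Sum>i\<le>k. F $ i * s ^ i * (G $ (k - i) * s ^ (k - i))) = (\<lambda>N. (F * G) $ N * s ^ N)"
  proof
    fix k
    have *: "F $ i * s ^ i * (G $ (k - i) * s ^ (k - i)) = F $ i * G $ (k - i) * s ^ k" if "i \<le> k" for i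
      using that by (simp add: mult_ac power_add[symmetric])
    show "(\<Sum>i\<le>k. F $ i * s ^ i * (G $ (k - i) * s ^ (k - i))) = (F * G) $ k * s ^ k"
      unfolding fps_mult_nth atLeast0AtMost sum_distrib_right by (intro sum.cong refl *) simp
  qed
  finally show ?thesis .
qed

lemma nonneg_sums_mult:
  assumes "nonneg_sums s F r" "nonneg_sums s G q" "s > 0"
  shows "nonneg_sums s (F * G) (r * q)"
proof -
  have F: "(\<lambda>N. F $ N * s ^ N) sums r" and G: "(\<lambda>N. G $ N * s ^ N) sums q"
    and nonneg: "F $ N \<ge> 0" "G $ N \<ge> 0" for N
    using assms by (auto simp: nonneg_sums_def)
  have "(\<lambda>N. (F * G) $ N * s ^ N) sums (r * q)"
    using F G nonneg assms(3) by (intro sums_fps_mult) (simp_all add: sums_iff)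
  then show ?thesis
    using nonneg by (auto simp: nonneg_sums_def fps_mult_nth intro!: sum_nonneg)
qed

lemma nonneg_sums_const: "c \<ge> 0 \<Longrightarrow> nonneg_sums s (fps_const c) c"
proof -
  have "(\<lambda>N. fps_const c $ N * s ^ N) sums c"
    using sums_single[of 0 "\<lambda>_. c"] by (rule sums_cong[THEN iffD1, rotated]) auto
  then show "c \<ge> 0 \<Longrightarrow> nonneg_sums s (fps_const c) c" by (simp add: nonneg_sums_def)
qed

lemma nonneg_sums_0: "nonneg_sums s 0 0" and nonneg_sums_1: "nonneg_sums s 1 1" and nonneg_sums_of_nat: "nonneg_sums s (of_nat n) (real n)"
  using nonneg_sums_const[of 0 s] nonneg_sums_const[of 1 s] nonneg_sums_const[of "real n" s] by (simp_all add: fps_of_nat)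

lemma nonneg_sums_X: "nonneg_sums s fps_X s"
proof -
  have "(\<lambda>N. fps_X $ N * s ^ N) sums s"
    using sums_single[of 1 "\<lambda>_. s"] by (rule sums_cong[THEN iffD1, rotated]) auto
  then show "nonneg_sums s fps_X s" by (simp add: nonneg_sums_def fps_X_def)
qed

lemma nonneg_sums_sum: "(\<And>i. i \<in> A \<Longrightarrow> nonneg_sums s (F i) (r i)) \<Longrightarrow> nonneg_sums s (sum F A) (sum r A)"
  by (induction A rule: infinite_finite_induct) (auto intro: nonneg_sums_0 nonneg_sums_add)

definition geo :: "real \<Rightarrow> nat \<Rightarrow> real fps" where
  "geo c m = Abs_fps (\<lambda>N. c ^ N / real m ^ Suc N)"

lemma geo_mult: "m \<ge> 1 \<Longrightarrow> geo c m * (of_nat m - fps_const c * fps_X) = 1"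
proof (rule fps_ext)
  fix N assume m: "m \<ge> 1"
  have "geo c m * (of_nat m - fps_const c * fps_X) =
      fps_const (real m) * geo c m - fps_const c * (fps_X * geo c m)"
    by (simp add: fps_of_nat algebra_simps)
  then show "(geo c m * (of_nat m - fps_const c * fps_X)) $ N = (1 :: real fps) $ N"
    using m by (cases N) (simp_all add: geo_def)
qed

lemma geo_cancel: "m \<ge> 1 \<Longrightarrow> (of_nat m - fps_const c * fps_X) * F = G \<Longrightarrow> F = geo c m * G"
  using geo_mult[of m c] by (metis mult.assoc mult_1)

lemma nonneg_sums_geo:
  assumes "m \<ge> 1" "c \<ge> 0" "s > 0" "c * s < real m"
  shows "nonneg_sums s (geo c m) (1 / (real m - c * s))"
proof -
  have "(\<lambda>N. (c * s / real m) ^ N) sums (1 / (1 - c * s / real m))"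
    using assms by (intro geometric_sums) auto
  then have "(\<lambda>N. 1 / real m * (c * s / real m) ^ N) sums (1 / real m * (1 / (1 - c * s / real m)))"
    by (rule sums_mult)
  moreover have "1 / real m * (1 / (1 - c * s / real m)) = 1 / (real m - c * s)"
    using assms by (simp add: field_simps)
  ultimately show ?thesis
    using assms by (simp add: nonneg_sums_def geo_def power_divide power_mult_distrib)
qed

text \<open>Tonelli's theorem for the double series in M and N: summation over M commutes with
  evaluation at s.\<close>

lemma nonneg_sums_suminf:
  assumes ev: "\<And>M. nonneg_sums s (F M) (r M)" and r: "r sums R" and s: "s > 0"
  shows "summable (\<lambda>M. F M $ N)" "(\<lambda>N. (suminf (\<lambda>M. F M $ N)) * s ^ N) sums R"
proof -
  define f where "f = (\<lambda>(M, N). F M $ N * s ^ N)"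
  have nonneg: "F M $ N \<ge> 0" for M N using ev by (simp add: nonneg_sums_def)
  have rnn: "r M \<ge> 0" for M
  proof -
    have "(\<lambda>N. F M $ N * s ^ N) sums r M" using ev[of M] by (simp add: nonneg_sums_def)
    from sums_le[OF _ sums_zero this] show ?thesis using nonneg s by simp
  qed
  have inner: "((\<lambda>N. f (M, N)) has_sum r M) UNIV" for M
    using ev[of M] nonneg s by (intro sums_nonneg_imp_has_sum) (auto simp: nonneg_sums_def f_def)
  have outer: "(r has_sum R) UNIV"
    using r rnn by (intro sums_nonneg_imp_has_sum)
  have "f summable_on (SIGMA M:UNIV. UNIV)"
    using outer nonneg s by (intro summable_on_SigmaI[OF inner]) (auto simp: f_def summable_on_def)
  from has_sum_SigmaI[OF inner outer this] have "(f has_sum R) (UNIV \<times> UNIV)" .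
  then have "((\<lambda>(N, M). f (M, N)) has_sum R) (UNIV \<times> UNIV)"
    by (rule has_sum_swap[THEN iffD1])
  then have g: "((\<lambda>(N, M). F M $ N * s ^ N) has_sum R) (SIGMA N:UNIV. UNIV)"
    by (simp add: f_def case_prod_unfold)
  have sec: "(\<lambda>M. F M $ N * s ^ N) summable_on UNIV" for N
    using summable_on_SigmaD1[of "\<lambda>N M. F M $ N * s ^ N" UNIV "\<lambda>_. UNIV" N] g
    by (auto simp: summable_on_def)
  then have "summable (\<lambda>M. F M $ N * s ^ N)" for N
    by (intro summable_on_imp_summable)
  then have sm: "summable (\<lambda>M. F M $ N)" for N
    using s summable_mult2[of "\<lambda>M. F M $ N * s ^ N" "1 / s ^ N"] by simp
  then show "summable (\<lambda>M. F M $ N)" .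
  have "((\<lambda>M. F M $ N * s ^ N) has_sum ((suminf (\<lambda>M. F M $ N)) * s ^ N)) UNIV" for N
    using nonneg s sm by (intro sums_nonneg_imp_has_sum sums_mult2 summable_sums) auto
  then have "((\<lambda>N. (suminf (\<lambda>M. F M $ N)) * s ^ N) has_sum R) UNIV"
    by (intro has_sum_SigmaD[OF g]) simp
  then show "(\<lambda>N. (suminf (\<lambda>M. F M $ N)) * s ^ N) sums R"
    by (rule has_sum_imp_sums)
qed

text \<open>The value at T = s of the coefficient of t^m after A := -\<alpha> T: with A and C
  standing for \<alpha> s and (\<alpha> + 1) s, the letter x divides by m - A and the letter y by m
  - C.\<close>

fun shifted_sum_rev :: "real \<Rightarrow> real \<Rightarrow> letter list \<Rightarrow> nat \<Rightarrow> real" where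
  "shifted_sum_rev A C [] m = (if m = 0 then 1 else 0)"
| "shifted_sum_rev A C (LX # r) m = (if m = 0 then 0 else shifted_sum_rev A C r m / (real m - A))"
| "shifted_sum_rev A C (LY # r) m = (if m = 0 then 0 else (\<Sum>j<m. shifted_sum_rev A C r j) / (real m - C))"

definition shifted_sum :: "real \<Rightarrow> real \<Rightarrow> letter list \<Rightarrow> nat \<Rightarrow> real" where
  "shifted_sum A C v = shifted_sum_rev A C (rev v)"

lemma shifted_sum_Nil [simp]: "shifted_sum A C [] m = (if m = 0 then 1 else 0)"
  and shifted_sum_LX [simp]: "shifted_sum A C (v @ [LX]) m = (if m = 0 then 0 else shifted_sum A C v m / (real m - A))"
  and shifted_sum_LY [simp]: "shifted_sum A C (v @ [LY]) m = (if m = 0 then 0 else (\<Sum>j<m. shifted_sum A C v j) / (real m - C))"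
  by (simp_all add: shifted_sum_def)

lemma shifted_sum_0: "v \<noteq> [] \<Longrightarrow> shifted_sum A C v 0 = 0"
  by (cases v rule: rev_cases; cases "last v") auto

lemma shifted_sum_nonneg:
  assumes "A < 1" "C < 1"
  shows "shifted_sum A C v m \<ge> 0"
proof (induction v arbitrary: m rule: rev_induct)
  case (snoc q v)
  then show ?case using assms by (cases q) (auto intro!: divide_nonneg_nonneg sum_nonneg)
qed simp

lemma inverse_diff_bound:
  assumes "0 \<le> A" "A < 1" "m \<ge> 1"
  shows "\<bar>1 / (real m - A)\<bar> \<le> (1 / (1 - A)) / real m"
proof -
  have "real m * (1 - A) \<le> real m - A" using assms by (simp add: algebra_simps mult_le_cancel_left1)
  moreover have "real m * (1 - A) > 0" using assms by simp
  ultimately show ?thesis using assms by (simp add: field_simps)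
qed

lemma power_bounded_shifted_sum:
  assumes "0 \<le> A" "A < 1" "0 \<le> C" "C < 1"
  shows "power_bounded (-7/8) (shifted_sum A C v)"
proof (induction v rule: rev_induct)
  case Nil
  show ?case by (rule power_bounded_0) simp
next
  case (snoc q v)
  have *: "power_bounded (-7/8) (shifted_sum A C (v @ [q]))" if "power_bounded (1/8) a" "0 \<le> D" "D < 1"
      "\<And>m. m \<ge> 1 \<Longrightarrow> shifted_sum A C (v @ [q]) m = a m * (1 / (real m - D))" for a D
  proof -
    have "power_bounded (1/8 - 1) (\<lambda>m. a m * (1 / (real m - D)))"
      by (rule power_bounded_divide[OF that(1) inverse_diff_bound[OF that(2,3)]])
    then have "power_bounded (-7/8) (\<lambda>m. a m * (1 / (real m - D)))" by simp
    then show ?thesis using that(4) by (simp add: power_bounded_def)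
  qed
  show ?case
  proof (cases q)
    case LX
    show ?thesis
      by (rule *[of "shifted_sum A C v" A]) (use snoc assms LX in \<open>auto intro: power_bounded_mono\<close>)
  next
    case LY
    show ?thesis
      by (rule *[OF power_bounded_partial_sums[OF snoc], of C]) (use assms LY in auto)
  qed
qed

text \<open>The final x divides by m - A, which makes up for the extra factor m.\<close>

lemma power_bounded_shifted_sum_LX:
  assumes "0 \<le> A" "A < 1" "0 \<le> C" "C < 1"
  shows "power_bounded (-7/8) (\<lambda>m. real m * shifted_sum A C (v @ [LX]) m)"
proof -
  obtain D where D: "\<forall>m\<ge>1. \<bar>shifted_sum A C v m\<bar> \<le> D * real m powr (-7/8)"
    using power_bounded_shifted_sum[OF assms] by (auto simp: power_bounded_def)
  have "\<bar>real m * shifted_sum A C (v @ [LX]) m\<bar> \<le> (1 / (1 - A) * D) * real m powr (-7/8)" if m: "m \<ge> 1" for m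
  proof -
    have "\<bar>real m * shifted_sum A C (v @ [LX]) m\<bar> = real m * \<bar>1 / (real m - A)\<bar> * \<bar>shifted_sum A C v m\<bar>"
      using m by (simp add: abs_mult)
    also have "\<dots> \<le> real m * ((1 / (1 - A)) / real m) * (D * real m powr (-7/8))"
      using inverse_diff_bound[of A m] assms m D by (intro mult_mono mult_left_mono) auto
    finally show ?thesis using m by simp
  qed
  then show ?thesis unfolding power_bounded_def by blast
qed

text \<open>With M = i + j all terms are nonnegative, so the sum over j may be taken first; it is
  the Beta evaluation at z = i - C. The index i = 0, where z is negative, is excluded by w 0 =
  0.\<close>

lemma rising_convolution_sums:
  assumes C: "0 < C" "C < 1/2" and B: "0 < B" "B \<le> 1/4"
    and w: "\<And>i. w i \<ge> 0" "w 0 = 0"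
    and S: "(\<lambda>i. w i * (Gamma (real i - C) * Gamma (1 - B) / Gamma (real i - C + 1 - B))) sums S"
  shows "(\<lambda>M. (\<Sum>i\<le>M. rising B (M - i) * w i) / (real M - C)) sums S"
proof -
  define ph where "ph i = Gamma (real i - C) * Gamma (1 - B) / Gamma (real i - C + 1 - B)" for i
  define f where "f = (\<lambda>(i, j). w i * (rising B j / (real j + (real i - C))))"
  have pos: "real i - C > 0" if "i \<noteq> 0" for i using that C by linarith
  have nonneg: "f (i, j) \<ge> 0" for i j
    using pos[of i] w B by (cases "i = 0") (auto simp: f_def rising_nonneg)
  have phnn: "w i * ph i \<ge> 0" for i
    using pos[of i] w B by (cases "i = 0")
      (auto simp: ph_def intro!: divide_nonneg_nonneg mult_nonneg_nonneg less_imp_le[OF Gamma_real_pos])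
  have inner: "((\<lambda>j. f (i, j)) has_sum (w i * ph i)) UNIV" for i
  proof (rule sums_nonneg_imp_has_sum)
    show "(\<lambda>j. f (i, j)) sums (w i * ph i)"
      using pos[of i] B w sums_mult[OF rising_sums_Beta[of "real i - C" B], of "w i"]
      by (cases "i = 0") (auto simp: f_def ph_def)
  qed (rule nonneg)
  have outer: "((\<lambda>i. w i * ph i) has_sum S) UNIV"
    using S phnn by (intro sums_nonneg_imp_has_sum) (auto simp: ph_def)
  have "f summable_on (SIGMA i:UNIV. UNIV)"
    using outer nonneg by (intro summable_on_SigmaI[OF inner]) (auto simp: summable_on_def)
  from has_sum_SigmaI[OF inner outer this] have fS: "(f has_sum S) (UNIV \<times> UNIV)" .
  have bij: "bij_betw (\<lambda>(M, i). (i, M - i)) (SIGMA M:UNIV. {..M}) (UNIV \<times> UNIV :: (nat \<times> nat) set)"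
    by (rule bij_betwI[of _ _ _ "\<lambda>(i, j). (i + j, i)"]) auto
  have "((\<lambda>x. f ((\<lambda>(M, i). (i, M - i)) x)) has_sum S) (SIGMA M:UNIV. {..M})"
    using has_sum_reindex_bij_betw[OF bij] fS by blast
  then have "((\<lambda>(M, i). f (i, M - i)) has_sum S) (SIGMA M:UNIV. {..M})"
    by (simp add: case_prod_unfold)
  then have "((\<lambda>M. \<Sum>i\<le>M. f (i, M - i)) has_sum S) UNIV"
    by (rule has_sum_SigmaD) (simp add: has_sum_finite)
  then have "(\<lambda>M. \<Sum>i\<le>M. f (i, M - i)) sums S" by (rule has_sum_imp_sums)
  also have "(\<lambda>M. \<Sum>i\<le>M. f (i, M - i)) = (\<lambda>M. (\<Sum>i\<le>M. rising B (M - i) * w i) / (real M - C))"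
    unfolding sum_divide_distrib by (intro ext sum.cong refl) (simp add: f_def of_nat_diff)
  finally show ?thesis .
qed

definition polylog_spec :: "real \<Rightarrow> letter list \<Rightarrow> nat \<Rightarrow> real fps" where
  "polylog_spec al v m = diag (- al) (polylog_series v m)"

lemma polylog_spec_LX:
  assumes "hd v = LY" "v \<noteq> []" "m \<ge> 1"
  shows "polylog_spec al (v @ [LX]) m = geo al m * polylog_spec al v m"
proof (rule geo_cancel)
  have "polylog_spec al v m = diag (- al) ((of_nat m + fps_X) * polylog_series (v @ [LX]) m)"
    using polylog_series_LX[OF assms(1,2)] by (simp add: polylog_spec_def)
  also have "\<dots> = (of_nat m - fps_const al * fps_X) * polylog_spec al (v @ [LX]) m"
    by (simp add: diag_mult diag_add diag_of_nat diag_X polylog_spec_def fps_const_neg[symmetric] del: fps_const_neg)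
  finally show "(of_nat m - fps_const al * fps_X) * polylog_spec al (v @ [LX]) m = polylog_spec al v m" ..
qed (use assms in auto)

lemma diag_lin_ext: "diag (- al) (of_nat m + fps_X - fps_const fps_X) = of_nat m - fps_const (al + 1) * fps_X"
  by (simp add: diag_diff diag_add diag_of_nat diag_X diag_const algebra_simps fps_const_neg[symmetric]
      fps_const_add[symmetric] del: fps_const_neg fps_const_add)

lemma polylog_spec_LY:
  assumes "v = [] \<or> hd v = LY" "m \<ge> 1"
  shows "polylog_spec al (v @ [LY]) m = geo (al + 1) m * (\<Sum>j<m. polylog_spec al v j)"
proof (rule geo_cancel)
  have "(\<Sum>j<m. polylog_spec al v j) = diag (- al) ((of_nat m + fps_X - fps_const fps_X) * polylog_series (v @ [LY]) m)"
    using polylog_series_LY[OF assms(1)] by (simp add: polylog_spec_def diag_sum)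
  also have "\<dots> = (of_nat m - fps_const (al + 1) * fps_X) * polylog_spec al (v @ [LY]) m"
    by (simp only: diag_mult diag_lin_ext polylog_spec_def)
  finally show "(of_nat m - fps_const (al + 1) * fps_X) * polylog_spec al (v @ [LY]) m = (\<Sum>j<m. polylog_spec al v j)" ..
qed (use assms in auto)

lemma polylog_spec_Nil: "polylog_spec al [] m = (if m = 0 then 1 else 0)"
  by (simp add: polylog_spec_def polylog_series_Nil diag_0 diag_1)

lemma polylog_spec_0: "v \<noteq> [] \<Longrightarrow> polylog_spec al v 0 = 0"
  by (simp add: polylog_spec_def polylog_series_0 diag_0)

lemma nonneg_sums_polylog_spec:
  assumes "v = [] \<or> hd v = LY" and al: "al > 0" and s: "s > 0" and small: "(al + 1) * s < 1"
  shows "nonneg_sums s (polylog_spec al v m) (shifted_sum (al * s) ((al + 1) * s) v m)"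
  using assms(1)
proof (induction v arbitrary: m rule: rev_induct)
  case Nil
  then show ?case by (simp add: polylog_spec_Nil nonneg_sums_0 nonneg_sums_1)
next
  case (snoc q v)
  show ?case
  proof (cases "m = 0")
    case True
    then show ?thesis by (simp add: polylog_spec_0 shifted_sum_0 nonneg_sums_0)
  next
    case False
    then have m: "m \<ge> 1" by simp
    have v: "v = [] \<or> hd v = LY" using snoc.prems by (cases v) auto
    have less: "(al + 1) * s < real m" "al * s < real m"
      using small m s by (auto simp: distrib_right)
    show ?thesis
    proof (cases q)
      case LX
      then have "v \<noteq> []" using snoc.prems by auto
      then have "polylog_spec al (v @ [q]) m = geo al m * polylog_spec al v m"
        using v m polylog_spec_LX[of v m al] LX by simp
      moreover have "nonneg_sums s (geo al m * polylog_spec al v m) (1 / (real m - al * s) * shifted_sum (al * s) ((al + 1) * s) v m)"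
        using al s less m snoc.IH[OF v] by (intro nonneg_sums_mult nonneg_sums_geo) auto
      ultimately show ?thesis using False LX by simp
    next
      case LY
      then have "polylog_spec al (v @ [q]) m = geo (al + 1) m * (\<Sum>j<m. polylog_spec al v j)"
        using v m polylog_spec_LY[of v m al] by simp
      moreover have "nonneg_sums s (geo (al + 1) m * (\<Sum>j<m. polylog_spec al v j))
          (1 / (real m - (al + 1) * s) * (\<Sum>j<m. shifted_sum (al * s) ((al + 1) * s) v j))"
        using al s less m snoc.IH[OF v] by (intro nonneg_sums_mult nonneg_sums_geo nonneg_sums_sum) auto
      ultimately show ?thesis using False LY by simp
    qed
  qed
qed

definition log_power_spec :: "real \<Rightarrow> real \<Rightarrow> nat \<Rightarrow> real fps" where
  "log_power_spec al be j = specialize (- al) (- be) (log_power_series j)"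

text \<open>Under B := -\<beta> T the factor j - B of the recursion becomes j + \<beta> T, so no
  signs occur and the value at s is the coefficient of (1 - t)^(-\<beta> s).\<close>

lemma nonneg_sums_log_power_spec:
  assumes "be > 0" "s > 0"
  shows "nonneg_sums s (log_power_spec al be j) (rising (be * s) j)"
proof (induction j)
  case 0
  show ?case by (simp add: log_power_spec_def log_power_series_0 specialize_1 nonneg_sums_1)
next
  case (Suc j)
  have "of_nat (Suc j) * log_power_spec al be (Suc j) = (of_nat j + fps_const be * fps_X) * log_power_spec al be j"
    using arg_cong[OF log_power_series_rec[of j], of "specialize (- al) (- be)"]
    by (simp add: specialize_mult specialize_diff specialize_of_nat specialize_X log_power_spec_def fps_const_neg[symmetric] del: fps_const_neg of_nat_Suc)
  then have "log_power_spec al be (Suc j) = fps_const (1 / real (Suc j)) * ((of_nat j + fps_const be * fps_X) * log_power_spec al be j)"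
  proof -
    assume *: "of_nat (Suc j) * log_power_spec al be (Suc j) = (of_nat j + fps_const be * fps_X) * log_power_spec al be j"
    have "fps_const (1 / real (Suc j)) * of_nat (Suc j) = (1 :: real fps)"
      by (simp add: fps_of_nat[symmetric] del: of_nat_Suc fps_of_nat)
    then show ?thesis unfolding *[symmetric] by (simp only: mult.assoc[symmetric] mult_1)
  qed
  moreover have "nonneg_sums s (fps_const (1 / real (Suc j)) * ((of_nat j + fps_const be * fps_X) * log_power_spec al be j))
      (1 / real (Suc j) * ((real j + be * s) * rising (be * s) j))"
    using assms Suc by (intro nonneg_sums_mult nonneg_sums_add nonneg_sums_const nonneg_sums_of_nat nonneg_sums_X) auto
  moreover have "1 / real (Suc j) * ((real j + be * s) * rising (be * s) j) = rising (be * s) (Suc j)"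
    unfolding rising_Suc[symmetric] by simp
  ultimately show ?case by simp
qed

lemma specialize_polylog_reg_series_rec:
  assumes "admissible v"
  shows "(of_nat M - fps_const (al + 1) * fps_X) * specialize (- al) (- be) (polylog_reg_series v M) =
    (\<Sum>i\<le>M. log_power_spec al be (M - i) * ((of_nat i - fps_const (al + 1) * fps_X) * polylog_spec al v i))"
proof -
  have "specialize (- al) (- be) (of_nat M + fps_const fps_X - fps_const (fps_const fps_X)) =
      diag (- al) (of_nat M + fps_X - fps_const fps_X)"
    by (simp only: specialize_diff specialize_add specialize_of_nat specialize_const diag_add diag_diff diag_of_nat)
  then show ?thesis
    using arg_cong[OF polylog_reg_series_rec[OF assms, of M], of "specialize (- al) (- be)"]
    by (simp only: specialize_mult specialize_sum specialize_const diag_mult diag_lin_ext polylog_spec_def log_power_spec_def)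
qed

text \<open>Only the product of the two factors \<open>i - (\<alpha> + 1) s\<close> and \<open>s_v(i)\<close> has coefficients of mixed
  sign; splitting it leaves two series with nonnegative terms.\<close>

lemma eval_K:
  fixes al be s :: real and v :: "letter list"
  defines "A \<equiv> al * s" and "C \<equiv> (al + 1) * s" and "B \<equiv> be * s"
  assumes v: "admissible v" and pos: "al > 0" "be > 0" "s > 0" and small: "C < 1/2" "B \<le> 1/4"
  obtains S where "(\<lambda>i. shifted_sum A C v i * Gamma (real i + 1 - C) / Gamma (real i + 1 - C - B)) sums S"
    "(\<lambda>N. specialize (- al) (- be) (zeta_series v) $ N * s ^ N) sums (Gamma (1 - B) * S)"
proof -
  have C: "0 < C" "0 \<le> A" "A < 1" "C < 1" and B: "0 < B"
    using pos small by (auto simp: C_def A_def B_def distrib_right add_pos_pos)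
  have vY: "v = [] \<or> hd v = LY" using v by (auto simp: admissible_def)
  define k where "k M = specialize (- al) (- be) (polylog_reg_series v M)" for M
  define w1 where "w1 i = real i * shifted_sum A C v i" for i
  define w2 where "w2 i = C * shifted_sum A C v i" for i
  define G where "G = (\<lambda>f M. geo (al + 1) M * (\<Sum>i\<le>M. log_power_spec al be (M - i) * (f i * polylog_spec al v i)))"
  \<comment> \<open>Index 0 is set by hand, since \<open>geo\<close> inverts m - c X only for m
    \<ge> 1. The value is that of the empty nested sum.\<close>
  define G1 where "G1 M = (if M = 0 then (if v = [] then 1 else 0) else G of_nat M)" for M
  define G2 where "G2 M = (if M = 0 then 0 else G (\<lambda>_. fps_const (al + 1) * fps_X) M)" for M
  define r where "r w M = (\<Sum>i\<le>M. rising B (M - i) * w i) / (real M - C)" for w M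
  define r1 where "r1 M = (if M = 0 then (if v = [] then 1 else 0) else r w1 M)" for M
  define r2 where "r2 M = (if M = 0 then 0 else r w2 M)" for M
  have kG: "k M = G1 M - G2 M" for M
  proof (cases "M = 0")
    case True
    \<comment> \<open>At M = 0 the recursion reads (\<alpha> + 1) X times an equation, and this
      nonzero factor has to be cancelled.\<close>
    have ne: "fps_const (al + 1) * fps_X \<noteq> (0 :: real fps)"
      using pos by (simp add: fps_const_eq_0_iff)
    have "fps_const (al + 1) * fps_X * k 0 = fps_const (al + 1) * fps_X * polylog_spec al v 0"
      using specialize_polylog_reg_series_rec[OF v, of 0 al be] by (simp add: k_def log_power_spec_def log_power_series_0 specialize_1)
    then have "k 0 = polylog_spec al v 0" using ne by (metis mult_cancel_left)
    then show ?thesis using True by (cases "v = []") (auto simp: G1_def G2_def polylog_spec_Nil polylog_spec_0)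
  next
    case False
    have "k M = geo (al + 1) M * (\<Sum>i\<le>M. log_power_spec al be (M - i) * ((of_nat i - fps_const (al + 1) * fps_X) * polylog_spec al v i))"
      using False specialize_polylog_reg_series_rec[OF v, of M al be] by (intro geo_cancel) (auto simp: k_def)
    then show ?thesis
      using False by (simp add: G1_def G2_def G_def left_diff_distrib right_diff_distrib sum_subtractf)
  qed
  have polylog_spec: "nonneg_sums s (polylog_spec al v i) (shifted_sum A C v i)" for i
    unfolding A_def C_def using vY pos small by (intro nonneg_sums_polylog_spec) (auto simp: C_def)
  have evG: "nonneg_sums s (G f M) (r (\<lambda>i. h i * shifted_sum A C v i) M)"
    if "\<And>i. nonneg_sums s (f i) (h i)" "M \<ge> 1" for f h M
  proof -
    have "nonneg_sums s (G f M) (1 / (real M - C) * (\<Sum>i\<le>M. rising B (M - i) * (h i * shifted_sum A C v i)))"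
      unfolding G_def C_def B_def using pos small that C
      by (intro nonneg_sums_mult nonneg_sums_sum nonneg_sums_geo nonneg_sums_log_power_spec polylog_spec[unfolded C_def]) (auto simp: C_def)
    then show ?thesis by (simp add: r_def)
  qed
  have ev1: "nonneg_sums s (G1 M) (r1 M)" for M
  proof (cases "M = 0")
    case False
    then show ?thesis using evG[of of_nat real M] by (simp add: G1_def r1_def w1_def[abs_def] nonneg_sums_of_nat)
  qed (auto simp: G1_def r1_def nonneg_sums_0 nonneg_sums_1)
  have ev2: "nonneg_sums s (G2 M) (r2 M)" for M
  proof (cases "M = 0")
    case False
    have "nonneg_sums s (fps_const (al + 1) * fps_X) C"
      unfolding C_def using pos by (intro nonneg_sums_mult nonneg_sums_const nonneg_sums_X) auto
    then show ?thesis using False evG[of "\<lambda>_. fps_const (al + 1) * fps_X" "\<lambda>_. C" M]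
      by (simp add: G2_def r2_def w2_def[abs_def])
  qed (auto simp: G2_def r2_def nonneg_sums_0)
  have main: "(\<lambda>N. specialize (- al) (- be) (zeta_series v) $ N * s ^ N) sums (R1 - R2)"
    if r1: "r1 sums R1" and r2: "r2 sums R2" for R1 R2
  proof -
    note 1 = nonneg_sums_suminf[OF ev1 r1 pos(3)]
    note 2 = nonneg_sums_suminf[OF ev2 r2 pos(3)]
    have "(\<lambda>M. k M $ N) sums ((suminf (\<lambda>M. G1 M $ N)) - (suminf (\<lambda>M. G2 M $ N)))" for N
      unfolding kG fps_sub_nth by (intro sums_diff summable_sums 1(1) 2(1))
    then have "specialize (- al) (- be) (zeta_series v) $ N = (suminf (\<lambda>M. G1 M $ N)) - (suminf (\<lambda>M. G2 M $ N))" for N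
      using specialize_polylog_reg_series_sums[of "- al" "- be" v N] by (auto simp: k_def dest: sums_unique2)
    then show ?thesis
      using sums_diff[OF 1(2) 2(2)] by (simp add: left_diff_distrib)
  qed
  define g where "g i = shifted_sum A C v i * Gamma (real i + 1 - C) / Gamma (real i + 1 - C - B)" for i
  show ?thesis
  proof (cases "v = []")
    case True
    \<comment> \<open>For the empty word the nested sum is concentrated at i = 0, outside the range
      of the Beta evaluation; the modified summation \<open>rising_sums_neg\<close> takes its
      place.\<close>
    have r1: "r1 sums 1"
    proof -
      have "r1 = (\<lambda>M. if M = 0 then 1 else 0)"
        unfolding r1_def r_def w1_def True by (auto simp: fun_eq_iff intro!: sum.neutral)
      then show ?thesis using sums_single[of 0 "\<lambda>_. 1 :: real"] by simp
    qed
    have "r2 = (\<lambda>j. if j = 0 then 0 else C * rising B j / (real j - C))"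
    proof
      fix j
      have "(\<Sum>i\<le>j. rising B (j - i) * w2 i) = (\<Sum>i\<in>{0}. rising B (j - i) * w2 i)"
        by (rule sum.mono_neutral_right) (auto simp: w2_def True)
      then show "r2 j = (if j = 0 then 0 else C * rising B j / (real j - C))"
        by (simp add: r2_def r_def w2_def True mult.commute)
    qed
    then have r2: "r2 sums (1 - Gamma (1 - B) * Gamma (1 - C) / Gamma (1 - C - B))"
      using rising_sums_neg[OF C(1) small(1) B small(2)] by simp
    have "g sums (Gamma (1 - C) / Gamma (1 - C - B))"
    proof -
      have "g = (\<lambda>i. if i = 0 then Gamma (1 - C) / Gamma (1 - C - B) else 0)"
        by (auto simp: g_def True)
      then show ?thesis using sums_single[of 0 "\<lambda>_. Gamma (1 - C) / Gamma (1 - C - B)"] by simp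
    qed
    then show ?thesis using main[OF r1 r2] that by (simp add: g_def[abs_def])
  next
    case False
    then obtain u where u: "v = u @ [LX]"
      using v by (metis admissible_def append_butlast_last_id)
    define ph where "ph i = Gamma (real i - C) * Gamma (1 - B) / Gamma (real i - C + 1 - B)" for i
    have w0: "w1 0 = 0" "w2 0 = 0" using False by (simp_all add: w1_def w2_def shifted_sum_0)
    have wnn: "w1 i \<ge> 0" "w2 i \<ge> 0" for i
      using C by (auto simp: w1_def w2_def shifted_sum_nonneg)
    have s1: "summable (\<lambda>i. w1 i * ph i)"
    proof -
      obtain D1 D2 where D: "\<forall>m\<ge>1. \<bar>w1 m\<bar> \<le> D1 * real m powr (-7/8)" "\<forall>m\<ge>1. \<bar>ph m\<bar> \<le> D2 * real m powr (-1/4)"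
        using power_bounded_shifted_sum_LX[of A C u] rising_Beta_bound[OF C(1) small(1) B small(2)] C
        by (auto simp: power_bounded_def w1_def u ph_def)
      \<comment> \<open>The exponents -7/8 of the weighted nested sum and -1/4 of the Gamma quotient
        add up to -9/8 < -1.\<close>
      have "\<bar>w1 m * ph m\<bar> \<le> (D1 * D2) * real m powr (-9/8)" if m: "m \<ge> 1" for m
      proof -
        have "\<bar>w1 m * ph m\<bar> \<le> (D1 * real m powr (-7/8)) * (D2 * real m powr (-1/4))"
          unfolding abs_mult using D m by (intro mult_mono) (auto intro: order_trans[OF abs_ge_zero])
        also have "\<dots> = (D1 * D2) * (real m powr (-7/8) * real m powr (-1/4))" by simp
        also have "real m powr (-7/8) * real m powr (-1/4) = real m powr (-9/8)"
          by (simp add: powr_add[symmetric])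
        finally show ?thesis .
      qed
      then have "power_bounded (-9/8) (\<lambda>m. w1 m * ph m)" unfolding power_bounded_def by blast
      then show ?thesis by (intro summable_rabs_cancel[OF power_bounded_summable]) auto
    qed
    have s2: "summable (\<lambda>i. w2 i * ph i)"
    proof (rule summable_comparison_test'[OF s1])
      fix i :: nat assume i: "i \<ge> 1"
      then have "ph i \<ge> 0"
        using C small B unfolding ph_def
        by (intro divide_nonneg_nonneg mult_nonneg_nonneg less_imp_le[OF Gamma_real_pos]) auto
      moreover have "w2 i \<le> w1 i"
        using i C shifted_sum_nonneg[of A C v i] by (auto simp: w1_def w2_def intro!: mult_right_mono)
      ultimately show "norm (w2 i * ph i) \<le> w1 i * ph i"
        using wnn[of i] by (simp add: mult_right_mono)
    qed
    define R1 where "R1 = suminf (\<lambda>i. w1 i * ph i)"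
    define R2 where "R2 = suminf (\<lambda>i. w2 i * ph i)"
    have R: "(\<lambda>i. w1 i * ph i) sums R1" "(\<lambda>i. w2 i * ph i) sums R2"
      unfolding R1_def R2_def by (intro summable_sums s1 s2)+
    have "r w1 sums R1" "r w2 sums R2"
      unfolding r_def using R C small B wnn w0
      by (auto simp: ph_def[abs_def] intro!: rising_convolution_sums)
    moreover have "r1 = r w1" "r2 = r w2"
      using False w0 by (auto simp: r1_def r2_def r_def)
    ultimately have sum: "(\<lambda>N. specialize (- al) (- be) (zeta_series v) $ N * s ^ N) sums (R1 - R2)"
      by (intro main) simp_all
    have "w1 i * ph i - w2 i * ph i = Gamma (1 - B) * g i" for i
    proof (cases "i = 0")
      case False
      have "real i - C \<noteq> 0" "real i - C > 0" using False C by linarith+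
      \<comment> \<open>The difference of the two weights is the factor i - C, which the functional
        equation absorbs into Gamma; this undoes the splitting into two nonnegative series.\<close>
      then have "(real i - C) * Gamma (real i - C) = Gamma (real i + 1 - C)"
        using Gamma_plus1[of "real i - C"] by (simp add: diff_add_eq nonpos_Ints_def)
      moreover have "w1 i * ph i - w2 i * ph i =
          Gamma (1 - B) * (shifted_sum A C v i * ((real i - C) * Gamma (real i - C)) / Gamma (real i - C + 1 - B))"
        by (simp add: w1_def w2_def ph_def algebra_simps diff_divide_distrib)
      moreover have "real i - C + 1 - B = real i + 1 - C - B" by simp
      ultimately show ?thesis by (simp only: g_def)
    qed (use w0 False in \<open>simp add: g_def shifted_sum_0\<close>)
    then have "(\<lambda>i. Gamma (1 - B) * g i) sums (R1 - R2)"
      using sums_diff[OF R] by simp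
    moreover have "Gamma (1 - B) > 0" using small B by (intro Gamma_real_pos) auto
    ultimately have "g sums ((R1 - R2) / Gamma (1 - B))"
      using sums_mult[of "\<lambda>i. Gamma (1 - B) * g i" "R1 - R2" "1 / Gamma (1 - B)"] by simp
    then show ?thesis using sum that \<open>Gamma (1 - B) > 0\<close> by (simp add: g_def[abs_def])
  qed
qed

section \<open>Connected sums\<close>

definition connector :: "real \<Rightarrow> real \<Rightarrow> real \<Rightarrow> nat \<Rightarrow> nat \<Rightarrow> real" where
  "connector A B s m n = Gamma (real m + 1 - A - s) * Gamma (real n + 1 - B - s) / Gamma (real m + real n + 1 - A - B - s)"

lemma connector_commute: "connector A B s m n = connector B A s n m"
  by (simp add: connector_def algebra_simps)

text \<open>Values in \<open>ennreal\<close> let the double series be rearranged before its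
  convergence is known. Finiteness comes only from the end point
  \<open>connected_sum_Nil\<close>.\<close>

definition connected_sum :: "real \<Rightarrow> real \<Rightarrow> real \<Rightarrow> letter list \<Rightarrow> letter list \<Rightarrow> ennreal" where
  "connected_sum A B s u w = suminf (\<lambda>m. suminf (\<lambda>n. ennreal (shifted_sum A (A + s) u m * shifted_sum B (B + s) w n * connector A B s m n)))"

lemma ennreal_suminf_swap:
  "suminf (\<lambda>i. suminf (\<lambda>j. f i j)) = suminf (\<lambda>j. suminf (\<lambda>i. f i j :: ennreal))"
proof -
  have "suminf (\<lambda>i. suminf (\<lambda>j. f i j)) = (\<integral>\<^sup>+i. suminf (\<lambda>j. f i j) \<partial>count_space UNIV)"
    by (simp add: nn_integral_count_space_nat)
  also have "\<dots> = suminf (\<lambda>j. \<integral>\<^sup>+i. f i j \<partial>count_space UNIV)"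
    by (rule nn_integral_suminf) simp
  finally show ?thesis by (simp add: nn_integral_count_space_nat)
qed

lemma connected_sum_commute: "connected_sum A B s u w = connected_sum B A s w u"
  unfolding connected_sum_def by (subst ennreal_suminf_swap) (simp add: connector_commute[of A] mult_ac)

context
  fixes A B s :: real
  assumes nonneg: "0 \<le> A" "0 \<le> B" "0 \<le> s" and small: "A + B + s < 1"
begin

lemma connector_pos: "connector A B s m n > 0"
proof -
  have "real m + real n + 1 - A - B - s > 0" using nonneg small by linarith
  then show ?thesis
    unfolding connector_def using nonneg small by (intro divide_pos_pos mult_pos_pos Gamma_real_pos) auto
qed

text \<open>With x = n + 1 - B - s and y = m + n + 1 - A - B - s, raising n by one multiplies the
  connector by x/y, and y - x = m - A.\<close>

lemma connector_step:
  "connector A B s m n - connector A B s m (Suc n) = (real m - A) * (connector A B s m (Suc n) / (real (Suc n) - (B + s)))"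
proof -
  define x where "x = real n + 1 - B - s"
  define y where "y = real m + real n + 1 - A - B - s"
  have pos: "x > 0" "y > 0" using nonneg small by (auto simp: x_def y_def)
  then have "x \<notin> nonpos_Ints" "y \<notin> nonpos_Ints" by (auto elim!: nonpos_Ints_cases)
  with pos have G: "Gamma (x + 1) = x * Gamma x" "Gamma (y + 1) = y * Gamma y" "Gamma y > 0"
    by (simp_all add: Gamma_plus1 Gamma_real_pos)
  define c where "c = Gamma (real m + 1 - A - s) * Gamma x / Gamma y"
  have 1: "connector A B s m n = c" by (simp add: connector_def c_def x_def y_def)
  have eqs: "real (Suc n) + 1 - B - s = x + 1" "real m + real (Suc n) + 1 - A - B - s = y + 1"
    by (simp_all add: x_def y_def)
  have 2: "connector A B s m (Suc n) = c * x / y"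
    unfolding connector_def eqs G(1,2) c_def by (simp add: mult_ac)
  have 3: "real (Suc n) - (B + s) = x" "real m - A = y - x" by (simp_all add: x_def y_def)
  show ?thesis unfolding 1 2 3 using pos by (simp add: field_simps)
qed

text \<open>No asymptotics of Gamma are used. The connector decreases in n to some l \<ge> 0, and
  telescoping makes the series of its values divided by n + 1 - B - s converge; that series
  dominates l times the harmonic series, so l = 0.\<close>

lemma connector_tendsto_0:
  assumes "m \<ge> 1"
  shows "(\<lambda>n. connector A B s m n) \<longlonglongrightarrow> 0"
proof -
  have mA: "real m - A > 0" using assms nonneg small by linarith
  have sn: "real (Suc n) - (B + s) > 0" for n using nonneg small by simp
  have "connector A B s m (Suc n) \<le> connector A B s m n" for n
  proof -
    have "(real m - A) * (connector A B s m (Suc n) / (real (Suc n) - (B + s))) \<ge> 0"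
      using mA sn[of n] connector_pos[of m "Suc n"] by (intro mult_nonneg_nonneg divide_nonneg_nonneg) auto
    then show ?thesis using connector_step[of m n] by linarith
  qed
  then have dec: "decseq (connector A B s m)" by (rule decseq_SucI)
  then obtain l where l: "connector A B s m \<longlonglongrightarrow> l" "\<forall>n. l \<le> connector A B s m n"
    using decseq_convergent[of "connector A B s m" 0] connector_pos less_imp_le by blast
  have "l \<ge> 0" by (rule LIMSEQ_le_const[OF l(1)]) (use connector_pos less_imp_le in blast)
  have "(\<lambda>n. connector A B s m n - connector A B s m (Suc n)) sums (connector A B s m 0 - l)"
    by (rule telescope_sums'[OF l(1)])
  then have sm: "summable (\<lambda>n. connector A B s m (Suc n) / (real (Suc n) - (B + s)))"
    unfolding connector_step using mA by (auto dest!: sums_summable simp only: summable_cmult_iff)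
  have "summable (\<lambda>n. l * (1 / real (Suc n)))"
  proof (rule summable_comparison_test'[OF sm])
    fix n :: nat
    have "l * (1 / real (Suc n)) \<le> connector A B s m (Suc n) * (1 / (real (Suc n) - (B + s)))"
      using l(2) sn[of n] \<open>l \<ge> 0\<close> nonneg less_imp_le[OF connector_pos[of m "Suc n"]]
      by (intro mult_mono frac_le) auto
    then show "norm (l * (1 / real (Suc n))) \<le> connector A B s m (Suc n) / (real (Suc n) - (B + s))"
      using \<open>l \<ge> 0\<close> by simp
  qed
  moreover have "\<not> summable (\<lambda>n. 1 / real (Suc n))"
    using not_summable_harmonic summable_Suc_iff[of "\<lambda>n. 1 / real n"] by (simp add: inverse_eq_divide)
  ultimately have "l = 0" unfolding summable_cmult_iff by blast
  then show ?thesis using l by simp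
qed

lemma connector_sums:
  assumes "m \<ge> 1"
  shows "(\<lambda>n. if j < n then connector A B s m n / (real n - (B + s)) else 0) sums (connector A B s m j / (real m - A))"
proof -
  have mA: "real m - A > 0" using assms nonneg small by linarith
  have "(\<lambda>n. connector A B s m (n + j)) \<longlonglongrightarrow> 0"
    by (rule LIMSEQ_ignore_initial_segment[OF connector_tendsto_0[OF assms]])
  from telescope_sums'[OF this]
  have "(\<lambda>n. (real m - A) * (connector A B s m (Suc (n + j)) / (real (Suc (n + j)) - (B + s)))) sums connector A B s m j"
    by (simp add: connector_step del: of_nat_Suc)
  from sums_mult[OF this, of "1 / (real m - A)"]
  have "(\<lambda>n. connector A B s m (Suc (n + j)) / (real (Suc (n + j)) - (B + s))) sums (connector A B s m j / (real m - A))"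
    using mA by simp
  then have "(\<lambda>n. if j < n + Suc j then connector A B s m (n + Suc j) / (real (n + Suc j) - (B + s)) else 0) sums
      (connector A B s m j / (real m - A) - (\<Sum>i<Suc j. if j < i then connector A B s m i / (real i - (B + s)) else 0))"
    by simp
  then show ?thesis by (subst (asm) sums_iff_shift') 
qed

text \<open>Telescoping trades the division by m - A, the effect of x on the left, for the sum over
  n > j divided by n - B - s, the effect of y on the right. It needs m \<ge> 1, and the terms with m
  = 0 vanish since u is nonempty.\<close>

lemma connected_sum_transport:
  assumes "u \<noteq> []"
  shows "connected_sum A B s (u @ [LX]) w = connected_sum A B s u (w @ [LY])"
proof -
  have svnn: "shifted_sum A (A + s) v k \<ge> 0" "shifted_sum B (B + s) v k \<ge> 0" for v k
    using nonneg small by (auto intro!: shifted_sum_nonneg)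
  have inner: "suminf (\<lambda>n. ennreal (shifted_sum A (A + s) (u @ [LX]) m * shifted_sum B (B + s) w n * connector A B s m n)) =
      suminf (\<lambda>n. ennreal (shifted_sum A (A + s) u m * shifted_sum B (B + s) (w @ [LY]) n * connector A B s m n))" for m
  proof (cases "m = 0")
    case True
    then show ?thesis using assms by (simp add: shifted_sum_0)
  next
    case False
    then have m: "m \<ge> 1" by simp
    have mA: "real m - A > 0" using m nonneg small by linarith
    define a where "a j = shifted_sum A (A + s) u m * shifted_sum B (B + s) w j" for j
    define d where "d j n = (if j < n then connector A B s m n / (real n - (B + s)) else 0)" for j n
    have ann: "a j \<ge> 0" for j by (simp add: a_def svnn)
    have dnn: "d j n \<ge> 0" for j n
    proof (cases "j < n")
      case True
      then have "real n \<ge> 1" by simp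
      then have "real n - (B + s) > 0" using nonneg small by linarith
      then show ?thesis using connector_pos[of m n] by (simp add: d_def)
    qed (simp add: d_def)
    have "ennreal (shifted_sum A (A + s) u m * shifted_sum B (B + s) (w @ [LY]) n * connector A B s m n) =
        suminf (\<lambda>j. ennreal (a j * d j n))" for n
    proof -
      have "shifted_sum A (A + s) u m * shifted_sum B (B + s) (w @ [LY]) n * connector A B s m n = (\<Sum>j<n. a j * d j n)"
        by (simp add: a_def d_def sum_distrib_left sum_distrib_right sum_divide_distrib)
      then have "ennreal (shifted_sum A (A + s) u m * shifted_sum B (B + s) (w @ [LY]) n * connector A B s m n) =
          (\<Sum>j<n. ennreal (a j * d j n))"
        using ann dnn by (simp add: sum_ennreal)
      also have "\<dots> = suminf (\<lambda>j. ennreal (a j * d j n))"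
        by (rule suminf_finite[symmetric]) (auto simp: d_def)
      finally show ?thesis .
    qed
    then have "suminf (\<lambda>n. ennreal (shifted_sum A (A + s) u m * shifted_sum B (B + s) (w @ [LY]) n * connector A B s m n)) =
        suminf (\<lambda>j. suminf (\<lambda>n. ennreal (a j * d j n)))"
      by (simp only: ennreal_suminf_swap[of "\<lambda>j n. ennreal (a j * d j n)"])
    also have "(\<lambda>j. suminf (\<lambda>n. ennreal (a j * d j n))) = (\<lambda>j. ennreal (a j * (connector A B s m j / (real m - A))))"
      using ann dnn by (intro ext suminf_ennreal_eq sums_mult connector_sums[OF m, folded d_def]) auto
    also have "\<dots> = (\<lambda>n. ennreal (shifted_sum A (A + s) (u @ [LX]) m * shifted_sum B (B + s) w n * connector A B s m n))"
      using False by (simp add: a_def)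
    finally show ?thesis by simp
  qed
  show ?thesis unfolding connected_sum_def inner ..
qed

end

definition dual :: "letter list \<Rightarrow> letter list" where
  "dual w = rev (map swap_letter w)"

lemma dual_simps: "dual [] = []" "dual (q # w) = dual w @ [swap_letter q]" "dual w = [] \<longleftrightarrow> w = []"
  by (simp_all add: dual_def)

text \<open>Moving an x needs a nonempty word on the left, moving a y a nonempty word on the right.
  Since the whole word begins with y and ends with x, this holds at every stage.\<close>

lemma connected_sum_dual_aux:
  assumes "0 \<le> A" "0 \<le> B" "0 \<le> s" "A + B + s < 1"
    and "hd (u @ r) = LY" "last (u @ r) = LX"
  shows "connected_sum A B s u (dual r) = connected_sum A B s (u @ r) []"
  using assms(5,6)
proof (induction r arbitrary: u)
  case (Cons q r)
  have "connected_sum A B s u (dual r @ [swap_letter q]) = connected_sum A B s (u @ [q]) (dual r)"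
  proof (cases q)
    case LX
    then have "u \<noteq> []" using Cons.prems by auto
    then show ?thesis using connected_sum_transport[OF assms(1-4), of u "dual r"] LX by simp
  next
    case LY
    then have "dual r \<noteq> []" using Cons.prems by (auto simp: dual_simps)
    then have "connected_sum B A s (dual r @ [LX]) u = connected_sum B A s (dual r) (u @ [LY])"
      using assms(1-4) by (intro connected_sum_transport) auto
    then show ?thesis using LY by (simp add: connected_sum_commute[of A B])
  qed
  then show ?case using Cons.IH[of "u @ [q]"] Cons.prems by (simp add: dual_simps)
qed (simp add: dual_simps)

lemma connected_sum_dual:
  assumes "0 \<le> A" "0 \<le> B" "0 \<le> s" "A + B + s < 1" "admissible v"
  shows "connected_sum A B s v [] = connected_sum B A s (dual v) []"
proof -
  have "connected_sum A B s [] (dual v) = connected_sum A B s v []"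
    using connected_sum_dual_aux[OF assms(1-4), of "[]" v] assms(5)
    by (cases "v = []") (auto simp: admissible_def dual_simps)
  then show ?thesis by (simp add: connected_sum_commute[of B A])
qed

lemma connected_sum_Nil:
  assumes "0 \<le> A" "0 \<le> B" "0 \<le> s" "A + B + s < 1"
    and "(\<lambda>i. shifted_sum A (A + s) v i * Gamma (real i + 1 - (A + s)) / Gamma (real i + 1 - (A + s) - B)) sums S"
  shows "connected_sum A B s v [] = ennreal (S * Gamma (1 - B - s))" "S \<ge> 0"
proof -
  have svnn: "shifted_sum A (A + s) v k \<ge> 0" for k
    using assms by (auto intro!: shifted_sum_nonneg)
  have gpos: "Gamma (real i + 1 - (A + s)) / Gamma (real i + 1 - (A + s) - B) > 0" for i
    using assms by (intro divide_pos_pos Gamma_real_pos) auto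
  have nn: "shifted_sum A (A + s) v i * Gamma (real i + 1 - (A + s)) / Gamma (real i + 1 - (A + s) - B) \<ge> 0" for i
    using mult_nonneg_nonneg[OF svnn less_imp_le[OF gpos]] by simp
  show "S \<ge> 0" using sums_le[OF _ sums_zero assms(5)] nn by simp
  have g0: "Gamma (1 - B - s) > 0" using assms by (intro Gamma_real_pos) auto
  have "suminf (\<lambda>n. ennreal (shifted_sum A (A + s) v m * shifted_sum B (B + s) [] n * connector A B s m n)) =
      ennreal (shifted_sum A (A + s) v m * Gamma (real m + 1 - (A + s)) / Gamma (real m + 1 - (A + s) - B) * Gamma (1 - B - s))" for m
  proof -
    have "suminf (\<lambda>n. ennreal (shifted_sum A (A + s) v m * shifted_sum B (B + s) [] n * connector A B s m n)) =
        (\<Sum>n\<in>{0}. ennreal (shifted_sum A (A + s) v m * shifted_sum B (B + s) [] n * connector A B s m n))"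
      by (rule suminf_finite) auto
    then show ?thesis by (simp add: connector_def algebra_simps)
  qed
  then show "connected_sum A B s v [] = ennreal (S * Gamma (1 - B - s))"
    unfolding connected_sum_def
    by (simp only:) (intro suminf_ennreal_eq sums_mult2 assms(5) mult_nonneg_nonneg[OF nn] less_imp_le[OF g0])
qed

section \<open>The Taylor series of the Gamma function\<close>

text \<open>\<open>gamma_fps\<close> is built from real derivatives, while its convergence comes
  from holomorphy. Differentiating along the real axis shows that the two kinds of derivatives
  agree, the imaginary part being constantly 0 there.\<close>

lemma higher_deriv_Gamma_of_real:
  "x > 0 \<Longrightarrow> (deriv ^^ n) Gamma (complex_of_real x) = of_real ((deriv ^^ n) Gamma x)"
proof (induction n arbitrary: x)
  case 0
  then show ?case by (simp add: Gamma_complex_of_real)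
next
  case (Suc n)
  define g where "g = (deriv ^^ n) (Gamma :: complex \<Rightarrow> complex)"
  define gr where "gr = (deriv ^^ n) (Gamma :: real \<Rightarrow> real)"
  define d where "d = deriv g (of_real x)"
  have hol: "g holomorphic_on {z. Re z > 0}"
    unfolding g_def
    by (intro holomorphic_higher_deriv holomorphic_Gamma) (auto simp: open_halfspace_Re_gt elim!: nonpos_Ints_cases)
  have "(g has_field_derivative d) (at (of_real x))"
    unfolding d_def using Suc.prems by (intro holomorphic_derivI[OF hol]) (auto simp: open_halfspace_Re_gt)
  then have "((\<lambda>t. g (of_real t)) has_vector_derivative d) (at x)"
    by (rule has_vector_derivative_real_field)
  then have *: "((\<lambda>t. complex_of_real (gr t)) has_vector_derivative d) (at x)"
    by (rule has_vector_derivative_transform_within_open[of _ _ _ "{0<..}"])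
       (use Suc in \<open>auto simp: g_def gr_def\<close>)
  have "((\<lambda>t. gr t) has_vector_derivative Re d) (at x)"
    using bounded_linear.has_vector_derivative[OF bounded_linear_Re *] by simp
  then have "deriv gr x = Re d"
    by (simp add: DERIV_imp_deriv has_real_derivative_iff_has_vector_derivative)
  moreover have "((\<lambda>t. 0 :: real) has_vector_derivative Im d) (at x)"
    using bounded_linear.has_vector_derivative[OF bounded_linear_Im *] by simp
  then have "Im d = 0"
    using vector_derivative_unique_at has_vector_derivative_const by blast
  ultimately show ?case
    by (simp add: d_def g_def gr_def complex_eq_iff)
qed

lemma gamma_fps_sums:
  assumes "\<bar>z\<bar> < 1"
  shows "(\<lambda>n. gamma_fps $ n * z ^ n) sums Gamma (1 + z)"
proof -
  have hol: "Gamma holomorphic_on ball (1 :: complex) 1"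
  proof (rule holomorphic_Gamma)
    show "ball (1 :: complex) 1 \<inter> nonpos_Ints = {}"
    proof -
      have False if x: "x \<in> ball (1 :: complex) 1" "x \<in> nonpos_Ints" for x
      proof -
        obtain n where n: "x = of_int n" "n \<le> 0" using x(2) by (auto elim: nonpos_Ints_cases)
        then have "1 \<le> \<bar>Re (1 - x)\<bar>" by simp
        also have "\<dots> \<le> norm (1 - x)" by (rule abs_Re_le_cmod)
        finally show False using x(1) by (simp add: dist_norm)
      qed
      then show ?thesis by blast
    qed
  qed
  have "complex_of_real (1 + z) \<in> ball 1 1" using assms by (simp add: dist_norm)
  from holomorphic_power_series[OF hol this]
  have "(\<lambda>n. complex_of_real (gamma_fps $ n * z ^ n)) sums complex_of_real (Gamma (1 + z))"
    using higher_deriv_Gamma_of_real[of 1] assms Gamma_complex_of_real[of "1 + z"]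
    by (simp add: gamma_fps_def)
  then show ?thesis by (simp only: sums_of_real_iff)
qed

lemma gamma_fps_0: "gamma_fps $ 0 = 1"
  by (simp add: gamma_fps_def)

section \<open>Identities of power series from identities of their sums\<close>

text \<open>Values are known only for s > 0. If the difference were nonzero, dividing by its lowest
  power of s and letting s tend to 0 from the right would force its leading coefficient to be
  0.\<close>

lemma fps_eqI_sums:
  fixes F G :: "real fps"
  assumes "\<epsilon> > 0" "\<And>s. 0 < s \<Longrightarrow> s < \<epsilon> \<Longrightarrow> (\<lambda>N. F $ N * s ^ N) sums f s"
    "\<And>s. 0 < s \<Longrightarrow> s < \<epsilon> \<Longrightarrow> (\<lambda>N. G $ N * s ^ N) sums f s"
  shows "F = G"
proof (rule ccontr)
  assume "F \<noteq> G"
  define D where "D = F - G"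
  define d where "d = subdegree D"
  define D' where "D' = fps_shift d D"
  have "D \<noteq> 0" using \<open>F \<noteq> G\<close> by (simp add: D_def)
  then have D'0: "D' $ 0 \<noteq> 0" by (simp add: D'_def d_def nth_subdegree_nonzero)
  have D'_sums: "(\<lambda>N. D' $ N * s ^ N) sums 0" if s: "0 < s" "s < \<epsilon>" for s
  proof -
    have "(\<lambda>N. D $ N * s ^ N) sums 0"
      using sums_diff[OF assms(2)[OF s] assms(3)[OF s]] by (simp add: D_def left_diff_distrib)
    moreover have "D $ N = 0" if "N < d" for N
      using that unfolding d_def by (rule nth_less_subdegree_zero)
    ultimately have "(\<lambda>N. D $ (N + d) * s ^ (N + d)) sums 0"
      using sums_zero_iff_shift[of d "\<lambda>N. D $ N * s ^ N" 0] by simp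
    from sums_mult[OF this, of "1 / s ^ d"] show ?thesis
      using s by (simp add: D'_def power_add)
  qed
  have "(\<lambda>s. suminf (\<lambda>N. D' $ N * s ^ N)) \<midarrow>0\<rightarrow> D' $ 0"
  proof -
    have "summable (\<lambda>N. D' $ N * (\<epsilon> / 2) ^ N)"
      using D'_sums[of "\<epsilon> / 2"] assms(1) by (simp add: sums_iff)
    from powser_limit_0_strong[of "\<epsilon> / 2"] assms(1)
    have "isCont (\<lambda>s. suminf (\<lambda>N. D' $ N * s ^ N)) 0"
      using \<open>summable (\<lambda>N. D' $ N * (\<epsilon> / 2) ^ N)\<close> by (intro isCont_powser) auto
    then show ?thesis by (simp add: isCont_def)
  qed
  then have "((\<lambda>s. suminf (\<lambda>N. D' $ N * s ^ N)) \<longlongrightarrow> D' $ 0) (at_right 0)"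
    by (rule filterlim_mono) (auto simp: at_within_le_at)
  moreover have "\<forall>\<^sub>F s in at_right 0. suminf (\<lambda>N. D' $ N * s ^ N) = 0"
    using eventually_at_right_real[OF assms(1)] by eventually_elim (use D'_sums in \<open>auto simp: sums_iff\<close>)
  ultimately have "((\<lambda>_. 0) \<longlongrightarrow> D' $ 0) (at_right (0 :: real))"
    by (rule Lim_transform_eventually)
  then have "D' $ 0 = 0" by (simp add: tendsto_const_iff)
  with D'0 show False by simp
qed

definition expands :: "real fps \<Rightarrow> real \<Rightarrow> (real \<Rightarrow> real) \<Rightarrow> bool" where
  "expands F \<epsilon> f \<longleftrightarrow> (\<forall>s. 0 < s \<and> s < \<epsilon> \<longrightarrow> (\<lambda>N. F $ N * s ^ N) sums f s)"

lemma expands_mult: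
  assumes "expands F \<epsilon> f" "expands G \<epsilon> g"
  shows "expands (F * G) \<epsilon> (\<lambda>s. f s * g s)"
  unfolding expands_def
proof (intro allI impI)
  fix s assume s: "0 < s \<and> s < \<epsilon>"
  \<comment> \<open>Convergence at a point between s and \<epsilon> gives the absolute convergence
    at s that the Cauchy product requires.\<close>
  define t where "t = (s + \<epsilon>) / 2"
  have t: "0 < t" "t < \<epsilon>" "s < t" using s by (auto simp: t_def)
  have abs: "summable (\<lambda>N. norm (H $ N * s ^ N))" if "expands H \<epsilon> h" for H h
  proof (rule powser_insidea)
    show "summable (\<lambda>N. H $ N * t ^ N)" using that t by (auto simp: expands_def sums_iff)
  qed (use s t in simp)
  show "(\<lambda>N. (F * G) $ N * s ^ N) sums (f s * g s)"
    using assms s by (intro sums_fps_mult abs[OF assms(1)] abs[OF assms(2)]) (auto simp: expands_def)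
qed

definition dilate :: "'a \<Rightarrow> 'a fps \<Rightarrow> 'a::comm_ring_1 fps" where
  "dilate c F = Abs_fps (\<lambda>n. c ^ n * F $ n)"

lemma dilate_mult: "dilate c (F * G) = dilate c F * dilate c G"
proof (rule fps_ext)
  fix N
  have "c ^ N * (F $ i * G $ (N - i)) = (c ^ i * F $ i) * (c ^ (N - i) * G $ (N - i))" if "i \<le> N" for i
  proof -
    have "c ^ N = c ^ i * c ^ (N - i)" using that by (simp add: power_add[symmetric])
    then show ?thesis by (simp only: mult_ac)
  qed
  then show "dilate c (F * G) $ N = (dilate c F * dilate c G) $ N"
    by (simp add: dilate_def fps_mult_nth sum_distrib_left)
qed

lemma dilate_1: "dilate c 1 = 1"
  by (rule fps_ext) (simp add: dilate_def)

lemma expands_dilate_gamma: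
  assumes "\<bar>c\<bar> * \<epsilon> \<le> 1"
  shows "expands (dilate c gamma_fps) \<epsilon> (\<lambda>s. Gamma (1 + c * s))"
  unfolding expands_def
proof (intro allI impI)
  fix s assume s: "0 < s \<and> s < \<epsilon>"
  have "\<bar>c * s\<bar> < 1"
  proof (cases "c = 0")
    case False
    then have "\<bar>c\<bar> * s < \<bar>c\<bar> * \<epsilon>" using s by simp
    then show ?thesis using assms s by (simp add: abs_mult)
  qed simp
  from gamma_fps_sums[OF this] show "(\<lambda>N. dilate c gamma_fps $ N * s ^ N) sums Gamma (1 + c * s)"
    by (simp add: dilate_def power_mult_distrib mult_ac)
qed

section \<open>Duality of the generating series\<close>

lemma admissible_dual: "admissible v \<Longrightarrow> admissible (dual v)"
  unfolding admissible_def dual_def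
  by (cases "v = []") (auto simp: hd_rev last_rev last_map hd_map)

text \<open>The identity is cross-multiplied to avoid inverse Gamma series. At T = s it combines the
  two evaluations by \<open>eval_K\<close> with the equality of the connected sums of v and of its
  dual.\<close>

lemma specialize_duality:
  fixes al be :: real
  assumes v: "admissible v" and pos: "al > 0" "be > 0"
  shows "specialize (- be) (- al) (zeta_series (dual v)) * (dilate (- be) gamma_fps * dilate (- al - 1) gamma_fps) =
    (dilate (- al) gamma_fps * dilate (- be - 1) gamma_fps) * specialize (- al) (- be) (zeta_series v)"
proof -
  \<comment> \<open>For s < e the quantities A = \<alpha> s and B = \<beta> s satisfy A + B + s <
    1/4, which implies all smallness conditions, and the arguments of the Gamma expansions stay
    inside the unit disc.\<close>
  define e where "e = 1 / (4 * (al + be + 1))"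
  have e: "e > 0" using pos by (simp add: e_def)
  define f where "f = (\<lambda>s. suminf (\<lambda>N. specialize (- al) (- be) (zeta_series v) $ N * s ^ N))"
  define g where "g = (\<lambda>s. suminf (\<lambda>N. specialize (- be) (- al) (zeta_series (dual v)) $ N * s ^ N))"
  have main: "summable (\<lambda>N. specialize (- al) (- be) (zeta_series v) $ N * s ^ N)"
      "summable (\<lambda>N. specialize (- be) (- al) (zeta_series (dual v)) $ N * s ^ N)"
      "g s * (Gamma (1 + - be * s) * Gamma (1 + (- al - 1) * s)) =
       (Gamma (1 + - al * s) * Gamma (1 + (- be - 1) * s)) * f s"
    if s: "0 < s" "s < e" for s
  proof -
    define A where "A = al * s"
    define B where "B = be * s"
    have AB: "0 < A" "0 < B" using pos s by (auto simp: A_def B_def)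
    have small: "A + B + s < 1/4"
      using s(2) pos by (simp add: A_def B_def e_def field_simps)
    have C: "(al + 1) * s = A + s" "(be + 1) * s = B + s"
      by (simp_all add: A_def B_def algebra_simps)
    have bd: "A + s < 1/2" "B \<le> 1/4" "B + s < 1/2" "A \<le> 1/4" using small AB s by linarith+
    obtain S where S: "(\<lambda>i. shifted_sum A (A + s) v i * Gamma (real i + 1 - (A + s)) / Gamma (real i + 1 - (A + s) - B)) sums S"
      "(\<lambda>N. specialize (- al) (- be) (zeta_series v) $ N * s ^ N) sums (Gamma (1 - B) * S)"
      by (rule eval_K[OF v pos s(1), unfolded C, folded A_def B_def, OF bd(1,2)])
    obtain S' where S': "(\<lambda>i. shifted_sum B (B + s) (dual v) i * Gamma (real i + 1 - (B + s)) / Gamma (real i + 1 - (B + s) - A)) sums S'"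
      "(\<lambda>N. specialize (- be) (- al) (zeta_series (dual v)) $ N * s ^ N) sums (Gamma (1 - A) * S')"
      by (rule eval_K[OF admissible_dual[OF v] pos(2,1) s(1), unfolded C, folded A_def B_def, OF bd(3,4)])
    have "connected_sum A B s v [] = ennreal (S * Gamma (1 - B - s))" "S \<ge> 0"
      using connected_sum_Nil[OF _ _ _ _ S(1)] AB s small by auto
    moreover have "connected_sum B A s (dual v) [] = ennreal (S' * Gamma (1 - A - s))" "S' \<ge> 0"
      using connected_sum_Nil[OF _ _ _ _ S'(1)] AB s small by auto
    moreover have "connected_sum A B s v [] = connected_sum B A s (dual v) []"
      using AB s small v by (intro connected_sum_dual) auto
    moreover have "Gamma (1 - B - s) > 0" "Gamma (1 - A - s) > 0"
      using AB s small by (auto intro!: Gamma_real_pos)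
    ultimately have eq: "S * Gamma (1 - B - s) = S' * Gamma (1 - A - s)"
      by (simp add: ennreal_inj)
    have f: "f s = Gamma (1 - B) * S" and g: "g s = Gamma (1 - A) * S'"
      using S(2) S'(2) by (simp_all add: f_def g_def sums_iff)
    have eqs: "1 + - be * s = 1 - B" "1 + (- al - 1) * s = 1 - A - s" "1 + - al * s = 1 - A"
        "1 + (- be - 1) * s = 1 - B - s"
      by (simp_all add: A_def B_def algebra_simps)
    have "Gamma (1 - A) * S' * (Gamma (1 - B) * Gamma (1 - A - s)) =
        Gamma (1 - A) * Gamma (1 - B) * (S' * Gamma (1 - A - s))" by (simp only: mult_ac)
    also have "\<dots> = Gamma (1 - A) * Gamma (1 - B) * (S * Gamma (1 - B - s))" by (simp only: eq)
    finally show "g s * (Gamma (1 + - be * s) * Gamma (1 + (- al - 1) * s)) =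
       (Gamma (1 + - al * s) * Gamma (1 + (- be - 1) * s)) * f s"
      unfolding f g eqs by (simp only: mult_ac)
    show "summable (\<lambda>N. specialize (- al) (- be) (zeta_series v) $ N * s ^ N)"
      "summable (\<lambda>N. specialize (- be) (- al) (zeta_series (dual v)) $ N * s ^ N)"
      using S(2) S'(2) by (simp_all add: sums_iff)
  qed
  have K: "expands (specialize (- al) (- be) (zeta_series v)) e f" "expands (specialize (- be) (- al) (zeta_series (dual v))) e g"
    using main by (auto simp: expands_def f_def g_def intro: summable_sums)
  have Gc: "expands (dilate c gamma_fps) e (\<lambda>s. Gamma (1 + c * s))" if "\<bar>c\<bar> \<le> al + be + 1" for c
  proof (rule expands_dilate_gamma)
    have "\<bar>c\<bar> * e \<le> (al + be + 1) * e" using that e by (intro mult_right_mono) auto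
    also have "\<dots> \<le> 1" using pos by (simp add: e_def)
    finally show "\<bar>c\<bar> * e \<le> 1" .
  qed
  have G: "expands (dilate (- be) gamma_fps) e (\<lambda>s. Gamma (1 + - be * s))"
     "expands (dilate (- al) gamma_fps) e (\<lambda>s. Gamma (1 + - al * s))"
     "expands (dilate (- be - 1) gamma_fps) e (\<lambda>s. Gamma (1 + (- be - 1) * s))"
     "expands (dilate (- al - 1) gamma_fps) e (\<lambda>s. Gamma (1 + (- al - 1) * s))"
    by (rule Gc, use pos in simp)+
  show ?thesis
  proof (rule fps_eqI_sums[OF e])
    fix s assume s: "0 < s" "s < e"
    show "(\<lambda>N. ((dilate (- al) gamma_fps * dilate (- be - 1) gamma_fps) * specialize (- al) (- be) (zeta_series v)) $ N * s ^ N) sums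
        ((Gamma (1 + - al * s) * Gamma (1 + (- be - 1) * s)) * f s)"
      using expands_mult[OF expands_mult[OF G(2,3)] K(1)] s by (simp add: expands_def)
    show "(\<lambda>N. (specialize (- be) (- al) (zeta_series (dual v)) * (dilate (- be) gamma_fps * dilate (- al - 1) gamma_fps)) $ N * s ^ N) sums
        ((Gamma (1 + - al * s) * Gamma (1 + (- be - 1) * s)) * f s)"
      using expands_mult[OF K(2) expands_mult[OF G(1,4)]] s
      unfolding expands_def main(3)[OF s, symmetric] by blast
  qed
qed

lemma diag_subst_plain: "diag c (subst_plain f) = dilate c f"
proof (rule fps_ext)
  fix N
  have "(\<Sum>i\<le>N. c ^ i * fps_const (f $ i) $ (N - i)) = (\<Sum>i\<in>{N}. c ^ i * fps_const (f $ i) $ (N - i))"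
    by (rule sum.mono_neutral_right) auto
  then show "diag c (subst_plain f) $ N = dilate c f $ N"
    by (simp add: diag_def subst_plain_def dilate_def)
qed

text \<open>On the line U = c T the argument U - T is (c - 1) T; on coefficients this is the
  binomial theorem.\<close>

lemma diag_subst_shift: "diag c (subst_shift f) = dilate (c - 1) f"
proof (rule fps_ext)
  fix N
  have binom: "(c - 1) ^ N = (\<Sum>i\<le>N. of_nat (N choose i) * c ^ i * (-1) ^ (N - i))"
    using binomial_ring[of c "-1" N] by simp
  have *: "c ^ i * subst_shift f $ i $ (N - i) = of_nat (N choose i) * c ^ i * (-1) ^ (N - i) * f $ N"
    if "i \<le> N" for i
    using that binomial_symmetric[OF that] by (simp add: subst_shift_def)
  have "diag c (subst_shift f) $ N = (\<Sum>i\<le>N. of_nat (N choose i) * c ^ i * (-1) ^ (N - i) * f $ N)"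
    unfolding diag_def fps_nth_Abs_fps by (intro sum.cong refl *) simp
  with binom show "diag c (subst_shift f) $ N = dilate (c - 1) f $ N"
    by (simp add: dilate_def sum_distrib_right)
qed

text \<open>The Gamma quotient of \<open>rho\<close> with real coefficients, before X and Y enter,
  nested like \<open>zeta_series\<close>.\<close>

definition gquot :: "real fps fps fps" where
  "gquot = fps_const (subst_plain gamma_fps) * coeffwise fps_const (subst_shift gamma_fps) *
     coeffwise fps_const (subst_plain (inverse gamma_fps)) * fps_const (subst_shift (inverse gamma_fps))"

lemma specialize_coeffwise_const: "specialize a b (coeffwise fps_const F) = diag b F"
proof -
  have "coeffwise (diag a) (coeffwise fps_const F) = F"
    by (rule fps_ext) (simp add: diag_const)
  then show ?thesis by (simp add: specialize_def)
qed

text \<open>Dualizing x^a v y^b gives x^b v' y^a with v' dual to v, hence the exchanged indices.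
  Negative multiples of T suffice to identify the formal series, since there are infinitely
  many.\<close>

lemma zeta_series_dual:
  assumes "admissible v"
  shows "Abs_fps (\<lambda>b. Abs_fps (\<lambda>a. zeta_series (dual v) $ a $ b)) = gquot * zeta_series v"
proof (rule specialize_inject)
  show "infinite {..<0 :: real}" by (rule infinite_Iio)
  fix a b :: real assume ab: "a \<in> {..<0}" "b \<in> {..<0}"
  have inv: "dilate c gamma_fps * dilate c (inverse gamma_fps) = 1" for c
    by (simp add: dilate_mult[symmetric] inverse_mult_eq_1' gamma_fps_0 dilate_1)
  have g: "specialize a b gquot = dilate a gamma_fps * dilate (b - 1) gamma_fps * dilate b (inverse gamma_fps) * dilate (a - 1) (inverse gamma_fps)"
    by (simp add: gquot_def specialize_mult specialize_const specialize_coeffwise_const diag_subst_plain diag_subst_shift)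
  have "specialize a b (Abs_fps (\<lambda>b. Abs_fps (\<lambda>a. zeta_series (dual v) $ a $ b))) = specialize b a (zeta_series (dual v))"
    by (rule specialize_swap)
  also have "\<dots> = specialize b a (zeta_series (dual v)) * ((dilate b gamma_fps * dilate b (inverse gamma_fps)) *
      (dilate (a - 1) gamma_fps * dilate (a - 1) (inverse gamma_fps)))"
    by (simp add: inv)
  also have "\<dots> = (specialize b a (zeta_series (dual v)) * (dilate b gamma_fps * dilate (a - 1) gamma_fps)) *
      (dilate b (inverse gamma_fps) * dilate (a - 1) (inverse gamma_fps))"
    by (simp only: mult_ac)
  also have "specialize b a (zeta_series (dual v)) * (dilate b gamma_fps * dilate (a - 1) gamma_fps) =
      (dilate a gamma_fps * dilate (b - 1) gamma_fps) * specialize a b (zeta_series v)"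
    using specialize_duality[OF assms, of "- a" "- b"] ab by simp
  also have "\<dots> * (dilate b (inverse gamma_fps) * dilate (a - 1) (inverse gamma_fps)) = specialize a b (gquot * zeta_series v)"
    unfolding specialize_mult g by (simp only: mult_ac)
  finally show "specialize a b (Abs_fps (\<lambda>b. Abs_fps (\<lambda>a. zeta_series (dual v) $ a $ b))) = specialize a b (gquot * zeta_series v)" .
qed

section \<open>Assembling the identity\<close>

lemma sum_sigma_words_conv_left:
  fixes g :: "letter list \<Rightarrow> 'a::comm_ring_1"
  assumes "u = [] \<or> hd u = LY"
  shows "(\<Sum>z\<leftarrow>sigma_words n (replicate a LX @ u). conv (power_char LX e) g z) =
    (\<Sum>i\<le>a. e i * (\<Sum>z\<leftarrow>sigma_words n (replicate (a - i) LX @ u). g z))"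
proof -
  have sigma_words: "sigma_words n (replicate a LX @ u) = map (\<lambda>z. replicate a LX @ z) (sigma_words n u)" for a
    by (induction a) (simp_all add: sigma_words_Cons_LX comp_def)
  have "z = [] \<or> hd z \<noteq> LX" if "z \<in> set (sigma_words n u)" for z
  proof (cases "u = []")
    case False
    then obtain u' where "u = LY # u'" using assms by (cases u) auto
    then show ?thesis using sigma_words_Cons_LY[of z n u'] that by auto
  qed (use that in \<open>auto split: if_splits\<close>)
  then have "map (\<lambda>z. conv (power_char LX e) g (replicate a LX @ z)) (sigma_words n u) =
      map (\<lambda>z. \<Sum>i\<le>a. e i * g (replicate (a - i) LX @ z)) (sigma_words n u)"
    by (intro map_cong refl conv_power_char_left)
  then have "(\<Sum>z\<leftarrow>sigma_words n (replicate a LX @ u). conv (power_char LX e) g z) =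
      (\<Sum>z\<leftarrow>sigma_words n u. \<Sum>i\<le>a. e i * g (replicate (a - i) LX @ z))"
    by (simp only: sigma_words map_map comp_def)
  also have "\<dots> = (\<Sum>i\<le>a. \<Sum>z\<leftarrow>sigma_words n u. e i * g (replicate (a - i) LX @ z))"
  proof (induction "sigma_words n u")
    case (Cons z zs)
    have "(\<Sum>z\<leftarrow>xs. \<Sum>i\<le>a. e i * g (replicate (a - i) LX @ z)) =
        (\<Sum>i\<le>a. \<Sum>z\<leftarrow>xs. e i * g (replicate (a - i) LX @ z))" for xs
      by (induction xs) (simp_all add: sum.distrib)
    then show ?case .
  qed simp
  finally show ?thesis by (simp add: sigma_words comp_def sum_list_const_mult)
qed

lemma admissible_replicate:
  assumes "admissible v"
  shows "replicate a LX @ v = [] \<or> last (replicate a LX @ v) = LX"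
    and "v @ replicate b LY = [] \<or> hd (v @ replicate b LY) = LY"
  using assms by (cases "v = []"; cases a; cases b;
    auto simp: admissible_def replicate_append_same[symmetric] simp del: replicate.simps)+

text \<open>As series in A and B: the regularization with values P and Q multiplies
  \<open>zeta_series v\<close> by exp(A P + B Q).\<close>

lemma sum_sigma_words_Zword:
  assumes "admissible v"
  shows "(\<Sum>z\<leftarrow>sigma_words n (replicate a LX @ v @ replicate b LY). Zword P Q z) =
    (\<Sum>i\<le>a. \<Sum>j\<le>b. divpow P i * divpow Q j * [:[:zeta_series v $ (b - j) $ (a - i) $ n:]:])"
proof -
  have "(\<Sum>z\<leftarrow>xs. Zreg_poly z) = [:[:\<Sum>z\<leftarrow>xs. Zreg z:]:]" for xs
    by (induction xs) (simp_all add: Zreg_poly_def)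
  then have Z: "(\<Sum>z\<leftarrow>sigma_words n (replicate a LX @ v @ replicate b LY). Zreg_poly z) = [:[:zeta_series v $ b $ a $ n:]:]" for a b
    by (simp add: zeta_series_def Zreg_sigma_def)
  have "(\<Sum>z\<leftarrow>sigma_words n (replicate a LX @ v @ replicate b LY). Zword P Q z) =
      (\<Sum>i\<le>a. divpow P i * (\<Sum>z\<leftarrow>sigma_words n ((replicate (a - i) LX @ v) @ replicate b LY). conv Zreg_poly (power_char LY (divpow Q)) z))"
    unfolding Zword_def using admissible_replicate(2)[OF assms] by (subst sum_sigma_words_conv_left) simp_all
  also have "\<dots> = (\<Sum>i\<le>a. divpow P i * (\<Sum>j\<le>b. (\<Sum>z\<leftarrow>sigma_words n ((replicate (a - i) LX @ v) @ replicate (b - j) LY). Zreg_poly z) * divpow Q j))"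
    by (intro sum.cong refl arg_cong2[of _ _ _ _ "(*)"] sum_sigma_words_conv_right admissible_replicate(1)[OF assms])
  also have "\<dots> = (\<Sum>i\<le>a. \<Sum>j\<le>b. divpow P i * divpow Q j * [:[:zeta_series v $ (b - j) $ (a - i) $ n:]:])"
    by (simp add: Z sum_distrib_left mult_ac)
  finally show ?thesis .
qed

lemma Zsh_sigma_map_word:
  "Zsh P Q (sigma_map (word w) $ n) = (\<Sum>z\<leftarrow>sigma_words n w. Zword P Q z)"
  by (simp add: Zsh_eq sigma_map_word_nth qc.lin_ext_sum_list comp_def)

lemma divpow_pX_pY: "divpow pX i * divpow pY j = exp_coeff i j"
proof -
  have X: "pX ^ i = [:monom 1 i:]" for i
    by (induction i) (simp_all add: pX_def one_pCons monom_Suc[of 1] pCons_one[symmetric] monom_0 del: pCons_one)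
  have Y: "pY ^ j = monom 1 j" for j
    by (induction j) (simp_all add: pY_def one_pCons[symmetric] monom_Suc)
  show ?thesis
    by (simp add: divpow_def X Y exp_coeff_def smult_monom)
qed

lemma is_rho_rho: "is_rho rho"
  unfolding rho_def using ex1_is_rho by (rule theI')

lemma rho_add: "rho (p + q) = rho p + rho q"
  and rho_smult: "rho (smult [:c:] p) = smult [:fps_const c:] (rho p)"
  and rho_exp: "coeffwise (coeffwise rho) exp_series =
       gamma_quot * coeffwise (coeffwise (map_poly (map_poly fps_const))) exp_series"
  using is_rho_rho by (auto simp: is_rho_def)

lemma rho_0: "rho 0 = 0"
  using rho_smult[of 0 0] by simp

lemma rho_sum: "rho (sum f A) = (\<Sum>i\<in>A. rho (f i))"
  by (induction A rule: infinite_finite_induct) (simp_all add: rho_0 rho_add)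

lemma coeffwise_mult:
  assumes "f 0 = 0" "\<And>x y. f (x + y) = f x + f y" "\<And>x y. f (x * y) = f x * f y"
  shows "coeffwise f (F * G) = coeffwise f F * coeffwise f G"
proof (rule fps_ext)
  fix n
  have "f (sum g A) = (\<Sum>i\<in>A. f (g i))" for g :: "nat \<Rightarrow> _" and A
    using assms by (induction A rule: infinite_finite_induct) simp_all
  then show "coeffwise f (F * G) $ n = (coeffwise f F * coeffwise f G) $ n"
    by (simp add: fps_mult_nth assms)
qed

lemma coeffwise_add:
  assumes "\<And>x y. f (x + y) = f x + f y"
  shows "coeffwise f (F + G) = coeffwise f F + coeffwise f G"
  by (rule fps_ext) (simp add: assms)

lemma coeffwise_0: "f 0 = 0 \<Longrightarrow> coeffwise f 0 = 0"
  by (rule fps_ext) simp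

definition pconst :: "'a::comm_ring_1 \<Rightarrow> 'a poly poly" where
  "pconst c = [:[:c:]:]"

lemma pconst_hom: "pconst 0 = 0" "pconst (x + y) = pconst x + pconst y" "pconst (x * y) = pconst x * pconst y"
  by (simp_all add: pconst_def)

lemma gamma_quot_eq: "gamma_quot = coeffwise (coeffwise pconst) gquot"
proof -
  have h1: "coeffwise pconst 0 = 0" "coeffwise pconst (F + G) = coeffwise pconst F + coeffwise pconst G"
    "coeffwise pconst (F * G) = coeffwise pconst F * coeffwise pconst G" for F G :: "real fps fps"
    by (simp_all add: coeffwise_0 coeffwise_add coeffwise_mult pconst_hom)
  have A: "coeffwise (coeffwise pconst) (fps_const F) = in_A F" for F
    unfolding in_A_def pconst_def[abs_def, symmetric] by (rule fps_ext) (simp add: h1(1))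
  have "coeffwise pconst (fps_const c) = fps_const (pconst c)" for c :: "real fps"
    by (rule fps_ext) (simp add: pconst_hom)
  then have B: "coeffwise (coeffwise pconst) (coeffwise fps_const F) = in_B F" for F
    by (intro fps_ext) (simp add: in_B_def pconst_def)
  show ?thesis
    unfolding gquot_def gamma_quot_def coeffwise_mult[OF h1] A B by (simp only: mult_ac)
qed

lemma rho_exp_coeff:
  "rho (exp_coeff i j) = (\<Sum>j'\<le>j. \<Sum>i'\<le>i. pconst (gquot $ j' $ i') *
     map_poly (map_poly fps_const) (exp_coeff (i - i') (j - j')))"
proof -
  have "rho (exp_coeff i j) = coeffwise (coeffwise rho) exp_series $ j $ i"
    by (simp add: exp_series_def)
  also have "\<dots> = (\<Sum>j'\<le>j. \<Sum>i'\<le>i. pconst (gquot $ j' $ i') *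
     map_poly (map_poly fps_const) (exp_coeff (i - i') (j - j')))"
    unfolding rho_exp gamma_quot_eq
    by (simp add: fps_mult_nth atLeast0AtMost fps_sum_nth exp_series_def)
  finally show ?thesis .
qed

definition tcoeff :: "nat \<Rightarrow> real fps poly poly \<Rightarrow> real poly poly" where
  "tcoeff m p = map_poly (map_poly (\<lambda>c. c $ m)) p"

lemma coeff_tcoeff: "coeff (coeff (tcoeff m p) i) k = coeff (coeff p i) k $ m"
  by (simp add: tcoeff_def coeff_map_poly)

lemma poly_poly_eqI: "(\<And>i k. coeff (coeff p i) k = coeff (coeff q i) k) \<Longrightarrow> p = q"
  by (intro poly_eqI)

lemma tcoeff_add: "tcoeff m (p + q) = tcoeff m p + tcoeff m q"
  by (rule poly_poly_eqI) (simp add: coeff_tcoeff)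

lemma tcoeff_sum: "tcoeff m (sum f A) = (\<Sum>i\<in>A. tcoeff m (f i))"
proof -
  have "tcoeff m 0 = 0" by (simp add: tcoeff_def)
  then show ?thesis
    by (induction A rule: infinite_finite_induct) (simp_all add: tcoeff_add)
qed

lemma tcoeff_pconst_mult:
  "tcoeff m (pconst g * map_poly (map_poly fps_const) q) = pconst (g $ m) * q"
  by (rule poly_poly_eqI) (simp add: coeff_tcoeff pconst_def coeff_map_poly)

lemma tcoeff_smult: "tcoeff m (smult [:fps_const c:] p) = smult [:c:] (tcoeff m p)"
  by (rule poly_poly_eqI) (simp add: coeff_tcoeff)

lemma rho_T_nth: "rho_T F $ n = (\<Sum>k\<le>n. tcoeff (n - k) (rho (F $ k)))"
  by (simp add: rho_T_def series_of_poly_def tcoeff_def)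

text \<open>Places scalar series in the commutative ring that also contains exp(AX + BY), so that
  all factors can be regrouped freely.\<close>

definition poly_lift :: "real fps fps fps \<Rightarrow> real poly poly fps fps fps" where
  "poly_lift F = coeffwise (coeffwise (coeffwise pconst)) F"

lemma poly_lift_mult: "poly_lift (F * G) = poly_lift F * poly_lift G"
  unfolding poly_lift_def
  by (intro coeffwise_mult coeffwise_0 coeffwise_add pconst_hom)

lemma poly_lift_nth: "poly_lift F $ b $ a $ n = pconst (F $ b $ a $ n)"
  by (simp add: poly_lift_def)

definition exp_terms :: "real poly poly fps fps fps" where
  "exp_terms = Abs_fps (\<lambda>b. Abs_fps (\<lambda>a. fps_const (exp_coeff a b)))"

lemma tcoeff_rho_exp_coeff: "tcoeff m (rho (exp_coeff i j)) = (poly_lift gquot * exp_terms) $ j $ i $ m"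
  unfolding rho_exp_coeff tcoeff_sum tcoeff_pconst_mult
  by (simp add: fps_mult_nth[of _ _ j] fps_mult_nth[of _ _ i] atLeast0AtMost fps_sum_nth exp_terms_def poly_lift_nth)

lemma mult_nth3:
  fixes F G :: "'a::comm_ring_1 fps fps fps"
  shows "(F * G) $ b $ a $ n = (\<Sum>j\<le>b. \<Sum>i\<le>a. \<Sum>k\<le>n. G $ (b - j) $ (a - i) $ k * F $ j $ i $ (n - k))"
proof -
  have 1: "(F * G) $ b = (\<Sum>j\<le>b. F $ j * G $ (b - j))"
    by (simp add: fps_mult_nth atLeast0AtMost)
  have 2: "(f * g) $ a = (\<Sum>i\<le>a. f $ i * g $ (a - i))" for f g :: "'a fps fps"
    by (simp add: fps_mult_nth atLeast0AtMost)
  have 3: "(f * g) $ n = (\<Sum>k\<le>n. g $ k * f $ (n - k))" for f g :: "'a fps"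
    by (subst mult.commute) (simp add: fps_mult_nth atLeast0AtMost)
  show ?thesis by (simp only: 1 2 3 fps_sum_nth)
qed

lemma tau_map_word: "tau_map (word w) = word (dual w)"
  by (simp add: word_def tau_map_single dual_def scal_def mult_single plus_list_def)

lemma word_decomp: "\<exists>a v b. w = replicate a LX @ v @ replicate b LY \<and> admissible v"
proof -
  define a where "a = length (takeWhile ((=) LX) w)"
  define u where "u = dropWhile ((=) LX) w"
  have "takeWhile ((=) LX) w = replicate a LX"
    unfolding a_def by (rule replicate_length_same[symmetric]) (auto dest: set_takeWhileD)
  then have w: "w = replicate a LX @ u" unfolding u_def by (metis takeWhile_dropWhile_id)
  have u: "u = [] \<or> hd u = LY"
    using hd_dropWhile[of "(=) LX" w] by (cases "hd u") (auto simp: u_def)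
  show ?thesis
  proof (cases u rule: word_split_LY)
    case (1 b)
    then have "w = replicate a LX @ [] @ replicate b LY \<and> admissible []"
      using w by (simp add: admissible_def)
    then show ?thesis by blast
  next
    case (2 b u')
    then have "w = replicate a LX @ (u' @ [LX]) @ replicate b LY \<and> admissible (u' @ [LX])"
      using w u by (cases u') (auto simp: admissible_def)
    then show ?thesis by blast
  qed
qed

lemma dual_append: "dual (u @ v) = dual v @ dual u"
  and dual_replicate: "dual (replicate n q) = replicate n (swap_letter q)"
  by (simp_all add: dual_def)

text \<open>Both sides are the coefficient of A^a B^b T^n in the product of exp(AX + BY), the Gamma
  quotient and the generating series of v. On the left, exchanging X and Y matches the exchange of a
  and b under duality.\<close>

lemma theorem1p3_word:
  "Zsh pY pX (sigma_map (tau_map (word w)) $ n) = rho_T (coeffwise (Zsh pX pY) (sigma_map (word w))) $ n"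
proof -
  obtain a v b where w: "w = replicate a LX @ v @ replicate b LY" and v: "admissible v"
    using word_decomp by blast
  have dw: "dual w = replicate b LX @ dual v @ replicate a LY"
    by (simp add: w dual_append dual_replicate)
  have dual: "zeta_series (dual v) $ a $ b = (gquot * zeta_series v) $ b $ a" for a b
    unfolding zeta_series_dual[OF v, symmetric] by simp
  have "Zsh pY pX (sigma_map (tau_map (word w)) $ n) =
      (\<Sum>i\<le>b. \<Sum>j\<le>a. divpow pY i * divpow pX j * pconst (zeta_series (dual v) $ (a - j) $ (b - i) $ n))"
    unfolding tau_map_word Zsh_sigma_map_word dw sum_sigma_words_Zword[OF admissible_dual[OF v]] pconst_def ..
  also have "\<dots> = (\<Sum>i\<le>b. \<Sum>j\<le>a. exp_coeff j i * poly_lift (gquot * zeta_series v) $ (b - i) $ (a - j) $ n)"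
    by (simp only: dual poly_lift_nth mult.commute[of "divpow pY _"] divpow_pX_pY)
  also have "\<dots> = (exp_terms * poly_lift (gquot * zeta_series v)) $ b $ a $ n"
    by (simp add: fps_mult_nth[of _ _ b] fps_mult_nth[of _ _ a] atLeast0AtMost fps_sum_nth exp_terms_def)
  \<comment> \<open>Regrouping the Gamma quotient with the exponential instead of the zeta series
    turns duality into the action of \<open>rho\<close>.\<close>
  also have "exp_terms * poly_lift (gquot * zeta_series v) = poly_lift (zeta_series v) * (poly_lift gquot * exp_terms)"
    by (simp only: poly_lift_mult mult_ac)
  also have "\<dots> $ b $ a $ n = (\<Sum>j\<le>b. \<Sum>i\<le>a. \<Sum>k\<le>n.
      poly_lift (zeta_series v) $ (b - j) $ (a - i) $ k * (poly_lift gquot * exp_terms) $ j $ i $ (n - k))"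
    by (subst mult.commute) (rule mult_nth3)
  also have "\<dots> = (\<Sum>k\<le>n. \<Sum>i\<le>a. \<Sum>j\<le>b.
      poly_lift (zeta_series v) $ (b - j) $ (a - i) $ k * (poly_lift gquot * exp_terms) $ j $ i $ (n - k))"
    by (subst sum.swap, subst (2) sum.swap, subst sum.swap) (rule refl)
  also have "\<dots> = rho_T (coeffwise (Zsh pX pY) (sigma_map (word w))) $ n"
  proof -
    have "tcoeff (n - k) (rho (Zsh pX pY (sigma_map (word w) $ k))) = (\<Sum>i\<le>a. \<Sum>j\<le>b.
      poly_lift (zeta_series v) $ (b - j) $ (a - i) $ k * (poly_lift gquot * exp_terms) $ j $ i $ (n - k))" for k
    proof -
      have "Zsh pX pY (sigma_map (word w) $ k) =
          (\<Sum>i\<le>a. \<Sum>j\<le>b. smult [:zeta_series v $ (b - j) $ (a - i) $ k:] (exp_coeff i j))"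
        unfolding Zsh_sigma_map_word w sum_sigma_words_Zword[OF v] divpow_pX_pY by simp
      then show ?thesis
        by (simp add: rho_sum rho_smult tcoeff_sum tcoeff_smult tcoeff_rho_exp_coeff poly_lift_nth pconst_def)
    qed
    then show ?thesis by (simp add: rho_T_nth)
  qed
  finally show ?thesis .
qed

theorem theorem1p3:
  fixes w :: ncpoly
  shows "coeffwise (Zsh pY pX) (sigma_map (tau_map w)) = rho_T (coeffwise (Zsh pX pY) (sigma_map w))"
proof (rule fps_ext)
  fix n
  have Zadd: "Zsh P Q (p + q) = Zsh P Q p + Zsh P Q q" for P Q p q
    by (simp add: Zsh_eq qc.lin_ext_add)
  have Zscal: "Zsh P Q (scal c * p) = smult [:of_rat c:] (Zsh P Q p)" for P Q c p
    by (simp add: Zsh_eq qc.lin_ext_scal_mult qconst_def)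
  have sigma_words: "sigma_map (scal c * p) = fps_const (scal c) * sigma_map p" for c p
    by (simp add: sigma_map_mult) (simp add: scal_def sigma_map_single)
  have tau: "tau_map (scal c * p) = scal c * tau_map p" for c p
  proof -
    have "tau_map (scal c) = scal c"
      using tau_map_single[of "[]" c] by (simp add: scal_def[symmetric] word_Nil)
    then show ?thesis by (simp add: tau_map_mult scal_commute)
  qed
  have smult_sum: "smult c (sum f A) = (\<Sum>i\<in>A. smult c (f i))" for c :: "real poly" and f :: "nat \<Rightarrow> _" and A
    by (induction A rule: infinite_finite_induct) (simp_all add: smult_add_right)
  show "coeffwise (Zsh pY pX) (sigma_map (tau_map w)) $ n = rho_T (coeffwise (Zsh pX pY) (sigma_map w)) $ n"
  proof (induction w rule: poly_mapping_additive_induct)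
    case (single u c)
    show ?case
      using theorem1p3_word[of u n]
      unfolding scal_mult_word[symmetric] rho_T_nth
      by (simp add: tau sigma_words Zscal rho_smult tcoeff_smult smult_sum)
  next
    case (add p q)
    then show ?case
      by (simp add: tau_map_add sigma_map_add Zadd rho_T_nth rho_add tcoeff_add sum.distrib)
  qed
qed

end
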